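(* Let $p$ be a prime, let $F(A)$ be the free group over a finite alphabet $A$, and let $H$ be a finitely generated subgroup of $F(A)$. Then the $\mathbf{H}_p$-closure $Cl_{\mathbf{H}_p}(H)$ of $H$ in $F(A)$ is an overgroup of $H$ (with respect to $A$), that is, $Cl_{\mathbf{H}_p}(H)\in\mathcal{O}_A(H)$.
   Context: A variety is a class of finite groups closed under taking subgroups, homomorphic images and (finite) direct products. The product $\mathbf{U}*\mathbf{V}$ of two varieties consists of all finite groups $G$ having a normal subgroup $N\in\mathbf{U}$ with $G/N\in\mathbf{V}$. For a prime $p$, $\mathbf{G}_p$ is the variety of all finite $p$-groups; $\mathbf{Ab}_d$ is the variety of all finite abelian groups of exponent dividing $d$; and $\mathbf{H}_p=\mathbf{G}_p*\mathbf{Ab}_{p-1}$. For a variety $\mathbf{V}$, the pro-$\mathbf{V}$ topology on a group $F$ is the topology having as a basis of open sets all cosets $Kx$, where $x\in F$ and $K$ ranges over the normal subgroups of $F$ with $F/K\in\mathbf{V}$. The $\mathbf{V}$-closure $Cl_{\mathbf{V}}(S)$ of a subset $S\subseteq F$ is its closure in this topology. An $A$-labeled graph is a directed graph whose underlying undirected graph is connected, with a chosen base vertex (marked $1$), and with each edge labeled by a letter of $A$. It is reduced if different edges with the same origin (resp. with the same terminus) have different labels, and each vertex except the base vertex is adjacent to at least two different edges. Paths may traverse edges backwards; the label of a path is the word obtained by concatenating $a$ for each edge labeled $a$ crossed forwards and $a^{-1}$ for each edge labeled $a$ crossed backwards; a path is reduced if its label is a reduced word. For a reduced $A$-labeled graph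 $\Gamma$, $L(\Gamma)\le F(A)$ is the subgroup of all labels of reduced paths from the base vertex to itself. The map $\Gamma\mapsto L(\Gamma)$ is a one-to-one correspondence (up to isomorphism of $A$-labeled graphs) between finite reduced $A$-labeled graphs and finitely generated subgroups of $F(A)$; the finite reduced $A$-labeled graph corresponding to a finitely generated subgroup $H$ is denoted $\Gamma_A(H)$ (so $L(\Gamma_A(H))=H$). A morphism of reduced $A$-labeled graphs is a map sending base vertex to base vertex, vertices to vertices and edges to edges, preserving origins, termini and labels of edges. For finitely generated subgroups $H,K$ of $F(A)$, a morphism $\Gamma_A(H)\to\Gamma_A(K)$ exists if and only if $H\le K$, and it is then unique; it is denoted $\phi_{H,K}$. A finitely generated subgroup $K$ is an overgroup of $H$ (with respect to $A$) if $\phi_{H,K}$ exists and is surjective on both vertices and edges. The set of all overgroups of $H$ is denoted $\mathcal{O}_A(H)$. *)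

theory Defs
  imports
    "HOL-Analysis.Abstract_Topology"
    "HOL-Algebra.Generated_Groups"
    "HOL-Computational_Algebra.Primes"
    "Graph_Theory.Digraph_Component"
begin

section \<open>Free groups\<close>

text \<open>A letter \<open>(a, True)\<close> stands for \<open>a\<close> and \<open>(a, False)\<close> for its formal inverse.  The elements
  of the free group are the freely reduced words.\<close>

type_synonym 'a word = "('a \<times> bool) list"

definition inv_letter :: "'a \<times> bool \<Rightarrow> 'a \<times> bool" where
  "inv_letter l = (fst l, \<not> snd l)"

definition reduced_word :: "'a word \<Rightarrow> bool" where
  "reduced_word w \<longleftrightarrow> successively (\<lambda>l m. m \<noteq> inv_letter l) w"

fun cancel_cons :: "'a \<times> bool \<Rightarrow> 'a word \<Rightarrow> 'a word" where
  "cancel_cons l [] = [l]"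
| "cancel_cons l (m # w) = (if m = inv_letter l then w else l # m # w)"

definition reduce :: "'a word \<Rightarrow> 'a word" where
  "reduce w = foldr cancel_cons w []"

definition free_group :: "'a set \<Rightarrow> 'a word monoid" where
  "free_group A = \<lparr>carrier = {w. reduced_word w \<and> fst ` set w \<subseteq> A},
                   monoid.mult = (\<lambda>u v. reduce (u @ v)), one = []\<rparr>"

lemma inv_letter_inv_letter [simp]: "inv_letter (inv_letter l) = l"
  by (simp add: inv_letter_def)

lemma inv_letter_eq_iff: "m = inv_letter l \<longleftrightarrow> l = inv_letter m"
  by auto

lemma fst_inv_letter [simp]: "fst (inv_letter l) = fst l"
  by (simp add: inv_letter_def)

lemma reduced_word_Nil [simp]: "reduced_word []"
  by (simp add: reduced_word_def)

lemma reduced_word_Cons: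
  "reduced_word (l # w) \<longleftrightarrow> w = [] \<or> hd w \<noteq> inv_letter l \<and> reduced_word w"
  by (auto simp: reduced_word_def successively_Cons)

lemma reduced_cancel_cons: "reduced_word w \<Longrightarrow> reduced_word (cancel_cons l w)"
  by (cases w) (auto simp: reduced_word_Cons)

lemma reduced_foldr: "reduced_word z \<Longrightarrow> reduced_word (foldr cancel_cons w z)"
  by (induction w) (auto simp: reduced_cancel_cons)

lemma reduced_reduce [simp]: "reduced_word (reduce w)"
  by (simp add: reduce_def reduced_foldr)

lemma cancel_cons_reduced: "reduced_word (l # w) \<Longrightarrow> cancel_cons l w = l # w"
  by (cases w) (auto simp: reduced_word_Cons)

lemma reduce_reduced: "reduced_word w \<Longrightarrow> reduce w = w"
proof (induction w)
  case (Cons l w)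
  then have "reduced_word w" by (auto simp: reduced_word_Cons)
  with Cons show ?case by (simp add: reduce_def cancel_cons_reduced)
qed (simp add: reduce_def)

lemma cancel_cons_inverse:
  assumes "reduced_word z"
  shows "cancel_cons l (cancel_cons (inv_letter l) z) = z"
proof (cases z)
  case (Cons m w)
  show ?thesis
  proof (cases "m = l")
    case True
    then show ?thesis using Cons assms by (simp add: cancel_cons_reduced)
  qed (use Cons in auto)
qed auto

lemma foldr_cancel_cons:
  assumes "reduced_word z"
  shows "foldr cancel_cons (cancel_cons l w) z = cancel_cons l (foldr cancel_cons w z)"
proof (cases w)
  case (Cons m w')
  show ?thesis
    using cancel_cons_inverse[OF reduced_foldr[OF assms], of l w'] Cons by auto
qed auto

lemma foldr_reduce:
  "reduced_word z \<Longrightarrow> foldr cancel_cons (reduce w) z = foldr cancel_cons w z"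
  by (induction w) (auto simp: reduce_def foldr_cancel_cons)

lemma reduce_append_left [simp]: "reduce (reduce u @ v) = reduce (u @ v)"
  using foldr_reduce[OF reduced_reduce[of v], of u] by (simp add: reduce_def)

lemma reduce_append_right [simp]: "reduce (u @ reduce v) = reduce (u @ v)"
  using reduce_reduced[OF reduced_reduce[of v]] by (simp add: reduce_def)

lemma letters_cancel_cons: "fst ` set (cancel_cons l w) \<subseteq> insert (fst l) (fst ` set w)"
  by (cases w) auto

lemma letters_reduce: "fst ` set (reduce w) \<subseteq> fst ` set w"
proof (induction w)
  case (Cons l w)
  then show ?case
    using letters_cancel_cons[of l "reduce w"]
    by (simp add: reduce_def) (meson insert_mono order_trans)
qed (simp add: reduce_def)

lemma reduce_inverse_append: "reduce (rev (map inv_letter w) @ w) = []"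
proof (induction w)
  case (Cons l w)
  have "reduce (rev (map inv_letter (l # w)) @ l # w)
      = reduce (rev (map inv_letter w) @ reduce ([inv_letter l, l] @ w))"
    unfolding reduce_append_right by simp
  also have "reduce ([inv_letter l, l] @ w) = reduce w"
    using cancel_cons_inverse[OF reduced_reduce, of "inv_letter l" w] by (simp add: reduce_def)
  finally show ?case using Cons by simp
qed (simp add: reduce_def)

lemma group_free_group: "group (free_group A)"
proof (rule groupI)
  fix x y assume "x \<in> carrier (free_group A)" "y \<in> carrier (free_group A)"
  then show "x \<otimes>\<^bsub>free_group A\<^esub> y \<in> carrier (free_group A)"
    using order_trans[OF letters_reduce[of "x @ y"]] by (simp add: free_group_def image_Un)
next
  fix x assume x: "x \<in> carrier (free_group A)"
  let ?y = "reduce (rev (map inv_letter x))"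
  have "?y \<in> carrier (free_group A)"
    using x letters_reduce[of "rev (map inv_letter x)"] by (fastforce simp: free_group_def)
  moreover have "?y \<otimes>\<^bsub>free_group A\<^esub> x = \<one>\<^bsub>free_group A\<^esub>"
    by (simp add: free_group_def reduce_inverse_append)
  ultimately show "\<exists>y\<in>carrier (free_group A). y \<otimes>\<^bsub>free_group A\<^esub> x = \<one>\<^bsub>free_group A\<^esub>"
    by blast
qed (auto simp: free_group_def reduce_reduced)

definition fin_gen_subgroup :: "'g set \<Rightarrow> ('g, 'm) monoid_scheme \<Rightarrow> bool" where
  "fin_gen_subgroup H F \<longleftrightarrow> subgroup H F \<and> (\<exists>S. finite S \<and> S \<subseteq> carrier F \<and> H = generate F S)"


section \<open>Varieties of finite groups and their topologies\<close>

text \<open>A class of finite groups is rendered as a predicate on groups.  In the product, the two factors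
  are applied to groups with different carrier types (a subgroup and a quotient).\<close>

definition var_Gp :: "nat \<Rightarrow> 'g monoid \<Rightarrow> bool" where
  "var_Gp p G \<longleftrightarrow> group G \<and> finite (carrier G) \<and> (\<exists>n. order G = p ^ n)"

definition var_Ab :: "nat \<Rightarrow> 'g monoid \<Rightarrow> bool" where
  "var_Ab d G \<longleftrightarrow> comm_group G \<and> finite (carrier G) \<and> (\<forall>x\<in>carrier G. x [^]\<^bsub>G\<^esub> d = \<one>\<^bsub>G\<^esub>)"

definition var_prod :: "('g monoid \<Rightarrow> bool) \<Rightarrow> ('g set monoid \<Rightarrow> bool) \<Rightarrow> 'g monoid \<Rightarrow> bool" where
  "var_prod U V G \<longleftrightarrow> group G \<and> finite (carrier G) \<and>
     (\<exists>N. N \<lhd> G \<and> U (G\<lparr>carrier := N\<rparr>) \<and> V (G Mod N))"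

definition var_H :: "nat \<Rightarrow> 'g monoid \<Rightarrow> bool" where
  "var_H p = var_prod (var_Gp p) (var_Ab (p - 1))"

definition pro_cosets :: "('g set monoid \<Rightarrow> bool) \<Rightarrow> 'g monoid \<Rightarrow> 'g set set" where
  "pro_cosets V F = {K #>\<^bsub>F\<^esub> x | K x. K \<lhd> F \<and> V (F Mod K) \<and> x \<in> carrier F}"

text \<open>\<open>topology_generated_by\<close> treats the cosets as a subbase; for the variety used here they are in
  fact a base, see \<open>openin_pro_topology_var_H\<close> below.\<close>

definition pro_topology :: "('g set monoid \<Rightarrow> bool) \<Rightarrow> 'g monoid \<Rightarrow> 'g topology" where
  "pro_topology V F = topology_generated_by (pro_cosets V F)"

definition pro_closure :: "('g set monoid \<Rightarrow> bool) \<Rightarrow> 'g monoid \<Rightarrow> 'g set \<Rightarrow> 'g set" where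
  "pro_closure V F S = pro_topology V F closure_of S"

lemma FactGroup_var_Ab_iff:
  assumes "N \<lhd> G"
  shows "var_Ab d (G Mod N) \<longleftrightarrow> finite (carrier (G Mod N)) \<and>
     (\<forall>x\<in>carrier G. \<forall>y\<in>carrier G. (x \<otimes>\<^bsub>G\<^esub> y) \<otimes>\<^bsub>G\<^esub> inv\<^bsub>G\<^esub> (y \<otimes>\<^bsub>G\<^esub> x) \<in> N) \<and>
     (\<forall>x\<in>carrier G. x [^]\<^bsub>G\<^esub> d \<in> N)"
proof -
  interpret N: normal N G by fact
  interpret Q: group "G Mod N" by (rule N.factorgroup_is_group)
  have eq: "N #>\<^bsub>G\<^esub> x = N #>\<^bsub>G\<^esub> y \<longleftrightarrow> x \<otimes>\<^bsub>G\<^esub> inv\<^bsub>G\<^esub> y \<in> N" if "x \<in> carrier G" "y \<in> carrier G" for x y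
    using that by (metis N.is_subgroup N.rcos_module N.rcos_self N.repr_independence N.is_group)
  have eq1: "N #>\<^bsub>G\<^esub> x = N \<longleftrightarrow> x \<in> N" if "x \<in> carrier G" for x
    using that by (metis N.coset_join2 N.is_subgroup N.rcos_self)
  have car: "carrier (G Mod N) = (\<lambda>x. N #>\<^bsub>G\<^esub> x) ` carrier G"
    by (auto simp: FactGroup_def RCOSETS_def)
  have pow: "(N #>\<^bsub>G\<^esub> x) [^]\<^bsub>G Mod N\<^esub> d = N #>\<^bsub>G\<^esub> (x [^]\<^bsub>G\<^esub> d)" if "x \<in> carrier G" for x
    using that by (rule N.FactGroup_pow)
  have comm: "comm_group (G Mod N) \<longleftrightarrow>
      (\<forall>x\<in>carrier G. \<forall>y\<in>carrier G. (x \<otimes>\<^bsub>G\<^esub> y) \<otimes>\<^bsub>G\<^esub> inv\<^bsub>G\<^esub> (y \<otimes>\<^bsub>G\<^esub> x) \<in> N)"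
  proof -
    have "comm_group (G Mod N) \<longleftrightarrow> (\<forall>X\<in>carrier (G Mod N). \<forall>Y\<in>carrier (G Mod N).
        X \<otimes>\<^bsub>G Mod N\<^esub> Y = Y \<otimes>\<^bsub>G Mod N\<^esub> X)"
      using Q.group_comm_groupI comm_group.axioms(1) comm_monoid.m_comm by metis
    then show ?thesis by (simp add: car N.rcos_sum eq)
  qed
  show ?thesis unfolding var_Ab_def comm by (auto simp: car pow eq1)
qed

lemma var_H_embed:
  fixes G :: "'g monoid" and G\<^sub>1 G\<^sub>2 :: "'h monoid"
  assumes p: "prime p" and G: "group G"
    and f1: "f\<^sub>1 \<in> hom G G\<^sub>1" and f2: "f\<^sub>2 \<in> hom G G\<^sub>2"
    and V1: "var_H p G\<^sub>1" and V2: "var_H p G\<^sub>2"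
    and inj: "inj_on (\<lambda>x. (f\<^sub>1 x, f\<^sub>2 x)) (carrier G)"
  shows "var_H p G"
proof -
  interpret G: group G by fact
  obtain M1 where M1: "M1 \<lhd> G\<^sub>1" "var_Gp p (G\<^sub>1\<lparr>carrier := M1\<rparr>)" "var_Ab (p - 1) (G\<^sub>1 Mod M1)"
    and fin1: "finite (carrier G\<^sub>1)"
    using V1 by (auto simp: var_H_def var_prod_def)
  obtain M2 where M2: "M2 \<lhd> G\<^sub>2" "var_Gp p (G\<^sub>2\<lparr>carrier := M2\<rparr>)" "var_Ab (p - 1) (G\<^sub>2 Mod M2)"
    and fin2: "finite (carrier G\<^sub>2)"
    using V2 by (auto simp: var_H_def var_prod_def)
  interpret M1: normal M1 G\<^sub>1 by fact
  interpret M2: normal M2 G\<^sub>2 by fact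
  interpret f1: group_hom G G\<^sub>1 f\<^sub>1 using f1 by unfold_locales
  interpret f2: group_hom G G\<^sub>2 f\<^sub>2 using f2 by unfold_locales
  let ?f = "\<lambda>x. (f\<^sub>1 x, f\<^sub>2 x)"
  define N where "N = {x \<in> carrier G. f\<^sub>1 x \<in> M1 \<and> f\<^sub>2 x \<in> M2}"
  have finG: "finite (carrier G)"
  proof (rule inj_on_finite[OF inj])
    show "?f ` carrier G \<subseteq> carrier G\<^sub>1 \<times> carrier G\<^sub>2" by auto
  qed (use fin1 fin2 in auto)
  have N: "N \<lhd> G"
    unfolding G.normal_inv_iff
  proof safe
    show "subgroup N G" by (rule G.subgroupI) (auto simp: N_def intro: exI[of _ "\<one>\<^bsub>G\<^esub>"])
    show "x \<otimes>\<^bsub>G\<^esub> h \<otimes>\<^bsub>G\<^esub> inv\<^bsub>G\<^esub> x \<in> N" if "x \<in> carrier G" "h \<in> N" for x h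
      using that M1.inv_op_closed2 M2.inv_op_closed2 by (auto simp: N_def)
  qed
  let ?GN = "G\<lparr>carrier := N\<rparr>" and ?D = "G\<^sub>1\<lparr>carrier := M1\<rparr> \<times>\<times> G\<^sub>2\<lparr>carrier := M2\<rparr>"
  have gGN: "group ?GN" by (rule G.subgroup_imp_group) (rule normal_imp_subgroup[OF N])
  obtain n1 n2 where n: "card M1 = p ^ n1" "card M2 = p ^ n2"
    using M1(2) M2(2) by (auto simp: var_Gp_def order_def)
  have gD: "group ?D"
    using M1(2) M2(2) by (intro DirProd_group) (auto simp: var_Gp_def)
  have "?f \<in> hom ?GN ?D"
  proof (rule homI)
    show "?f x \<in> carrier ?D" if "x \<in> carrier ?GN" for x
      using that unfolding N_def DirProd_def by simp
    show "?f (x \<otimes>\<^bsub>?GN\<^esub> y) = ?f x \<otimes>\<^bsub>?D\<^esub> ?f y"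
      if "x \<in> carrier ?GN" "y \<in> carrier ?GN" for x y
    proof -
      have "x \<in> carrier G" "y \<in> carrier G" using that by (auto simp: N_def)
      then show ?thesis unfolding DirProd_def by simp
    qed
  qed
  then have "group_hom ?GN ?D ?f"
    using gGN gD by (simp add: group_hom_def group_hom_axioms_def)
  from group_hom.img_is_subgroup[OF this] have "subgroup (?f ` N) ?D" by simp
  from group.lagrange[OF gD this] have "card (?f ` N) dvd order ?D"
    by (rule dvdI[OF sym, OF trans[OF mult.commute]])
  moreover have "order ?D = p ^ (n1 + n2)"
    by (simp add: order_def DirProd_def card_cartesian_product n power_add)
  moreover have "card (?f ` N) = card N"
    using inj by (intro card_image) (auto simp: inj_on_def N_def)
  ultimately obtain k where "card N = p ^ k"
    using p by (auto simp: divides_primepow_nat)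
  then have "var_Gp p ?GN"
    using gGN finG by (auto simp: var_Gp_def order_def N_def)
  moreover have "var_Ab (p - 1) (G Mod N)"
    unfolding FactGroup_var_Ab_iff[OF N]
  proof (intro conjI ballI)
    show "finite (carrier (G Mod N))"
      using finG by (auto simp: FactGroup_def RCOSETS_def)
  next
    fix x y assume "x \<in> carrier G" "y \<in> carrier G"
    then show "(x \<otimes>\<^bsub>G\<^esub> y) \<otimes>\<^bsub>G\<^esub> inv\<^bsub>G\<^esub> (y \<otimes>\<^bsub>G\<^esub> x) \<in> N"
      using M1(3) M2(3) unfolding FactGroup_var_Ab_iff[OF M1(1)] FactGroup_var_Ab_iff[OF M2(1)]
      by (simp add: N_def)
  next
    fix x assume "x \<in> carrier G"
    then show "x [^]\<^bsub>G\<^esub> (p - 1) \<in> N"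
      using M1(3) M2(3) unfolding FactGroup_var_Ab_iff[OF M1(1)] FactGroup_var_Ab_iff[OF M2(1)]
      by (simp add: N_def f1.hom_nat_pow f2.hom_nat_pow)
  qed
  ultimately show ?thesis
    using G finG N by (auto simp: var_H_def var_prod_def)
qed

lemma var_H_quotient_Int:
  assumes "prime p" and K1: "K\<^sub>1 \<lhd> F" "var_H p (F Mod K\<^sub>1)" and K2: "K\<^sub>2 \<lhd> F" "var_H p (F Mod K\<^sub>2)"
  shows "K\<^sub>1 \<inter> K\<^sub>2 \<lhd> F \<and> var_H p (F Mod (K\<^sub>1 \<inter> K\<^sub>2))"
proof -
  interpret K1: normal K\<^sub>1 F by fact
  interpret K2: normal K\<^sub>2 F by fact
  let ?K = "K\<^sub>1 \<inter> K\<^sub>2"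
  have "subgroup ?K F" by (rule K1.subgroups_Inter_pair) (rule K1.is_subgroup K2.is_subgroup)+
  then have K: "?K \<lhd> F"
    unfolding K1.normal_inv_iff using K1.inv_op_closed2 K2.inv_op_closed2 by auto
  interpret K: normal ?K F by fact
  have eq: "L #>\<^bsub>F\<^esub> x = L #>\<^bsub>F\<^esub> y \<longleftrightarrow> x \<otimes>\<^bsub>F\<^esub> inv\<^bsub>F\<^esub> y \<in> L"
    if "subgroup L F" "x \<in> carrier F" "y \<in> carrier F" for x y L
    using that by (metis subgroup.rcos_module K1.rcos_self K1.repr_independence K1.is_group)
  have ext: "\<exists>f \<in> hom (F Mod ?K) (F Mod L). \<forall>x\<in>carrier F. f (?K #>\<^bsub>F\<^esub> x) = L #>\<^bsub>F\<^esub> x"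
    if L: "L \<lhd> F" "?K \<subseteq> L" for L
  proof -
    interpret L: normal L F by fact
    have "(\<lambda>x. L #>\<^bsub>F\<^esub> x) \<in> hom F (F Mod L)" by (rule L.r_coset_hom_Mod)
    moreover have "L #>\<^bsub>F\<^esub> x = L #>\<^bsub>F\<^esub> y" if "x \<in> carrier F" "y \<in> carrier F" "?K #>\<^bsub>F\<^esub> x = ?K #>\<^bsub>F\<^esub> y" for x y
      using that L(2) eq[OF L.is_subgroup] eq[OF K.is_subgroup] by auto
    ultimately obtain g where "g \<in> hom (F Mod ?K) (F Mod L)" "\<And>x. x \<in> carrier F \<Longrightarrow> g (?K #>\<^bsub>F\<^esub> x) = L #>\<^bsub>F\<^esub> x"
      using FactGroup_universal[of "\<lambda>x. L #>\<^bsub>F\<^esub> x" F "F Mod L" ?K] K by metis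
    then show ?thesis by blast
  qed
  obtain f1 where f1: "f1 \<in> hom (F Mod ?K) (F Mod K\<^sub>1)" "\<And>x. x \<in> carrier F \<Longrightarrow> f1 (?K #>\<^bsub>F\<^esub> x) = K\<^sub>1 #>\<^bsub>F\<^esub> x"
    using ext[OF K1(1)] by auto
  obtain f2 where f2: "f2 \<in> hom (F Mod ?K) (F Mod K\<^sub>2)" "\<And>x. x \<in> carrier F \<Longrightarrow> f2 (?K #>\<^bsub>F\<^esub> x) = K\<^sub>2 #>\<^bsub>F\<^esub> x"
    using ext[OF K2(1)] by auto
  have "inj_on (\<lambda>X. (f1 X, f2 X)) (carrier (F Mod ?K))"
    using f1(2) f2(2) eq[OF K.is_subgroup] eq[OF K1.is_subgroup] eq[OF K2.is_subgroup]
    by (auto simp: inj_on_def FactGroup_def RCOSETS_def)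
  then show ?thesis
    using var_H_embed[OF assms(1) K.factorgroup_is_group f1(1) f2(1) K1(2) K2(2)] K by blast
qed

lemma openin_pro_topology_var_H:
  assumes p: "prime p" and F: "group F"
  shows "openin (pro_topology (var_H p) F) = arbitrary union_of (\<lambda>U. U \<in> pro_cosets (var_H p) F)"
proof -
  interpret F: group F by fact
  let ?P = "\<lambda>U. U \<in> pro_cosets (var_H p) F"
  have op: "openin (pro_topology (var_H p) F) U" if "?P U" for U
    using that unfolding pro_topology_def by (rule topology_generated_by_Basis)
  have int: "(arbitrary union_of ?P) (U \<inter> W)" if "?P U" "?P W" for U W
  proof -
    have "\<exists>C. ?P C \<and> x \<in> C \<and> C \<subseteq> U \<inter> W" if x: "x \<in> U \<inter> W" for x
    proof -
      obtain K y where K: "K \<lhd> F" "var_H p (F Mod K)" and y: "y \<in> carrier F" "U = K #>\<^bsub>F\<^esub> y"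
        using \<open>?P U\<close> by (auto simp: pro_cosets_def)
      obtain L z where L: "L \<lhd> F" "var_H p (F Mod L)" and z: "z \<in> carrier F" "W = L #>\<^bsub>F\<^esub> z"
        using \<open>?P W\<close> by (auto simp: pro_cosets_def)
      have K': "subgroup K F" and L': "subgroup L F" using K L by (auto intro: normal_imp_subgroup)
      have xF: "x \<in> carrier F" using x y F.r_coset_subset_G[OF subgroup.subset[OF K']] by blast
      have "U = K #>\<^bsub>F\<^esub> x" "W = L #>\<^bsub>F\<^esub> x"
        using x y z F.repr_independence K' L' by blast+
      then have "(K \<inter> L) #>\<^bsub>F\<^esub> x \<subseteq> U \<inter> W" by (auto simp: r_coset_def)
      moreover have "x \<in> (K \<inter> L) #>\<^bsub>F\<^esub> x"
        using F.rcos_self[OF xF F.subgroups_Inter_pair[OF K' L']] .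
      moreover have "?P ((K \<inter> L) #>\<^bsub>F\<^esub> x)"
        using var_H_quotient_Int[OF p K L] xF by (auto simp: pro_cosets_def)
      ultimately show ?thesis by blast
    qed
    then have "U \<inter> W = \<Union> {C. ?P C \<and> C \<subseteq> U \<inter> W}" by blast
    then show ?thesis unfolding union_of_def arbitrary_def by (intro exI conjI) auto
  qed
  have top: "istopology (arbitrary union_of ?P)"
    unfolding istopology_base_eq
    using int by blast
  have "(arbitrary union_of ?P) U" if "generate_topology_on (pro_cosets (var_H p) F) U" for U
    using that
  proof induction
    case (Int a b) then show ?case using top unfolding istopology_def by blast
  next
    case (UN k) then show ?case using top unfolding istopology_def by blast
  next
    case (Basis s) then show ?case by (rule arbitrary_union_of_inc)
  qed (rule arbitrary_union_of_empty)
  moreover have "openin (pro_topology (var_H p) F) U" if "(arbitrary union_of ?P) U" for U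
    using that op unfolding union_of_def arbitrary_def by auto
  ultimately show ?thesis
    by (auto simp: pro_topology_def openin_topology_generated_by_iff)
qed


section \<open>Labeled graphs\<close>

record ('v, 'e, 'a) lgraph =
  dgr :: "('v, 'e) pre_digraph"
  lab :: "'e \<Rightarrow> 'a"
  base :: 'v

abbreviation verts\<^sub>L :: "('v, 'e, 'a) lgraph \<Rightarrow> 'v set" where "verts\<^sub>L \<Gamma> \<equiv> verts (dgr \<Gamma>)"
abbreviation arcs\<^sub>L :: "('v, 'e, 'a) lgraph \<Rightarrow> 'e set" where "arcs\<^sub>L \<Gamma> \<equiv> arcs (dgr \<Gamma>)"
abbreviation org :: "('v, 'e, 'a) lgraph \<Rightarrow> 'e \<Rightarrow> 'v" where "org \<Gamma> \<equiv> tail (dgr \<Gamma>)"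
abbreviation ter :: "('v, 'e, 'a) lgraph \<Rightarrow> 'e \<Rightarrow> 'v" where "ter \<Gamma> \<equiv> head (dgr \<Gamma>)"

definition labeled_graph :: "'a set \<Rightarrow> ('v, 'e, 'a) lgraph \<Rightarrow> bool" where
  "labeled_graph A \<Gamma> \<longleftrightarrow> wf_digraph (dgr \<Gamma>) \<and> Digraph_Component.connected (dgr \<Gamma>) \<and>
     base \<Gamma> \<in> verts\<^sub>L \<Gamma> \<and> lab \<Gamma> ` arcs\<^sub>L \<Gamma> \<subseteq> A"

definition reduced_graph :: "'a set \<Rightarrow> ('v, 'e, 'a) lgraph \<Rightarrow> bool" where
  "reduced_graph A \<Gamma> \<longleftrightarrow> labeled_graph A \<Gamma> \<and>
     (\<forall>e\<in>arcs\<^sub>L \<Gamma>. \<forall>f\<in>arcs\<^sub>L \<Gamma>. e \<noteq> f \<and> org \<Gamma> e = org \<Gamma> f \<longrightarrow> lab \<Gamma> e \<noteq> lab \<Gamma> f) \<and>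
     (\<forall>e\<in>arcs\<^sub>L \<Gamma>. \<forall>f\<in>arcs\<^sub>L \<Gamma>. e \<noteq> f \<and> ter \<Gamma> e = ter \<Gamma> f \<longrightarrow> lab \<Gamma> e \<noteq> lab \<Gamma> f) \<and>
     (\<forall>v\<in>verts\<^sub>L \<Gamma> - {base \<Gamma>}. \<exists>e\<in>arcs\<^sub>L \<Gamma>. \<exists>f\<in>arcs\<^sub>L \<Gamma>. e \<noteq> f \<and>
        (org \<Gamma> e = v \<or> ter \<Gamma> e = v) \<and> (org \<Gamma> f = v \<or> ter \<Gamma> f = v))"

text \<open>In a path, \<open>(e, True)\<close> crosses the edge \<open>e\<close> forwards and \<open>(e, False)\<close> crosses it backwards.\<close>

fun lpath :: "('v, 'e, 'a) lgraph \<Rightarrow> 'v \<Rightarrow> ('e \<times> bool) list \<Rightarrow> 'v \<Rightarrow> bool" where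
  "lpath \<Gamma> u [] v \<longleftrightarrow> u = v \<and> u \<in> verts\<^sub>L \<Gamma>"
| "lpath \<Gamma> u ((e, True) # \<pi>) v \<longleftrightarrow> e \<in> arcs\<^sub>L \<Gamma> \<and> org \<Gamma> e = u \<and> lpath \<Gamma> (ter \<Gamma> e) \<pi> v"
| "lpath \<Gamma> u ((e, False) # \<pi>) v \<longleftrightarrow> e \<in> arcs\<^sub>L \<Gamma> \<and> ter \<Gamma> e = u \<and> lpath \<Gamma> (org \<Gamma> e) \<pi> v"

definition path_label :: "('v, 'e, 'a) lgraph \<Rightarrow> ('e \<times> bool) list \<Rightarrow> 'a word" where
  "path_label \<Gamma> \<pi> = map (\<lambda>(e, s). (lab \<Gamma> e, s)) \<pi>"

definition lang :: "('v, 'e, 'a) lgraph \<Rightarrow> 'a word set" where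
  "lang \<Gamma> = {path_label \<Gamma> \<pi> | \<pi>. lpath \<Gamma> (base \<Gamma>) \<pi> (base \<Gamma>) \<and> reduced_word (path_label \<Gamma> \<pi>)}"

text \<open>The graph of a finitely generated subgroup is determined only up to isomorphism; being finite,
  a representative can be chosen with natural numbers as vertices and edges.\<close>

definition subgroup_graph :: "'a set \<Rightarrow> 'a word set \<Rightarrow> (nat, nat, 'a) lgraph" where
  "subgroup_graph A H = (SOME \<Gamma>. reduced_graph A \<Gamma> \<and> fin_digraph (dgr \<Gamma>) \<and> lang \<Gamma> = H)"

definition lgraph_morphism ::
  "('v, 'e, 'a) lgraph \<Rightarrow> ('w, 'f, 'a) lgraph \<Rightarrow> ('v \<Rightarrow> 'w) \<Rightarrow> ('e \<Rightarrow> 'f) \<Rightarrow> bool" where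
  "lgraph_morphism \<Gamma> \<Delta> \<phi>\<^sub>V \<phi>\<^sub>E \<longleftrightarrow>
     \<phi>\<^sub>V (base \<Gamma>) = base \<Delta> \<and> \<phi>\<^sub>V ` verts\<^sub>L \<Gamma> \<subseteq> verts\<^sub>L \<Delta> \<and> \<phi>\<^sub>E ` arcs\<^sub>L \<Gamma> \<subseteq> arcs\<^sub>L \<Delta> \<and>
     (\<forall>e\<in>arcs\<^sub>L \<Gamma>. org \<Delta> (\<phi>\<^sub>E e) = \<phi>\<^sub>V (org \<Gamma> e) \<and> ter \<Delta> (\<phi>\<^sub>E e) = \<phi>\<^sub>V (ter \<Gamma> e) \<and>
        lab \<Delta> (\<phi>\<^sub>E e) = lab \<Gamma> e)"

definition overgroups :: "'a set \<Rightarrow> 'a word set \<Rightarrow> 'a word set set" where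
  "overgroups A H = {K. fin_gen_subgroup K (free_group A) \<and>
     (\<exists>\<phi>\<^sub>V \<phi>\<^sub>E. lgraph_morphism (subgroup_graph A H) (subgroup_graph A K) \<phi>\<^sub>V \<phi>\<^sub>E \<and>
        \<phi>\<^sub>V ` verts\<^sub>L (subgroup_graph A H) = verts\<^sub>L (subgroup_graph A K) \<and>
        \<phi>\<^sub>E ` arcs\<^sub>L (subgroup_graph A H) = arcs\<^sub>L (subgroup_graph A K))}"

end

theory Submission
  imports Defs "HOL-Algebra.Sylow" "HOL-Algebra.Multiplicative_Group"
begin

text \<open>
  Let \<open>K\<close> be the closure of \<open>H\<close>; it is a subgroup, the intersection of the subgroups \<open>NH\<close> for the open
  normal subgroups \<open>N\<close> of the free group.  The graph of any subgroup is the core of its coset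
  graph: the vertices and edges that its elements meet when they are read, as reduced words, from the
  coset of the identity.  The morphism from the graph of \<open>H\<close> to that of \<open>K\<close> is the projection
  \<open>Hx \<mapsto> Kx\<close>, and the claim is that it is onto: every edge of the core graph of \<open>K\<close> is already met by \<open>H\<close>
  (\<open>met_edges_subset\<close> in the locale \<open>closed_hull\<close>).  Then the core graph of \<open>K\<close> is finite as well, which
  also makes \<open>K\<close> finitely generated (\<open>overgroupI\<close>).

  Call an edge of the core graph of \<open>K\<close> bad if \<open>H\<close> does not meet it.  Two facts about bad edges
  contradict each other unless there are none.

  The first one is topological (\<open>dvd_exp_along\<close>): every loop at the base vertex crosses each bad edge
  with an exponent sum divisible by \<open>p\<close>.  Since \<open>K\<close> is closed, some open normal \<open>N\<close> is so small that the
  bad edge stays different from the finitely many edges met by \<open>H\<close> and by the loop in the finite coset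
  graph of \<open>NH\<close>.  There, exponent sums along the edge form a crossed homomorphism, and reducing it
  modulo \<open>p\<close> produces a smaller normal subgroup \<open>N'\<close> with \<open>N/N'\<close> an elementary abelian \<open>p\<close>-group.
  The variety in question is closed under extensions with such a kernel (\<open>var_H_extension\<close>), so \<open>N'\<close> is
  open (\<open>var_H_crossed_hom_kernel\<close>).  An element of \<open>K\<close> lies in \<open>N'H\<close>, and both factors have exponent
  sum \<open>0\<close> modulo \<open>p\<close>.

  The second one is combinatorial (\<open>ex_loop_exp_sum_1\<close>): if a reduced loop at the base vertex crosses
  some bad edge, then there is a loop that crosses some bad edge with exponent sum \<open>1\<close> or \<open>-1\<close>.

  The graphs representing subgroups are arbitrary finite reduced graphs with the right language, so it
  is also shown that each of them is isomorphic to the core graph (\<open>lgraph_iso_core_graph\<close>), which rests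
  on the fact that every edge of a finite reduced graph lies on a reduced loop at the base vertex
  (\<open>ex_reduced_loop_through\<close>).
\<close>

section \<open>Free reduction\<close>

text \<open>The formal inverse of a word; on reduced words this is the inverse in the free group.\<close>

definition winv :: "('a \<times> bool) list \<Rightarrow> ('a \<times> bool) list" where
  "winv w = rev (map inv_letter w)"

lemma winv_Nil [simp]: "winv [] = []"
  and winv_Cons: "winv (l # w) = winv w @ [inv_letter l]"
  and winv_append [simp]: "winv (u @ v) = winv v @ winv u"
  by (auto simp: winv_def)

lemma winv_winv [simp]: "winv (winv w) = w"
  by (simp add: winv_def rev_map o_def)

lemma inv_letter_inject [simp]: "inv_letter l = inv_letter m \<longleftrightarrow> l = m"
  by (metis inv_letter_inv_letter)

lemma inv_letter_Pair [simp]: "inv_letter (a, s) = (a, \<not> s)"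
  by (simp add: inv_letter_def)

lemma reduced_word_append:
  "reduced_word (u @ v) \<longleftrightarrow> reduced_word u \<and> reduced_word v \<and>
     (u = [] \<or> v = [] \<or> hd v \<noteq> inv_letter (last u))"
  unfolding reduced_word_def by (auto simp: successively_append_iff)

lemma reduced_word_winv: "reduced_word (winv w) \<longleftrightarrow> reduced_word w"
proof -
  have "reduced_word (winv w)" if "reduced_word w" for w :: "('a \<times> bool) list"
    using that
  proof (induction w)
    case (Cons l w)
    then show ?case
      by (cases w) (auto simp: winv_Cons reduced_word_append reduced_word_Cons)
  qed simp
  from this[of w] this[of "winv w"] show ?thesis by auto
qed

lemma reduce_winv_self [simp]: "reduce (winv w @ w) = []" "reduce (w @ winv w) = []"
  using reduce_inverse_append[of w] reduce_inverse_append[of "winv w"]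
  by (simp_all add: winv_def[symmetric])

lemma reduce_Nil [simp]: "reduce [] = []"
  by (simp add: reduce_def)

lemma reduce_Cons: "reduce (l # w) = cancel_cons l (reduce w)"
  by (simp add: reduce_def)

lemma reduce_singleton [simp]: "reduce [l] = [l]"
  by (simp add: reduce_def)

lemma reduce_append_middle: "reduce (u @ reduce v @ w) = reduce (u @ v @ w)"
  by (metis reduce_append_left reduce_append_right)

lemma reduce_cancel_middle: "reduce (u @ winv v @ v @ w) = reduce (u @ w)"
  "reduce (u @ v @ winv v @ w) = reduce (u @ w)"
proof -
  have "reduce (u @ winv v @ v @ w) = reduce (u @ reduce (winv v @ v) @ w)" for v
    unfolding reduce_append_middle by simp
  then show *: "reduce (u @ winv v @ v @ w) = reduce (u @ w)" for v by simp
  from *[of "winv v"] show "reduce (u @ v @ winv v @ w) = reduce (u @ w)" by simp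
qed

text \<open>Free reduction commutes with relabelings of letters; this relates the reduction of a path in a
  graph, seen as a word over oriented edges, to the reduction of its label.\<close>

lemma reduce_map_reduce:
  assumes f: "\<And>l. f (inv_letter l) = inv_letter (f l)"
  shows "reduce (map f (reduce w)) = reduce (map f w)"
proof (induction w)
  case (Cons l w)
  have red: "reduced_word (reduce (map f w))" for w by simp
  show ?case
  proof (cases "reduce w")
    case Nil
    then show ?thesis using Cons by (simp add: reduce_Cons)
  next
    case (Cons m w')
    have IH: "cancel_cons (f m) (reduce (map f w')) = reduce (map f w)"
      using Cons.IH Cons by (simp add: reduce_Cons)
    show ?thesis
    proof (cases "m = inv_letter l")
      case True
      have "reduce (map f w') = cancel_cons (f l) (cancel_cons (inv_letter (f l)) (reduce (map f w')))"
        by (simp add: cancel_cons_inverse)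
      then show ?thesis using IH Cons True by (simp add: reduce_Cons f)
    next
      case False
      then show ?thesis using IH Cons by (simp add: reduce_Cons)
    qed
  qed
qed simp

text \<open>Reading \<open>reduce w\<close> visits only group elements that are visited when reading \<open>w\<close>.\<close>

lemma prefix_of_reduce:
  assumes "reduce w = y @ z"
  shows "\<exists>u v. w = u @ v \<and> reduce u = y"
  using assms
proof (induction w arbitrary: y z)
  case (Cons l w)
  show ?case
  proof (cases "y = []")
    case True
    then show ?thesis by (intro exI[of _ "[]"] exI[of _ "l # w"]) simp
  next
    case False
    show ?thesis
    proof (cases "\<exists>w'. reduce w = inv_letter l # w'")
      case True
      then have "reduce w = (inv_letter l # y) @ z"
        using Cons.prems by (auto simp: reduce_Cons)
      from Cons.IH[OF this] obtain u v where "w = u @ v" "reduce u = inv_letter l # y" by blast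
      then show ?thesis by (intro exI[of _ "l # u"] exI[of _ v]) (simp add: reduce_Cons)
    next
      case F: False
      then have eq: "reduce (l # w) = l # reduce w"
        by (cases "reduce w") (auto simp: reduce_Cons)
      with False Cons.prems obtain y' where y': "y = l # y'" "reduce w = y' @ z"
        by (cases y) auto
      from Cons.IH[OF y'(2)] obtain u v where uv: "w = u @ v" "reduce u = y'" by blast
      have "reduced_word (l # y')"
        using reduced_reduce[of "l # w"] eq y' by (metis append_Cons reduced_word_append)
      then show ?thesis using uv y'
        by (intro exI[of _ "l # u"] exI[of _ v]) (simp add: reduce_Cons cancel_cons_reduced)
    qed
  qed
qed simp

lemma mult_free_group [simp]: "u \<otimes>\<^bsub>free_group A\<^esub> v = reduce (u @ v)"
  and one_free_group [simp]: "\<one>\<^bsub>free_group A\<^esub> = []"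
  by (simp_all add: free_group_def)

lemma carrier_free_group: "w \<in> carrier (free_group A) \<longleftrightarrow> reduced_word w \<and> fst ` set w \<subseteq> A"
  by (simp add: free_group_def)

lemma carrier_free_group_append:
  assumes "u @ v \<in> carrier (free_group A)"
  shows "u \<in> carrier (free_group A)" "v \<in> carrier (free_group A)"
  using assms by (auto simp: carrier_free_group reduced_word_append)

lemma reduce_in_carrier: "fst ` set w \<subseteq> A \<Longrightarrow> reduce w \<in> carrier (free_group A)"
  using letters_reduce[of w] by (auto simp: carrier_free_group)

lemma inv_free_group:
  assumes "w \<in> carrier (free_group A)"
  shows "inv\<^bsub>free_group A\<^esub> w = winv w"
proof (rule group.inv_equality[OF group_free_group])
  show "winv w \<in> carrier (free_group A)"
    using assms by (auto simp: carrier_free_group reduced_word_winv) (auto simp: winv_def)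
qed (use assms in auto)

section \<open>Paths in labeled graphs\<close>

text \<open>A pair \<open>(e, s)\<close> of an edge and a direction is an oriented edge; reversing it is
  \<^const>\<open>inv_letter\<close>, so that a path is a word over oriented edges, and free reduction of this word
  removes backtracking.\<close>

definition src :: "('v, 'e, 'a) lgraph \<Rightarrow> 'e \<times> bool \<Rightarrow> 'v" where
  "src \<Gamma> d = (if snd d then org \<Gamma> (fst d) else ter \<Gamma> (fst d))"

definition tgt :: "('v, 'e, 'a) lgraph \<Rightarrow> 'e \<times> bool \<Rightarrow> 'v" where
  "tgt \<Gamma> d = (if snd d then ter \<Gamma> (fst d) else org \<Gamma> (fst d))"

definition letter :: "('v, 'e, 'a) lgraph \<Rightarrow> 'e \<times> bool \<Rightarrow> 'a \<times> bool" where
  "letter \<Gamma> d = (lab \<Gamma> (fst d), snd d)"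

lemma src_inv_letter [simp]: "src \<Gamma> (inv_letter d) = tgt \<Gamma> d"
  and tgt_inv_letter [simp]: "tgt \<Gamma> (inv_letter d) = src \<Gamma> d"
  and letter_inv_letter [simp]: "letter \<Gamma> (inv_letter d) = inv_letter (letter \<Gamma> d)"
  by (auto simp: src_def tgt_def letter_def inv_letter_def)

lemma lpath_Cons [simp]:
  "lpath \<Gamma> u (d # \<pi>) v \<longleftrightarrow> fst d \<in> arcs\<^sub>L \<Gamma> \<and> src \<Gamma> d = u \<and> lpath \<Gamma> (tgt \<Gamma> d) \<pi> v"
  by (cases d; cases "snd d") (auto simp: src_def tgt_def)

declare lpath.simps(2,3) [simp del]

lemma path_label_letter: "path_label \<Gamma> \<pi> = map (letter \<Gamma>) \<pi>"
  by (auto simp: path_label_def letter_def split: prod.splits)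

lemma path_label_simps [simp]:
  "path_label \<Gamma> [] = []"
  "path_label \<Gamma> (d # \<pi>) = letter \<Gamma> d # path_label \<Gamma> \<pi>"
  "path_label \<Gamma> (\<pi> @ \<rho>) = path_label \<Gamma> \<pi> @ path_label \<Gamma> \<rho>"
  "path_label \<Gamma> (winv \<pi>) = winv (path_label \<Gamma> \<pi>)"
  by (simp_all add: path_label_letter winv_def rev_map o_def)

context
  fixes \<Gamma> :: "('v, 'e, 'a) lgraph"
  assumes wf: "wf_digraph (dgr \<Gamma>)"
begin

lemma src_in_verts: "fst d \<in> arcs\<^sub>L \<Gamma> \<Longrightarrow> src \<Gamma> d \<in> verts\<^sub>L \<Gamma>"
  and tgt_in_verts: "fst d \<in> arcs\<^sub>L \<Gamma> \<Longrightarrow> tgt \<Gamma> d \<in> verts\<^sub>L \<Gamma>"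
  using wf by (auto simp: src_def tgt_def wf_digraph_def)

lemma lpath_in_verts:
  "lpath \<Gamma> u \<pi> v \<Longrightarrow> u \<in> verts\<^sub>L \<Gamma>" "lpath \<Gamma> u \<pi> v \<Longrightarrow> v \<in> verts\<^sub>L \<Gamma>"
  by (induction \<pi> arbitrary: u) (auto simp: src_in_verts)

lemma lpath_append:
  "lpath \<Gamma> u (\<pi> @ \<rho>) v \<longleftrightarrow> (\<exists>x. lpath \<Gamma> u \<pi> x \<and> lpath \<Gamma> x \<rho> v)"
  by (induction \<pi> arbitrary: u) (auto dest: lpath_in_verts)

lemma lpath_winv: "lpath \<Gamma> u \<pi> v \<Longrightarrow> lpath \<Gamma> v (winv \<pi>) u"
proof (induction \<pi> arbitrary: u)
  case (Cons d \<pi>)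
  then have "lpath \<Gamma> (tgt \<Gamma> d) [inv_letter d] u"
    using src_in_verts[of d] by simp
  then show ?case using Cons by (auto simp: winv_Cons lpath_append)
qed simp

lemma lpath_cancel_cons:
  assumes "fst d \<in> arcs\<^sub>L \<Gamma>" "lpath \<Gamma> (tgt \<Gamma> d) \<pi> v"
  shows "lpath \<Gamma> (src \<Gamma> d) (cancel_cons d \<pi>) v"
proof (cases \<pi>)
  case Nil
  then show ?thesis using assms tgt_in_verts[of d] by simp
next
  case (Cons d' \<pi>')
  then show ?thesis using assms by auto
qed

lemma lpath_reduce: "lpath \<Gamma> u \<pi> v \<Longrightarrow> lpath \<Gamma> u (reduce \<pi>) v"
  by (induction \<pi> arbitrary: u) (auto simp: reduce_Cons intro: lpath_cancel_cons)

lemma reduce_path_label: "reduce (path_label \<Gamma> (reduce \<pi>)) = reduce (path_label \<Gamma> \<pi>)"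
  unfolding path_label_letter by (rule reduce_map_reduce) simp

lemma mk_symmetric_reachable_iff_lpath:
  "u \<rightarrow>\<^sup>*\<^bsub>mk_symmetric (dgr \<Gamma>)\<^esub> v \<longleftrightarrow> (\<exists>\<pi>. lpath \<Gamma> u \<pi> v)"
proof
  interpret wf_digraph "dgr \<Gamma>" by (rule wf)
  interpret S: pair_wf_digraph "mk_symmetric (dgr \<Gamma>)" ..
  {
    assume "u \<rightarrow>\<^sup>*\<^bsub>mk_symmetric (dgr \<Gamma>)\<^esub> v"
    then show "\<exists>\<pi>. lpath \<Gamma> u \<pi> v"
    proof (induction rule: S.converse_reachable_induct)
      case base
      then show ?case by (intro exI[of _ "[]"]) simp
    next
      case (step x y)
      then obtain \<pi> where \<pi>: "lpath \<Gamma> y \<pi> v" by blast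
      from step(1) obtain e where e: "e \<in> arcs\<^sub>L \<Gamma>"
        "(x, y) = (org \<Gamma> e, ter \<Gamma> e) \<or> (x, y) = (ter \<Gamma> e, org \<Gamma> e)"
        by (auto simp: parcs_mk_symmetric)
      then have "src \<Gamma> (e, True) = x \<and> tgt \<Gamma> (e, True) = y \<or>
          src \<Gamma> (e, False) = x \<and> tgt \<Gamma> (e, False) = y"
        by (auto simp: src_def tgt_def)
      then obtain s where "src \<Gamma> (e, s) = x" "tgt \<Gamma> (e, s) = y" by blast
      with e \<pi> show ?case by (intro exI[of _ "(e, s) # \<pi>"]) auto
    qed
  next
    assume "\<exists>\<pi>. lpath \<Gamma> u \<pi> v"
    then obtain \<pi> where "lpath \<Gamma> u \<pi> v" ..
    then show "u \<rightarrow>\<^sup>*\<^bsub>mk_symmetric (dgr \<Gamma>)\<^esub> v"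
    proof (induction \<pi> arbitrary: u)
      case (Cons d \<pi>)
      then have "(src \<Gamma> d, tgt \<Gamma> d) \<in> parcs (mk_symmetric (dgr \<Gamma>))"
        by (auto simp: parcs_mk_symmetric src_def tgt_def)
      then have "(u, tgt \<Gamma> d) \<in> parcs (mk_symmetric (dgr \<Gamma>))" using Cons.prems by auto
      moreover have "tgt \<Gamma> d \<rightarrow>\<^sup>*\<^bsub>mk_symmetric (dgr \<Gamma>)\<^esub> v" using Cons by auto
      ultimately show ?case by (rule S.adj_reachable_trans)
    qed auto
  }
qed

lemma connected_iff_lpath_base:
  assumes "base \<Gamma> \<in> verts\<^sub>L \<Gamma>"
  shows "Digraph_Component.connected (dgr \<Gamma>) \<longleftrightarrow> (\<forall>v\<in>verts\<^sub>L \<Gamma>. \<exists>\<pi>. lpath \<Gamma> (base \<Gamma>) \<pi> v)"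
proof -
  have "\<exists>\<pi>. lpath \<Gamma> u \<pi> v" if "lpath \<Gamma> (base \<Gamma>) \<pi> u" "lpath \<Gamma> (base \<Gamma>) \<rho> v" for u v \<pi> \<rho>
    using that lpath_winv lpath_append by blast
  then show ?thesis
    using assms unfolding connected_def strongly_connected_def
    by (simp add: mk_symmetric_reachable_iff_lpath) blast
qed

end

text \<open>In a graph in which oriented edges with the same source carry different letters, a path is
  determined by its source and its label.\<close>

definition deterministic :: "('v, 'e, 'a) lgraph \<Rightarrow> bool" where
  "deterministic \<Gamma> \<longleftrightarrow> (\<forall>d d'. fst d \<in> arcs\<^sub>L \<Gamma> \<longrightarrow> fst d' \<in> arcs\<^sub>L \<Gamma> \<longrightarrow> src \<Gamma> d = src \<Gamma> d' \<longrightarrow>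
     letter \<Gamma> d = letter \<Gamma> d' \<longrightarrow> d = d')"

lemma deterministicD:
  "\<lbrakk>deterministic \<Gamma>; fst d \<in> arcs\<^sub>L \<Gamma>; fst d' \<in> arcs\<^sub>L \<Gamma>; src \<Gamma> d = src \<Gamma> d'; letter \<Gamma> d = letter \<Gamma> d'\<rbrakk>
    \<Longrightarrow> d = d'"
  unfolding deterministic_def by blast

lemma reduced_graph_iff:
  "reduced_graph A \<Gamma> \<longleftrightarrow> labeled_graph A \<Gamma> \<and> deterministic \<Gamma> \<and>
     (\<forall>v\<in>verts\<^sub>L \<Gamma> - {base \<Gamma>}. \<exists>e\<in>arcs\<^sub>L \<Gamma>. \<exists>f\<in>arcs\<^sub>L \<Gamma>. e \<noteq> f \<and>
        (org \<Gamma> e = v \<or> ter \<Gamma> e = v) \<and> (org \<Gamma> f = v \<or> ter \<Gamma> f = v))"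
proof -
  have "deterministic \<Gamma> \<longleftrightarrow>
     (\<forall>e\<in>arcs\<^sub>L \<Gamma>. \<forall>f\<in>arcs\<^sub>L \<Gamma>. e \<noteq> f \<and> org \<Gamma> e = org \<Gamma> f \<longrightarrow> lab \<Gamma> e \<noteq> lab \<Gamma> f) \<and>
     (\<forall>e\<in>arcs\<^sub>L \<Gamma>. \<forall>f\<in>arcs\<^sub>L \<Gamma>. e \<noteq> f \<and> ter \<Gamma> e = ter \<Gamma> f \<longrightarrow> lab \<Gamma> e \<noteq> lab \<Gamma> f)"
    unfolding deterministic_def src_def letter_def by (auto split: if_splits)
  then show ?thesis unfolding reduced_graph_def by argo
qed

lemma lpath_label_unique:
  assumes "deterministic \<Gamma>" "lpath \<Gamma> u \<pi> v" "lpath \<Gamma> u \<rho> w" "path_label \<Gamma> \<pi> = path_label \<Gamma> \<rho>"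
  shows "\<pi> = \<rho> \<and> v = w"
  using assms(2-)
proof (induction \<pi> arbitrary: u \<rho>)
  case (Cons d \<pi>)
  then obtain d' \<rho>' where \<rho>: "\<rho> = d' # \<rho>'" by (cases \<rho>) auto
  then have "d = d'" using Cons.prems assms(1) by (auto intro: deterministicD)
  then show ?case using Cons \<rho> by auto
qed (auto simp: path_label_letter)

lemma reduced_path_label:
  assumes "deterministic \<Gamma>" "lpath \<Gamma> u \<pi> v"
  shows "reduced_word (path_label \<Gamma> \<pi>) \<longleftrightarrow> reduced_word \<pi>"
  using assms(2)
proof (induction \<pi> arbitrary: u)
  case (Cons d \<pi>)
  then have IH: "reduced_word (path_label \<Gamma> \<pi>) \<longleftrightarrow> reduced_word \<pi>" by auto
  show ?case
  proof (cases \<pi>)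
    case (Cons d' \<pi>')
    with Cons.prems have "fst d \<in> arcs\<^sub>L \<Gamma>" "fst d' \<in> arcs\<^sub>L \<Gamma>" "src \<Gamma> d' = tgt \<Gamma> d" by auto
    then have "letter \<Gamma> d' = inv_letter (letter \<Gamma> d) \<longleftrightarrow> d' = inv_letter d"
      using deterministicD[OF assms(1), of d' "inv_letter d"] by auto
    then show ?thesis using IH Cons by (auto simp: reduced_word_Cons)
  qed (simp add: reduced_word_Cons)
qed simp

lemma ex_lpath_reduced_label:
  assumes "wf_digraph (dgr \<Gamma>)" "deterministic \<Gamma>" "lpath \<Gamma> u \<pi> v"
  shows "lpath \<Gamma> u (reduce \<pi>) v \<and> path_label \<Gamma> (reduce \<pi>) = reduce (path_label \<Gamma> \<pi>)"
proof -
  have *: "lpath \<Gamma> u (reduce \<pi>) v" by (rule lpath_reduce[OF assms(1,3)])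
  have "path_label \<Gamma> (reduce \<pi>) = reduce (path_label \<Gamma> (reduce \<pi>))"
    using reduced_path_label[OF assms(2) *] by (simp add: reduce_reduced)
  then show ?thesis using * reduce_path_label[OF assms(1)] by simp
qed

section \<open>Reduced loops in finite reduced graphs\<close>

text \<open>An oriented edge is accessible if some reduced path from the base vertex ends with it.\<close>

definition accessible :: "('v, 'e, 'a) lgraph \<Rightarrow> 'e \<times> bool \<Rightarrow> bool" where
  "accessible \<Gamma> d \<longleftrightarrow> (\<exists>\<pi>. lpath \<Gamma> (base \<Gamma>) (\<pi> @ [d]) (tgt \<Gamma> d) \<and> reduced_word (\<pi> @ [d]))"

lemma accessible_inv_letter_iff:
  assumes wf: "wf_digraph (dgr \<Gamma>)"
  shows "accessible \<Gamma> (inv_letter d) \<longleftrightarrow>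
    (\<exists>\<rho>. lpath \<Gamma> (src \<Gamma> d) (d # \<rho>) (base \<Gamma>) \<and> reduced_word (d # \<rho>))"
proof
  assume "accessible \<Gamma> (inv_letter d)"
  then obtain \<pi> where \<pi>: "lpath \<Gamma> (base \<Gamma>) (\<pi> @ [inv_letter d]) (src \<Gamma> d)"
    "reduced_word (\<pi> @ [inv_letter d])"
    by (auto simp: accessible_def)
  then show "\<exists>\<rho>. lpath \<Gamma> (src \<Gamma> d) (d # \<rho>) (base \<Gamma>) \<and> reduced_word (d # \<rho>)"
    using lpath_winv[OF wf \<pi>(1)] reduced_word_winv[of "\<pi> @ [inv_letter d]"]
    by (intro exI[of _ "winv \<pi>"]) (auto simp: winv_Cons)
next
  assume "\<exists>\<rho>. lpath \<Gamma> (src \<Gamma> d) (d # \<rho>) (base \<Gamma>) \<and> reduced_word (d # \<rho>)"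
  then obtain \<rho> where \<rho>: "lpath \<Gamma> (src \<Gamma> d) (d # \<rho>) (base \<Gamma>)" "reduced_word (d # \<rho>)" by blast
  then show "accessible \<Gamma> (inv_letter d)"
    using lpath_winv[OF wf \<rho>(1)] reduced_word_winv[of "d # \<rho>"]
    by (auto simp: accessible_def winv_Cons)
qed

lemma accessible_step:
  assumes wf: "wf_digraph (dgr \<Gamma>)" and "accessible \<Gamma> d" "fst d' \<in> arcs\<^sub>L \<Gamma>" "src \<Gamma> d' = tgt \<Gamma> d"
    "d' \<noteq> inv_letter d"
  shows "accessible \<Gamma> d'"
proof -
  obtain \<pi> where "lpath \<Gamma> (base \<Gamma>) (\<pi> @ [d]) (tgt \<Gamma> d)" "reduced_word (\<pi> @ [d])"
    using assms by (auto simp: accessible_def)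
  then have "lpath \<Gamma> (base \<Gamma>) ((\<pi> @ [d]) @ [d']) (tgt \<Gamma> d')" "reduced_word ((\<pi> @ [d]) @ [d'])"
    using assms tgt_in_verts[OF wf, of d']
    by (subst lpath_append[OF wf], auto simp: reduced_word_append reduced_word_Cons)
  then show ?thesis unfolding accessible_def by blast
qed

text \<open>Suppose that \<open>d\<close> is accessible but no reduced path starting with \<open>d\<close> returns to the base vertex.
  The set \<open>X\<close> of oriented edges in which reduced paths starting with \<open>d\<close> can end is finite, closed
  under continuation, and different members of it have different targets.  By counting, each member
  of \<open>X\<close> is preceded by another one, so a reduced path from the base vertex to \<open>d\<close> would run inside
  \<open>X\<close> meet to its first edge, which has no predecessor in \<open>X\<close>.\<close>

lemma accessible_inv_letter:
  assumes R: "reduced_graph A \<Gamma>" and fin: "fin_digraph (dgr \<Gamma>)" and acc: "accessible \<Gamma> d"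
  shows "accessible \<Gamma> (inv_letter d)"
proof (rule ccontr)
  assume nacc: "\<not> accessible \<Gamma> (inv_letter d)"
  have wf: "wf_digraph (dgr \<Gamma>)" and base: "base \<Gamma> \<in> verts\<^sub>L \<Gamma>"
    using R by (auto simp: reduced_graph_def labeled_graph_def)
  have succ: "\<exists>d'. fst d' \<in> arcs\<^sub>L \<Gamma> \<and> src \<Gamma> d' = v \<and> d' \<noteq> x"
    if v: "v \<in> verts\<^sub>L \<Gamma> - {base \<Gamma>}" for v x
  proof -
    obtain e f where ef: "e \<in> arcs\<^sub>L \<Gamma>" "f \<in> arcs\<^sub>L \<Gamma>" "e \<noteq> f" "org \<Gamma> e = v \<or> ter \<Gamma> e = v"
        "org \<Gamma> f = v \<or> ter \<Gamma> f = v"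
    proof -
      have "\<forall>v\<in>verts\<^sub>L \<Gamma> - {base \<Gamma>}. \<exists>e\<in>arcs\<^sub>L \<Gamma>. \<exists>f\<in>arcs\<^sub>L \<Gamma>. e \<noteq> f \<and>
          (org \<Gamma> e = v \<or> ter \<Gamma> e = v) \<and> (org \<Gamma> f = v \<or> ter \<Gamma> f = v)"
        using R unfolding reduced_graph_def by (elim conjE)
      from bspec[OF this v] show thesis using that by blast
    qed
    define s t where "s = (org \<Gamma> e = v)" and "t = (org \<Gamma> f = v)"
    have "src \<Gamma> (e, s) = v" "src \<Gamma> (f, t) = v"
      using ef by (auto simp: src_def s_def t_def)
    moreover have "(e, s) \<noteq> x \<or> (f, t) \<noteq> x" using ef by auto
    ultimately show ?thesis using ef by (metis fst_conv)
  qed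
  define R where "R = {(x, y). fst y \<in> arcs\<^sub>L \<Gamma> \<and> src \<Gamma> y = tgt \<Gamma> x \<and> y \<noteq> inv_letter x}"
  define X where "X = {x. (d, x) \<in> R\<^sup>*}"
  have dX: "d \<in> X" by (simp add: X_def)
  have X_step: "y \<in> X" if "x \<in> X" "(x, y) \<in> R" for x y
    using that by (auto simp: X_def)
  have X: "fst x \<in> arcs\<^sub>L \<Gamma>" "accessible \<Gamma> x" "\<not> accessible \<Gamma> (inv_letter x)" if "x \<in> X" for x
  proof -
    have "(d, x) \<in> R\<^sup>*" using that by (simp add: X_def)
    then have "fst x \<in> arcs\<^sub>L \<Gamma> \<and> accessible \<Gamma> x \<and> \<not> accessible \<Gamma> (inv_letter x)"
    proof induction
      case base
      then show ?case using acc nacc by (auto simp: accessible_def lpath_append[OF wf])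
    next
      case (step x y)
      then have "accessible \<Gamma> y" using accessible_step[OF wf, of x y] by (auto simp: R_def)
      moreover have "\<not> accessible \<Gamma> (inv_letter y)"
        using accessible_step[OF wf, of "inv_letter y" "inv_letter x"] step
        by (auto simp: R_def)
      ultimately show ?case using step by (auto simp: R_def)
    qed
    then show "fst x \<in> arcs\<^sub>L \<Gamma>" "accessible \<Gamma> x" "\<not> accessible \<Gamma> (inv_letter x)" by auto
  qed
  have meet: "c = x" if "x \<in> X" "accessible \<Gamma> c" "tgt \<Gamma> c = tgt \<Gamma> x" for c x
  proof (rule ccontr)
    assume "c \<noteq> x"
    then have "(x, inv_letter c) \<in> R"
      using that by (auto simp: R_def accessible_def lpath_append[OF wf])
    with X_step[OF \<open>x \<in> X\<close>] have "inv_letter c \<in> X" by blast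
    then show False using X(3)[of "inv_letter c"] that(2) by simp
  qed
  have not_base: "tgt \<Gamma> x \<noteq> base \<Gamma>" if "x \<in> X" for x
  proof
    assume "tgt \<Gamma> x = base \<Gamma>"
    then have "lpath \<Gamma> (src \<Gamma> x) [x] (base \<Gamma>)" "reduced_word [x]"
      using X(1)[OF that] base by (auto simp: reduced_word_Cons)
    then show False using X(3)[OF that] accessible_inv_letter_iff[OF wf] by blast
  qed
  have "\<exists>y. (x, y) \<in> R" if "x \<in> X" for x
    using succ[of "tgt \<Gamma> x" "inv_letter x"] not_base[OF that] tgt_in_verts[OF wf X(1)[OF that]]
    by (auto simp: R_def)
  then obtain f where f: "\<And>x. x \<in> X \<Longrightarrow> (x, f x) \<in> R" by metis
  have "inj_on f X"
  proof (rule inj_onI)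
    fix x y assume "x \<in> X" "y \<in> X" "f x = f y"
    then have "tgt \<Gamma> x = tgt \<Gamma> y" using f[of x] f[of y] by (auto simp: R_def)
    then show "x = y" using meet X(2) \<open>x \<in> X\<close> \<open>y \<in> X\<close> by blast
  qed
  moreover have "f ` X \<subseteq> X" using f X_step by blast
  moreover have "finite X"
  proof (rule finite_subset)
    show "X \<subseteq> arcs\<^sub>L \<Gamma> \<times> UNIV" using X(1) by (auto simp: mem_Times_iff)
    show "finite (arcs\<^sub>L \<Gamma> \<times> (UNIV :: bool set))" using fin by (simp add: fin_digraph.finite_arcs)
  qed
  ultimately have surj: "f ` X = X" by (simp add: endo_inj_surj)
  have pred: "\<exists>x\<in>X. tgt \<Gamma> x = src \<Gamma> y" if "y \<in> X" for y
  proof -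
    obtain x where "x \<in> X" "y = f x" using \<open>y \<in> X\<close> surj by blast
    then show ?thesis using f[of x] by (auto simp: R_def)
  qed
  have "\<not> lpath \<Gamma> (base \<Gamma>) (\<pi> @ [y]) (tgt \<Gamma> y)" if "y \<in> X" "reduced_word (\<pi> @ [y])" for \<pi> y
    using that
  proof (induction \<pi> arbitrary: y rule: rev_induct)
    case Nil
    then show ?case using pred[of y] not_base by auto
  next
    case (snoc c \<pi>)
    show ?case
    proof
      assume p: "lpath \<Gamma> (base \<Gamma>) ((\<pi> @ [c]) @ [y]) (tgt \<Gamma> y)"
      then have c: "lpath \<Gamma> (base \<Gamma>) (\<pi> @ [c]) (tgt \<Gamma> c)" and cy: "tgt \<Gamma> c = src \<Gamma> y"
        using tgt_in_verts[OF wf, of c] by (auto simp: lpath_append[OF wf])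
      have rc: "reduced_word (\<pi> @ [c])" using snoc.prems by (simp add: reduced_word_append reduced_word_Cons)
      then have "accessible \<Gamma> c" using c by (auto simp: accessible_def)
      then have "c \<in> X" using pred[OF snoc.prems(1)] meet cy by metis
      then show False using snoc.IH rc c by blast
    qed
  qed
  then show False using acc dX unfolding accessible_def by blast
qed

text \<open>Every edge can be reached by a reduced path in some direction, hence in both; so a reduced path
  ending with \<open>d\<close> and one starting with \<open>d\<close> overlap in a reduced loop.\<close>

lemma ex_reduced_loop_through:
  assumes R: "reduced_graph A \<Gamma>" and fin: "fin_digraph (dgr \<Gamma>)" and d: "fst d \<in> arcs\<^sub>L \<Gamma>"
  shows "\<exists>\<pi> \<rho>. lpath \<Gamma> (base \<Gamma>) (\<pi> @ d # \<rho>) (base \<Gamma>) \<and> reduced_word (\<pi> @ d # \<rho>)"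
proof -
  have wf: "wf_digraph (dgr \<Gamma>)" and base: "base \<Gamma> \<in> verts\<^sub>L \<Gamma>"
    and conn: "Digraph_Component.connected (dgr \<Gamma>)"
    using R by (auto simp: reduced_graph_def labeled_graph_def)
  obtain \<pi> where "lpath \<Gamma> (base \<Gamma>) \<pi> (src \<Gamma> d)"
    using conn src_in_verts[OF wf d] by (auto simp: connected_iff_lpath_base[OF wf base])
  then have p: "lpath \<Gamma> (base \<Gamma>) (reduce \<pi>) (src \<Gamma> d)" by (rule lpath_reduce[OF wf])
  have "accessible \<Gamma> d \<or> accessible \<Gamma> (inv_letter d)"
  proof (cases "reduced_word (reduce \<pi> @ [d])")
    case True
    moreover have "lpath \<Gamma> (base \<Gamma>) (reduce \<pi> @ [d]) (tgt \<Gamma> d)"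
      using p d tgt_in_verts[OF wf d] by (auto simp: lpath_append[OF wf])
    ultimately show ?thesis unfolding accessible_def by blast
  next
    case False
    then have "reduce \<pi> \<noteq> []" "last (reduce \<pi>) = inv_letter d"
      by (auto simp: reduced_word_append reduced_word_Cons)
    then obtain \<rho> where \<rho>: "reduce \<pi> = \<rho> @ [inv_letter d]"
      by (metis append_butlast_last_id)
    then have "accessible \<Gamma> (inv_letter d)"
      using p reduced_reduce[of \<pi>] by (auto simp: accessible_def)
    then show ?thesis ..
  qed
  then have "accessible \<Gamma> d" "accessible \<Gamma> (inv_letter d)"
    using accessible_inv_letter[OF R fin, of d] accessible_inv_letter[OF R fin, of "inv_letter d"]
    by auto
  then obtain \<pi> \<rho> where
    *: "lpath \<Gamma> (base \<Gamma>) (\<pi> @ [d]) (tgt \<Gamma> d)" "reduced_word (\<pi> @ [d])"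
       "lpath \<Gamma> (src \<Gamma> d) (d # \<rho>) (base \<Gamma>)" "reduced_word (d # \<rho>)"
    unfolding accessible_inv_letter_iff[OF wf] by (auto simp: accessible_def)
  then have "lpath \<Gamma> (base \<Gamma>) (\<pi> @ d # \<rho>) (base \<Gamma>)" "reduced_word (\<pi> @ d # \<rho>)"
    by (auto simp: lpath_append[OF wf] reduced_word_append)
  then show ?thesis by blast
qed

section \<open>Coset graphs of a subgroup of the free group\<close>

text \<open>A subgroup \<open>K\<close> of the free group and its right cosets.\<close>

locale free_group_subgroup =
  fixes A :: "'a set" and K :: "'a word set"
  assumes K: "subgroup K (free_group A)"
begin

sublocale F: group "free_group A"
  by (rule group_free_group)

abbreviation coset :: "'a word \<Rightarrow> 'a word set" where
  "coset x \<equiv> K #>\<^bsub>free_group A\<^esub> x"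

lemma K_carrier: "w \<in> K \<Longrightarrow> w \<in> carrier (free_group A)"
  using subgroup.mem_carrier[OF K] .

lemma Nil_in_K: "[] \<in> K"
  using subgroup.one_closed[OF K] by simp

lemma reduce_append_in_K: "u \<in> K \<Longrightarrow> v \<in> K \<Longrightarrow> reduce (u @ v) \<in> K"
  using subgroup.m_closed[OF K, of u v] by simp

lemma winv_in_carrier: "w \<in> carrier (free_group A) \<Longrightarrow> winv w \<in> carrier (free_group A)"
  using F.inv_closed[of w] by (simp add: inv_free_group)

lemma reduce_append_in_carrier:
  "u \<in> carrier (free_group A) \<Longrightarrow> v \<in> carrier (free_group A) \<Longrightarrow> reduce (u @ v) \<in> carrier (free_group A)"
  using F.m_closed[of u v] by simp

lemma singleton_in_carrier: "[l] \<in> carrier (free_group A) \<longleftrightarrow> fst l \<in> A"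
  by (simp add: carrier_free_group reduced_word_Cons)

lemma mem_coset_iff:
  assumes "x \<in> carrier (free_group A)" "y \<in> carrier (free_group A)"
  shows "y \<in> coset x \<longleftrightarrow> reduce (y @ winv x) \<in> K"
  using subgroup.rcos_module[OF K F.is_group assms] assms by (simp add: inv_free_group)

lemma self_in_coset: "x \<in> carrier (free_group A) \<Longrightarrow> x \<in> coset x"
  by (rule F.rcos_self[OF _ K])

lemma coset_eq_iff:
  assumes "x \<in> carrier (free_group A)" "y \<in> carrier (free_group A)"
  shows "coset x = coset y \<longleftrightarrow> reduce (x @ winv y) \<in> K"
  using mem_coset_iff[OF assms(2,1)] self_in_coset[OF assms(1)]
    F.repr_independence[OF _ assms(2) K, of x] by auto

lemma coset_Nil [simp]: "coset [] = K"
  using F.coset_join2[OF F.one_closed K] Nil_in_K by simp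

lemma coset_eq_K_iff: "x \<in> carrier (free_group A) \<Longrightarrow> coset x = K \<longleftrightarrow> x \<in> K"
  using coset_eq_iff[of x "[]"] F.one_closed by (simp add: carrier_free_group reduce_reduced)

lemma coset_mult:
  assumes "x \<in> carrier (free_group A)" "y \<in> carrier (free_group A)"
  shows "coset x #>\<^bsub>free_group A\<^esub> y = coset (reduce (x @ y))"
  using F.coset_mult_assoc[OF subgroup.subset[OF K] assms] by simp

lemma coset_mult_cong:
  assumes "coset x = coset y" "x \<in> carrier (free_group A)" "y \<in> carrier (free_group A)"
    "z \<in> carrier (free_group A)"
  shows "coset (reduce (x @ z)) = coset (reduce (y @ z))"
  using assms by (simp flip: coset_mult)

lemma coset_mem_rcosets: "x \<in> carrier (free_group A) \<Longrightarrow> coset x \<in> rcosets\<^bsub>free_group A\<^esub> K"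
  by (auto simp: RCOSETS_def)

end

text \<open>In a coset graph of \<open>K\<close>, the vertices are right cosets of \<open>K\<close>, and the edge \<open>(Kx, a)\<close> leads from
  \<open>Kx\<close> to \<open>Kxa\<close> and has the label \<open>a\<close>.\<close>

definition coset_graph ::
  "'a set \<Rightarrow> 'a word set \<Rightarrow> 'a word set set \<Rightarrow> ('a word set \<times> 'a) set \<Rightarrow>
    ('a word set, 'a word set \<times> 'a, 'a) lgraph" where
  "coset_graph A K V E =
     \<lparr>dgr = \<lparr>verts = V, arcs = E, tail = fst, head = (\<lambda>(c, a). c #>\<^bsub>free_group A\<^esub> [(a, True)])\<rparr>,
      lab = snd, base = K\<rparr>"

lemma coset_graph_simps [simp]:
  "verts\<^sub>L (coset_graph A K V E) = V" "arcs\<^sub>L (coset_graph A K V E) = E"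
  "org (coset_graph A K V E) e = fst e"
  "ter (coset_graph A K V E) e = fst e #>\<^bsub>free_group A\<^esub> [(snd e, True)]"
  "lab (coset_graph A K V E) e = snd e" "base (coset_graph A K V E) = K"
  by (auto simp: coset_graph_def split: prod.splits)

text \<open>The vertices and edges met by the words of \<open>H\<close> when they are read from the coset \<open>K\<close>.  Only forward
  crossings are recorded; when \<open>H\<close> is a subgroup contained in \<open>K\<close>, the edges crossed backwards are among
  these edges, because the inverse words cross them forwards.\<close>

definition met_vertices :: "'a set \<Rightarrow> 'a word set \<Rightarrow> 'a word set \<Rightarrow> 'a word set set" where
  "met_vertices A H K = {K #>\<^bsub>free_group A\<^esub> y | y z. y @ z \<in> H}"

definition met_edges :: "'a set \<Rightarrow> 'a word set \<Rightarrow> 'a word set \<Rightarrow> ('a word set \<times> 'a) set" where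
  "met_edges A H K = {(K #>\<^bsub>free_group A\<^esub> y, a) | y a z. y @ (a, True) # z \<in> H}"

text \<open>The core graph of \<open>K\<close> is the part of its coset graph that the elements of \<open>K\<close> themselves meet.\<close>

abbreviation core_graph :: "'a set \<Rightarrow> 'a word set \<Rightarrow> ('a word set, 'a word set \<times> 'a, 'a) lgraph" where
  "core_graph A K \<equiv> coset_graph A K (met_vertices A K K) (met_edges A K K)"

context free_group_subgroup
begin

text \<open>The oriented edge crossed by the letter \<open>l\<close> when it is read from the coset of \<open>x\<close>.\<close>

definition crossed :: "'a word \<Rightarrow> 'a \<times> bool \<Rightarrow> ('a word set \<times> 'a) \<times> bool" where
  "crossed x l = ((coset (if snd l then x else reduce (x @ [l])), fst l), snd l)"

lemma crossed_simps:
  assumes "x \<in> carrier (free_group A)" "fst l \<in> A"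
  shows "src (coset_graph A K V E) (crossed x l) = coset x"
    "tgt (coset_graph A K V E) (crossed x l) = coset (reduce (x @ [l]))"
    "letter (coset_graph A K V E) (crossed x l) = l"
proof -
  have c: "[l] \<in> carrier (free_group A)" "[inv_letter l] \<in> carrier (free_group A)"
    using assms by (simp_all add: singleton_in_carrier)
  have "reduce (reduce (x @ [l]) @ [inv_letter l]) = x"
    using reduce_cancel_middle(2)[of x "[l]" "[]"] assms
    by (simp add: winv_Cons reduce_reduced carrier_free_group)
  then have "\<not> snd l \<Longrightarrow> coset (reduce (x @ [l])) #>\<^bsub>free_group A\<^esub> [(fst l, True)] = coset x"
    using coset_mult[of "reduce (x @ [l])" "[inv_letter l]"] reduce_append_in_carrier[OF assms(1) c(1)] c
    by (simp add: inv_letter_def)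
  moreover have "snd l \<Longrightarrow> coset x #>\<^bsub>free_group A\<^esub> [(fst l, True)] = coset (reduce (x @ [l]))"
    using coset_mult[OF assms(1) c(1)] by (cases l) simp
  ultimately show "src (coset_graph A K V E) (crossed x l) = coset x"
    "tgt (coset_graph A K V E) (crossed x l) = coset (reduce (x @ [l]))"
    "letter (coset_graph A K V E) (crossed x l) = l"
    by (auto simp: src_def tgt_def crossed_def letter_def prod_eq_iff)
qed

lemma eq_crossed:
  assumes "fst (fst d) \<in> rcosets\<^bsub>free_group A\<^esub> K" "snd (fst d) \<in> A"
    and x: "x \<in> carrier (free_group A)" "src (coset_graph A K V E) d = coset x"
  shows "d = crossed x (letter (coset_graph A K V E) d)"
proof -
  obtain c a s where d: "d = ((c, a), s)" by (metis prod.collapse)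
  obtain y where y: "y \<in> carrier (free_group A)" "c = coset y"
    using assms d by (auto simp: RCOSETS_def)
  show ?thesis
  proof (cases s)
    case True
    then show ?thesis using d x by (simp add: src_def crossed_def letter_def)
  next
    case False
    have a: "[(a, True)] \<in> carrier (free_group A)" "[(a, False)] \<in> carrier (free_group A)"
      using assms d by (simp_all add: singleton_in_carrier)
    have "coset (reduce (y @ [(a, True)])) = coset x"
      using False x d y a by (simp add: src_def coset_mult)
    then have "coset (reduce (reduce (y @ [(a, True)]) @ [(a, False)])) = coset (reduce (x @ [(a, False)]))"
      by (rule coset_mult_cong) (use a y x reduce_append_in_carrier in auto)
    also have "reduce (reduce (y @ [(a, True)]) @ [(a, False)]) = y"
      using reduce_cancel_middle(2)[of y "[(a, True)]" "[]"] y
      by (simp add: winv_Cons reduce_reduced carrier_free_group)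
    finally show ?thesis using False d y by (simp add: crossed_def letter_def)
  qed
qed

lemma deterministic_coset_graph:
  assumes "E \<subseteq> (rcosets\<^bsub>free_group A\<^esub> K) \<times> A"
  shows "deterministic (coset_graph A K V E)"
  unfolding deterministic_def
proof (intro allI impI)
  let ?C = "coset_graph A K V E"
  fix d d' assume d: "fst d \<in> arcs\<^sub>L ?C" "fst d' \<in> arcs\<^sub>L ?C" "src ?C d = src ?C d'"
    "letter ?C d = letter ?C d'"
  obtain c a s where [simp]: "d = ((c, a), s)" by (metis prod.collapse)
  have ca: "c \<in> rcosets\<^bsub>free_group A\<^esub> K" "a \<in> A" using d assms by auto
  then obtain y where y: "y \<in> carrier (free_group A)" "c = coset y" by (auto simp: RCOSETS_def)
  obtain x where x: "x \<in> carrier (free_group A)" "src ?C d = coset x"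
  proof (cases s)
    case True
    then show ?thesis using that[of y] y by (simp add: src_def)
  next
    case False
    then show ?thesis
      using that[of "reduce (y @ [(a, True)])"] y ca
      by (simp add: src_def coset_mult reduce_append_in_carrier singleton_in_carrier)
  qed
  have "d = crossed x (letter ?C d)" "d' = crossed x (letter ?C d')"
    using x d assms by (intro eq_crossed; auto)+
  then show "d = d'" using d(4) by simp
qed

lemma lpath_coset_graph_target:
  assumes "E \<subseteq> (rcosets\<^bsub>free_group A\<^esub> K) \<times> A" "x \<in> carrier (free_group A)"
    "lpath (coset_graph A K V E) (coset x) \<pi> v"
  shows "fst ` set (path_label (coset_graph A K V E) \<pi>) \<subseteq> A \<and>
    v = coset (reduce (x @ path_label (coset_graph A K V E) \<pi>))"
  using assms(2,3)
proof (induction \<pi> arbitrary: x)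
  case Nil
  then show ?case by (simp add: reduce_reduced carrier_free_group)
next
  case (Cons d \<pi>)
  let ?C = "coset_graph A K V E"
  let ?l = "letter ?C d"
  have l: "fst ?l \<in> A" using Cons.prems assms(1) by (auto simp: letter_def)
  have "d = crossed x ?l"
    using Cons.prems assms(1) by (intro eq_crossed) auto
  then have "tgt ?C d = coset (reduce (x @ [?l]))"
    using crossed_simps(2)[OF Cons.prems(1) l] by metis
  then show ?case
    using Cons.IH[of "reduce (x @ [?l])"] Cons.prems l
      reduce_append_left[of "x @ [?l]" "path_label ?C \<pi>"]
    by (simp add: reduce_append_in_carrier singleton_in_carrier)
qed

text \<open>For the elements of a subgroup \<open>H\<close> of \<open>K\<close>, reading them in the core graph of \<open>K\<close> stays on the
  edges met by \<open>H\<close>; with \<open>H = K\<close> this yields that the core graph is a reduced graph with language \<open>K\<close>.\<close>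

lemma split_in_K:
  assumes "y @ l # z \<in> K"
  shows "y \<in> carrier (free_group A)" "fst l \<in> A" "y @ [l] \<in> carrier (free_group A)"
    "reduce (y @ [l]) = y @ [l]"
proof -
  have c: "(y @ [l]) @ z \<in> carrier (free_group A)" using K_carrier[OF assms] by simp
  from carrier_free_group_append(1)[OF this]
  show c: "y @ [l] \<in> carrier (free_group A)" .
  then show "y \<in> carrier (free_group A)" "fst l \<in> A" "reduce (y @ [l]) = y @ [l]"
    using carrier_free_group_append by (auto simp: carrier_free_group reduce_reduced)
qed

lemma met_vertices_subset: "met_vertices A K K \<subseteq> rcosets\<^bsub>free_group A\<^esub> K"
  using K_carrier carrier_free_group_append(1)
  by (fastforce simp: met_vertices_def intro: coset_mem_rcosets)

lemma met_edges_subset: "met_edges A K K \<subseteq> met_vertices A K K \<times> A"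
  using split_in_K by (fastforce simp: met_edges_def met_vertices_def)

lemma met_edges_subset_rcosets: "met_edges A K K \<subseteq> (rcosets\<^bsub>free_group A\<^esub> K) \<times> A"
  using met_edges_subset met_vertices_subset by blast

lemma crossed_in_met_edges:
  assumes H: "subgroup H (free_group A)" "H \<subseteq> K" and in_H: "y @ l # z \<in> H"
  shows "fst (crossed y l) \<in> met_edges A H K"
proof (cases "snd l")
  case True
  then show ?thesis using in_H by (cases l) (auto simp: crossed_def met_edges_def)
next
  case False
  then have l: "inv_letter l = (fst l, True)" by (simp add: inv_letter_def)
  have in_K: "y @ l # z \<in> K" using H in_H by blast
  have *: "winv z @ inv_letter l # winv y \<in> H"
    using subgroup.m_inv_closed[OF H(1) in_H] inv_free_group[OF K_carrier[OF in_K]] by (simp add: winv_Cons)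
  then have **: "winv z @ inv_letter l # winv y \<in> K" using H by blast
  have "coset (winv z) = coset (y @ [l])"
  proof (subst coset_eq_iff)
    show "reduce (winv z @ winv (y @ [l])) \<in> K"
      using ** K_carrier[OF **] by (simp add: winv_Cons carrier_free_group reduce_reduced)
  qed (use split_in_K[OF **] split_in_K[OF in_K] in auto)
  then show ?thesis
    using *[unfolded l] False split_in_K[OF in_K] by (auto simp: crossed_def met_edges_def)
qed

lemma coset_in_met_vertices: "y @ z \<in> K \<Longrightarrow> coset y \<in> met_vertices A K K"
  by (auto simp: met_vertices_def)

lemma K_in_met_vertices: "K \<in> met_vertices A K K"
  using coset_in_met_vertices[of "[]" "[]"] Nil_in_K by simp

lemma wf_core_graph: "wf_digraph (dgr (core_graph A K))"
proof
  fix e assume e: "e \<in> arcs\<^sub>L (core_graph A K)"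
  then show "org (core_graph A K) e \<in> verts\<^sub>L (core_graph A K)"
    using met_edges_subset by auto
  from e obtain y a z where e: "e = (coset y, a)" "y @ (a, True) # z \<in> K" by (auto simp: met_edges_def)
  then have "ter (core_graph A K) e = coset (y @ [(a, True)])"
    using split_in_K[OF e(2)] by (simp add: coset_mult singleton_in_carrier)
  then show "ter (core_graph A K) e \<in> verts\<^sub>L (core_graph A K)"
    using coset_in_met_vertices[of "y @ [(a, True)]" z] e by simp
qed

lemma ex_lpath_core_graph:
  assumes H: "subgroup H (free_group A)" "H \<subseteq> K" and "y @ w @ z \<in> H"
  shows "\<exists>\<pi>. lpath (core_graph A K) (coset y) \<pi> (coset (y @ w)) \<and> path_label (core_graph A K) \<pi> = w \<and>
    fst ` set \<pi> \<subseteq> met_edges A H K"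
  using assms(3)
proof (induction w arbitrary: y)
  case Nil
  then show ?case using H(2) by (intro exI[of _ "[]"]) (auto intro: coset_in_met_vertices)
next
  case (Cons l w)
  then obtain \<pi> where \<pi>: "lpath (core_graph A K) (coset (y @ [l])) \<pi> (coset ((y @ [l]) @ w))"
    "path_label (core_graph A K) \<pi> = w" "fst ` set \<pi> \<subseteq> met_edges A H K"
    using Cons.IH[of "y @ [l]"] by auto
  have in_H: "y @ l # (w @ z) \<in> H" using Cons.prems by simp
  then have in_K: "y @ l # (w @ z) \<in> K" using H(2) by blast
  have "fst (crossed y l) \<in> met_edges A H K" by (rule crossed_in_met_edges[OF H in_H])
  moreover from this have "fst (crossed y l) \<in> met_edges A K K" using H(2) by (auto simp: met_edges_def)
  ultimately show ?case
    using split_in_K[OF in_K] crossed_simps[of y l] \<pi> by (intro exI[of _ "crossed y l # \<pi>"]) simp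
qed

lemma deterministic_core_graph: "deterministic (core_graph A K)"
  by (rule deterministic_coset_graph[OF met_edges_subset_rcosets])

lemma lang_core_graph: "lang (core_graph A K) = K"
proof (intro equalityI subsetI)
  fix w assume "w \<in> lang (core_graph A K)"
  then obtain \<pi> where \<pi>: "w = path_label (core_graph A K) \<pi>" "lpath (core_graph A K) K \<pi> K"
    "reduced_word w"
    by (auto simp: lang_def)
  have "K = coset w \<and> fst ` set w \<subseteq> A"
    using lpath_coset_graph_target[OF met_edges_subset_rcosets, where x = "[]" and \<pi> = \<pi> and
        V = "met_vertices A K K" and v = K] \<pi> F.one_closed
    by (simp add: reduce_reduced)
  then show "w \<in> K" using self_in_coset[of w] \<pi>(3) by (auto simp: carrier_free_group)
next
  fix w assume w: "w \<in> K"
  then obtain \<pi> where "lpath (core_graph A K) (coset []) \<pi> (coset w)" "path_label (core_graph A K) \<pi> = w"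
    using ex_lpath_core_graph[OF K subset_refl, of "[]" w "[]"] by auto
  then show "w \<in> lang (core_graph A K)"
    using w K_carrier[OF w] coset_eq_K_iff[of w] by (auto simp: lang_def carrier_free_group)
qed

lemma reduced_core_graph: "reduced_graph A (core_graph A K)"
  unfolding reduced_graph_iff
proof (intro conjI ballI)
  let ?C = "core_graph A K"
  have base: "base ?C \<in> verts\<^sub>L ?C" by (simp add: K_in_met_vertices)
  have "\<exists>\<pi>. lpath ?C (base ?C) \<pi> v" if "v \<in> verts\<^sub>L ?C" for v
  proof -
    from that obtain y z where "v = coset y" "[] @ y @ z \<in> K" by (auto simp: met_vertices_def)
    then show ?thesis using ex_lpath_core_graph[OF K subset_refl, of "[]" y z] by auto
  qed
  then show "labeled_graph A ?C"
    unfolding labeled_graph_def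
    using wf_core_graph base connected_iff_lpath_base[OF wf_core_graph base] met_edges_subset
    by auto
  show "deterministic ?C" by (rule deterministic_core_graph)
  fix v assume v: "v \<in> verts\<^sub>L ?C - {base ?C}"
  define P where "P = (\<lambda>y. coset y = v \<and> (\<exists>z. y @ z \<in> K))"
  \<comment> \<open>A shortest representative arrives at \<open>v\<close> along an edge that is not a loop, hence differs from
    the edge along which the word continues.\<close>
  obtain y where y: "P y" "\<And>y'. P y' \<Longrightarrow> length y \<le> length y'"
  proof -
    obtain y0 where "P y0" using v by (auto simp: met_vertices_def P_def)
    from ex_has_least_nat[of P, OF this, of length] show thesis using that by blast
  qed
  obtain z where z: "y @ z \<in> K" "coset y = v" using y(1) by (auto simp: P_def)
  have yc: "y \<in> carrier (free_group A)" "z \<in> carrier (free_group A)"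
    using K_carrier[OF z(1)] carrier_free_group_append by auto
  have "y \<noteq> []" using z v by auto
  then obtain y' l where yl: "y = y' @ [l]" by (metis append_butlast_last_id)
  have "z \<noteq> []" using z v coset_eq_K_iff[OF yc(1)] by auto
  then obtain m z' where zm: "z = m # z'" by (cases z) auto
  have in1: "y' @ l # z \<in> K" and in2: "y @ m # z' \<in> K" using z yl zm by auto
  let ?d = "crossed y' l" and ?d' = "crossed y m"
  have arcs: "fst ?d \<in> arcs\<^sub>L ?C" "fst ?d' \<in> arcs\<^sub>L ?C"
    using crossed_in_met_edges[OF K subset_refl in1] crossed_in_met_edges[OF K subset_refl in2] by auto
  have tgt: "tgt ?C ?d = v" "src ?C ?d = coset y'" and src: "src ?C ?d' = v"
    and lt: "letter ?C ?d = l" "letter ?C ?d' = m"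
    using crossed_simps[of y' l] crossed_simps[of y m] split_in_K[OF in1] split_in_K[OF in2] z yl
    by auto
  have "fst ?d \<noteq> fst ?d'"
  proof
    assume eq: "fst ?d = fst ?d'"
    have "coset y' \<noteq> v" using y(2)[of y'] yl in1 by (auto simp: P_def)
    then have "?d \<noteq> ?d'" using tgt src by auto
    then have "?d' = inv_letter ?d" using eq by (auto simp: inv_letter_def prod_eq_iff)
    then have "m = inv_letter l" using lt by (metis letter_inv_letter)
    moreover have "reduced_word (y' @ l # m # z')"
      using K_carrier[OF z(1)] yl zm by (simp add: carrier_free_group)
    ultimately show False by (auto simp: reduced_word_append reduced_word_Cons)
  qed
  moreover have "org ?C (fst ?d) = v \<or> ter ?C (fst ?d) = v" "org ?C (fst ?d') = v \<or> ter ?C (fst ?d') = v"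
    using tgt src unfolding tgt_def src_def by (metis)+
  ultimately show "\<exists>e\<in>arcs\<^sub>L ?C. \<exists>f\<in>arcs\<^sub>L ?C. e \<noteq> f \<and> (org ?C e = v \<or> ter ?C e = v) \<and>
      (org ?C f = v \<or> ter ?C f = v)"
    using arcs by blast
qed

end

section \<open>Isomorphisms of labeled graphs\<close>

lemma lgraph_morphism_comp:
  assumes "lgraph_morphism \<Gamma> \<Delta> f g" "lgraph_morphism \<Delta> \<Lambda> f' g'"
  shows "lgraph_morphism \<Gamma> \<Lambda> (f' \<circ> f) (g' \<circ> g)"
  using assms unfolding lgraph_morphism_def by (auto simp: image_subset_iff)

lemma lpath_morphism:
  assumes "lgraph_morphism \<Gamma> \<Delta> f g" "lpath \<Gamma> u \<pi> v"
  shows "lpath \<Delta> (f u) (map (apfst g) \<pi>) (f v) \<and> path_label \<Delta> (map (apfst g) \<pi>) = path_label \<Gamma> \<pi>"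
  using assms(2)
proof (induction \<pi> arbitrary: u)
  case Nil
  then show ?case using assms(1) by (auto simp: lgraph_morphism_def)
next
  case (Cons d \<pi>)
  have "src \<Delta> (apfst g d) = f (src \<Gamma> d)" "tgt \<Delta> (apfst g d) = f (tgt \<Gamma> d)"
    "letter \<Delta> (apfst g d) = letter \<Gamma> d" "fst (apfst g d) \<in> arcs\<^sub>L \<Delta>"
    using assms(1) Cons.prems by (auto simp: lgraph_morphism_def src_def tgt_def letter_def)
  then show ?case using Cons by auto
qed

text \<open>An isomorphism is a morphism that is bijective on vertices and on edges.\<close>

definition lgraph_iso ::
  "('v, 'e, 'a) lgraph \<Rightarrow> ('w, 'f, 'a) lgraph \<Rightarrow> ('v \<Rightarrow> 'w) \<Rightarrow> ('e \<Rightarrow> 'f) \<Rightarrow> bool" where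
  "lgraph_iso \<Gamma> \<Delta> f g \<longleftrightarrow> lgraph_morphism \<Gamma> \<Delta> f g \<and> bij_betw f (verts\<^sub>L \<Gamma>) (verts\<^sub>L \<Delta>) \<and>
     bij_betw g (arcs\<^sub>L \<Gamma>) (arcs\<^sub>L \<Delta>)"

lemma lgraph_iso_sym:
  assumes iso: "lgraph_iso \<Gamma> \<Delta> f g" and wf: "wf_digraph (dgr \<Gamma>)" and base: "base \<Gamma> \<in> verts\<^sub>L \<Gamma>"
  shows "lgraph_iso \<Delta> \<Gamma> (inv_into (verts\<^sub>L \<Gamma>) f) (inv_into (arcs\<^sub>L \<Gamma>) g)"
proof -
  let ?f = "inv_into (verts\<^sub>L \<Gamma>) f" and ?g = "inv_into (arcs\<^sub>L \<Gamma>) g"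
  have m: "lgraph_morphism \<Gamma> \<Delta> f g" and f: "bij_betw f (verts\<^sub>L \<Gamma>) (verts\<^sub>L \<Delta>)"
    and g: "bij_betw g (arcs\<^sub>L \<Gamma>) (arcs\<^sub>L \<Delta>)"
    using iso by (auto simp: lgraph_iso_def)
  have bij: "bij_betw ?f (verts\<^sub>L \<Delta>) (verts\<^sub>L \<Gamma>)" "bij_betw ?g (arcs\<^sub>L \<Delta>) (arcs\<^sub>L \<Gamma>)"
    using f g by (simp_all add: bij_betw_inv_into)
  have left: "?f (f v) = v" if "v \<in> verts\<^sub>L \<Gamma>" for v
    using that f by (simp add: bij_betw_inv_into_left)
  have "org \<Gamma> (?g e) = ?f (org \<Delta> e) \<and> ter \<Gamma> (?g e) = ?f (ter \<Delta> e) \<and> lab \<Gamma> (?g e) = lab \<Delta> e"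
    if "e \<in> arcs\<^sub>L \<Delta>" for e
  proof -
    have e: "?g e \<in> arcs\<^sub>L \<Gamma>" "g (?g e) = e"
      using that g bij(2) by (auto simp: bij_betw_inv_into_right bij_betw_def)
    then have "org \<Gamma> (?g e) \<in> verts\<^sub>L \<Gamma>" "ter \<Gamma> (?g e) \<in> verts\<^sub>L \<Gamma>"
      using wf by (auto simp: wf_digraph_def)
    then show ?thesis using m e left unfolding lgraph_morphism_def by metis
  qed
  moreover have "?f (base \<Delta>) = base \<Gamma>"
    using m left[OF base] by (auto simp: lgraph_morphism_def)
  ultimately have "lgraph_morphism \<Delta> \<Gamma> ?f ?g"
    using bij by (auto simp: lgraph_morphism_def bij_betw_def)
  then show ?thesis using bij by (simp add: lgraph_iso_def)
qed

lemma lang_subset_morphism: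
  assumes "lgraph_morphism \<Gamma> \<Delta> f g"
  shows "lang \<Gamma> \<subseteq> lang \<Delta>"
proof
  fix w assume "w \<in> lang \<Gamma>"
  then obtain \<pi> where \<pi>: "lpath \<Gamma> (base \<Gamma>) \<pi> (base \<Gamma>)" "w = path_label \<Gamma> \<pi>" "reduced_word w"
    by (auto simp: lang_def)
  moreover have "f (base \<Gamma>) = base \<Delta>" using assms by (simp add: lgraph_morphism_def)
  ultimately show "w \<in> lang \<Delta>"
    using lpath_morphism[OF assms \<pi>(1)] unfolding lang_def
    by (intro CollectI exI[of _ "map (apfst g) \<pi>"]) auto
qed

lemma lang_iso:
  assumes "lgraph_iso \<Gamma> \<Delta> f g" "wf_digraph (dgr \<Gamma>)" "base \<Gamma> \<in> verts\<^sub>L \<Gamma>"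
  shows "lang \<Gamma> = lang \<Delta>"
proof
  show "lang \<Gamma> \<subseteq> lang \<Delta>"
    using assms by (auto simp: lgraph_iso_def dest: lang_subset_morphism)
  show "lang \<Delta> \<subseteq> lang \<Gamma>"
    using lgraph_iso_sym[OF assms] by (auto simp: lgraph_iso_def dest: lang_subset_morphism)
qed

lemma reduced_graph_iso:
  assumes iso: "lgraph_iso \<Gamma> \<Delta> f g" and R: "reduced_graph A \<Gamma>"
  shows "reduced_graph A \<Delta>"
proof -
  have m: "lgraph_morphism \<Gamma> \<Delta> f g" and f: "bij_betw f (verts\<^sub>L \<Gamma>) (verts\<^sub>L \<Delta>)"
    and g: "bij_betw g (arcs\<^sub>L \<Gamma>) (arcs\<^sub>L \<Delta>)"
    using iso by (auto simp: lgraph_iso_def)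
  have wf: "wf_digraph (dgr \<Gamma>)" and base: "base \<Gamma> \<in> verts\<^sub>L \<Gamma>"
    and conn: "Digraph_Component.connected (dgr \<Gamma>)" and lab: "lab \<Gamma> ` arcs\<^sub>L \<Gamma> \<subseteq> A"
    using R by (auto simp: reduced_graph_def labeled_graph_def)
  have e: "org \<Delta> (g e) = f (org \<Gamma> e)" "ter \<Delta> (g e) = f (ter \<Gamma> e)" "lab \<Delta> (g e) = lab \<Gamma> e"
    if "e \<in> arcs\<^sub>L \<Gamma>" for e
    using m that by (auto simp: lgraph_morphism_def)
  have V: "verts\<^sub>L \<Delta> = f ` verts\<^sub>L \<Gamma>" and E: "arcs\<^sub>L \<Delta> = g ` arcs\<^sub>L \<Gamma>"
    using f g by (auto simp: bij_betw_def)
  have base': "base \<Delta> = f (base \<Gamma>)" using m by (simp add: lgraph_morphism_def)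
  have ends: "org \<Gamma> e \<in> verts\<^sub>L \<Gamma>" "ter \<Gamma> e \<in> verts\<^sub>L \<Gamma>" if "e \<in> arcs\<^sub>L \<Gamma>" for e
    using wf that by (auto simp: wf_digraph_def)
  have inj_f: "f u = f v \<longleftrightarrow> u = v" if "u \<in> verts\<^sub>L \<Gamma>" "v \<in> verts\<^sub>L \<Gamma>" for u v
    using f that by (auto simp: bij_betw_def inj_on_def)
  have inj_g: "g e = g e' \<longleftrightarrow> e = e'" if "e \<in> arcs\<^sub>L \<Gamma>" "e' \<in> arcs\<^sub>L \<Gamma>" for e e'
    using g that by (auto simp: bij_betw_def inj_on_def)
  have wf': "wf_digraph (dgr \<Delta>)"
    by standard (auto simp: V E e ends)
  have "\<exists>\<pi>. lpath \<Delta> (base \<Delta>) \<pi> v" if v: "v \<in> verts\<^sub>L \<Delta>" for v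
  proof -
    obtain u where "u \<in> verts\<^sub>L \<Gamma>" "v = f u" using v V by auto
    moreover from this obtain \<pi> where "lpath \<Gamma> (base \<Gamma>) \<pi> u"
      using conn by (auto simp: connected_iff_lpath_base[OF wf base])
    ultimately show ?thesis using lpath_morphism[OF m] base' by metis
  qed
  then have "labeled_graph A \<Delta>"
    using wf' base lab by (auto simp: labeled_graph_def connected_iff_lpath_base V E base' e)
  moreover have "\<forall>e\<in>arcs\<^sub>L \<Delta>. \<forall>e'\<in>arcs\<^sub>L \<Delta>. e \<noteq> e' \<and> org \<Delta> e = org \<Delta> e' \<longrightarrow> lab \<Delta> e \<noteq> lab \<Delta> e'"
    "\<forall>e\<in>arcs\<^sub>L \<Delta>. \<forall>e'\<in>arcs\<^sub>L \<Delta>. e \<noteq> e' \<and> ter \<Delta> e = ter \<Delta> e' \<longrightarrow> lab \<Delta> e \<noteq> lab \<Delta> e'"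
    using R by (auto simp: reduced_graph_def E e ends inj_f inj_g)
  moreover have "\<exists>e\<in>arcs\<^sub>L \<Delta>. \<exists>e'\<in>arcs\<^sub>L \<Delta>. e \<noteq> e' \<and>
        (org \<Delta> e = v \<or> ter \<Delta> e = v) \<and> (org \<Delta> e' = v \<or> ter \<Delta> e' = v)"
    if v: "v \<in> verts\<^sub>L \<Delta> - {base \<Delta>}" for v
  proof -
    obtain u where u: "u \<in> verts\<^sub>L \<Gamma> - {base \<Gamma>}" "v = f u" using v V base' by auto
    have "\<forall>v\<in>verts\<^sub>L \<Gamma> - {base \<Gamma>}. \<exists>e\<in>arcs\<^sub>L \<Gamma>. \<exists>f\<in>arcs\<^sub>L \<Gamma>. e \<noteq> f \<and>
        (org \<Gamma> e = v \<or> ter \<Gamma> e = v) \<and> (org \<Gamma> f = v \<or> ter \<Gamma> f = v)"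
      using R unfolding reduced_graph_def by (elim conjE)
    from bspec[OF this u(1)] obtain e1 e2 where e12: "e1 \<in> arcs\<^sub>L \<Gamma>" "e2 \<in> arcs\<^sub>L \<Gamma>" "e1 \<noteq> e2"
      "org \<Gamma> e1 = u \<or> ter \<Gamma> e1 = u" "org \<Gamma> e2 = u \<or> ter \<Gamma> e2 = u"
      by blast
    then show ?thesis
      using u by (intro bexI[of _ "g e1"] bexI[of _ "g e2"]) (auto simp: E e inj_g)
  qed
  ultimately show ?thesis unfolding reduced_graph_def by blast
qed

lemma fin_digraph_iso:
  assumes iso: "lgraph_iso \<Gamma> \<Delta> f g" and "wf_digraph (dgr \<Delta>)" "fin_digraph (dgr \<Gamma>)"
  shows "fin_digraph (dgr \<Delta>)"
proof -
  have "finite (verts\<^sub>L \<Delta>)" "finite (arcs\<^sub>L \<Delta>)"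
    using assms bij_betw_finite unfolding lgraph_iso_def
    by (auto dest: fin_digraph.finite_verts fin_digraph.finite_arcs)
  then show ?thesis using assms(2) by (simp add: fin_digraph_def fin_digraph_axioms_def)
qed

lemma ex_iso_nat_lgraph:
  assumes wf: "wf_digraph (dgr \<Gamma>)" and fin: "finite (verts\<^sub>L \<Gamma>)" "finite (arcs\<^sub>L \<Gamma>)"
  shows "\<exists>(\<Delta> :: (nat, nat, 'a) lgraph) f g. lgraph_iso (\<Gamma> :: ('v, 'e, 'a) lgraph) \<Delta> f g"
proof -
  obtain f :: "'v \<Rightarrow> nat" where f: "inj_on f (verts\<^sub>L \<Gamma>)"
    using finite_imp_inj_to_nat_seg[OF fin(1)] by blast
  obtain g :: "'e \<Rightarrow> nat" where g: "inj_on g (arcs\<^sub>L \<Gamma>)"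
    using finite_imp_inj_to_nat_seg[OF fin(2)] by blast
  let ?h = "inv_into (arcs\<^sub>L \<Gamma>) g"
  define \<Delta> :: "(nat, nat, 'a) lgraph" where
    "\<Delta> = \<lparr>dgr = \<lparr>verts = f ` verts\<^sub>L \<Gamma>, arcs = g ` arcs\<^sub>L \<Gamma>,
                 tail = f \<circ> org \<Gamma> \<circ> ?h, head = f \<circ> ter \<Gamma> \<circ> ?h\<rparr>,
           lab = lab \<Gamma> \<circ> ?h, base = f (base \<Gamma>)\<rparr>"
  have "lgraph_iso \<Gamma> \<Delta> f g"
    using f g by (auto simp: lgraph_iso_def lgraph_morphism_def \<Delta>_def bij_betw_def)
  then show ?thesis by blast
qed

section \<open>Uniqueness of the graph of a subgroup\<close>

text \<open>The coset of the language that corresponds to a vertex: the reduced labels of the paths from the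
  base vertex to it.\<close>

definition vertex_coset :: "('v, 'e, 'a) lgraph \<Rightarrow> 'v \<Rightarrow> 'a word set" where
  "vertex_coset \<Gamma> v = {w. reduced_word w \<and> (\<exists>\<pi>. lpath \<Gamma> (base \<Gamma>) \<pi> v \<and> path_label \<Gamma> \<pi> = w)}"

lemma letters_path_label:
  assumes "lab \<Gamma> ` arcs\<^sub>L \<Gamma> \<subseteq> A" "lpath \<Gamma> u \<pi> v"
  shows "fst ` set (path_label \<Gamma> \<pi>) \<subseteq> A"
  using assms(2) by (induction \<pi> arbitrary: u) (use assms(1) in \<open>auto simp: letter_def\<close>)

context free_group_subgroup
begin

text \<open>A finite reduced graph with language \<open>K\<close> is isomorphic to the core graph of \<open>K\<close>: all its edges
  lie on reduced loops at the base vertex.\<close>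

lemma lgraph_iso_core_graph:
  assumes R: "reduced_graph A \<Gamma>" and fin: "fin_digraph (dgr \<Gamma>)" and lang: "lang \<Gamma> = K"
  shows "lgraph_iso \<Gamma> (core_graph A K) (vertex_coset \<Gamma>) (\<lambda>e. (vertex_coset \<Gamma> (org \<Gamma> e), lab \<Gamma> e))"
proof -
  let ?f = "vertex_coset \<Gamma>" and ?g = "\<lambda>e. (vertex_coset \<Gamma> (org \<Gamma> e), lab \<Gamma> e)"
  have wf: "wf_digraph (dgr \<Gamma>)" and base: "base \<Gamma> \<in> verts\<^sub>L \<Gamma>"
    and conn: "Digraph_Component.connected (dgr \<Gamma>)" and lab: "lab \<Gamma> ` arcs\<^sub>L \<Gamma> \<subseteq> A"
    using R by (auto simp: reduced_graph_def labeled_graph_def)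
  have det: "deterministic \<Gamma>" using R by (simp add: reduced_graph_iff)
  note app = lpath_append[OF wf]
  have in_lang: "reduce (path_label \<Gamma> \<pi>) \<in> K" if "lpath \<Gamma> (base \<Gamma>) \<pi> (base \<Gamma>)" for \<pi>
    using ex_lpath_reduced_label[OF wf det that] lang unfolding lang_def
    by (smt (verit, best) mem_Collect_eq reduced_reduce)
  have carrier: "path_label \<Gamma> \<pi> \<in> carrier (free_group A)"
    if "lpath \<Gamma> u \<pi> v" "reduced_word (path_label \<Gamma> \<pi>)" for u v \<pi>
    using letters_path_label[OF lab that(1)] that(2) by (simp add: carrier_free_group)
  have f: "?f v = coset (path_label \<Gamma> \<pi>)"
    if \<pi>: "lpath \<Gamma> (base \<Gamma>) \<pi> v" "reduced_word (path_label \<Gamma> \<pi>)" for v \<pi>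
  proof (intro equalityI subsetI)
    let ?x = "path_label \<Gamma> \<pi>"
    fix w assume "w \<in> ?f v"
    then obtain \<rho> where \<rho>: "lpath \<Gamma> (base \<Gamma>) \<rho> v" "path_label \<Gamma> \<rho> = w" "reduced_word w"
      by (auto simp: vertex_coset_def)
    have "lpath \<Gamma> (base \<Gamma>) (\<rho> @ winv \<pi>) (base \<Gamma>)"
      using \<rho>(1) lpath_winv[OF wf \<pi>(1)] app by blast
    from in_lang[OF this] show "w \<in> coset ?x"
      using carrier[OF \<pi>] carrier[OF \<rho>(1)] \<rho> by (simp add: mem_coset_iff)
  next
    let ?x = "path_label \<Gamma> \<pi>"
    fix w assume w: "w \<in> coset ?x"
    have wc: "w \<in> carrier (free_group A)"
      using w F.r_coset_subset_G[OF subgroup.subset[OF K] carrier[OF \<pi>]] by blast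
    then have "reduce (w @ winv ?x) \<in> lang \<Gamma>" using w carrier[OF \<pi>] lang by (simp add: mem_coset_iff)
    then obtain \<sigma> where \<sigma>: "lpath \<Gamma> (base \<Gamma>) \<sigma> (base \<Gamma>)" "path_label \<Gamma> \<sigma> = reduce (w @ winv ?x)"
      by (auto simp: lang_def)
    have p: "lpath \<Gamma> (base \<Gamma>) (\<sigma> @ \<pi>) v" using \<sigma>(1) \<pi>(1) app by blast
    have "reduce (path_label \<Gamma> (\<sigma> @ \<pi>)) = w"
      using reduce_cancel_middle(1)[of w ?x "[]"] wc \<sigma> by (simp add: carrier_free_group reduce_reduced)
    then show "w \<in> ?f v"
      using ex_lpath_reduced_label[OF wf det p] wc by (auto simp: vertex_coset_def carrier_free_group)
  qed
  have ex_path: "\<exists>\<pi>. lpath \<Gamma> (base \<Gamma>) \<pi> v \<and> reduced_word (path_label \<Gamma> \<pi>)" if "v \<in> verts\<^sub>L \<Gamma>" for v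
  proof -
    obtain \<pi> where "lpath \<Gamma> (base \<Gamma>) \<pi> v"
      using conn \<open>v \<in> verts\<^sub>L \<Gamma>\<close> by (auto simp: connected_iff_lpath_base[OF wf base])
    from ex_lpath_reduced_label[OF wf det this] show ?thesis by (metis reduced_reduce)
  qed
  have f_base: "?f (base \<Gamma>) = K"
    using f[of "[]" "base \<Gamma>"] base by simp
  have inj_f: "inj_on ?f (verts\<^sub>L \<Gamma>)"
  proof (rule inj_onI)
    fix u v assume uv: "u \<in> verts\<^sub>L \<Gamma>" "v \<in> verts\<^sub>L \<Gamma>" "?f u = ?f v"
    obtain \<pi> where \<pi>: "lpath \<Gamma> (base \<Gamma>) \<pi> u" "reduced_word (path_label \<Gamma> \<pi>)"
      using ex_path uv by blast
    then have "path_label \<Gamma> \<pi> \<in> ?f u" by (auto simp: vertex_coset_def)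
    then obtain \<rho> where "lpath \<Gamma> (base \<Gamma>) \<rho> v" "path_label \<Gamma> \<rho> = path_label \<Gamma> \<pi>"
      using uv(3) by (auto simp: vertex_coset_def)
    then show "u = v" using lpath_label_unique[OF det \<pi>(1)] by metis
  qed
  have inj_g: "inj_on ?g (arcs\<^sub>L \<Gamma>)"
  proof (rule inj_onI)
    fix e e' assume e: "e \<in> arcs\<^sub>L \<Gamma>" "e' \<in> arcs\<^sub>L \<Gamma>" "?g e = ?g e'"
    then have "org \<Gamma> e = org \<Gamma> e'"
      using inj_f wf by (auto simp: inj_on_def wf_digraph_def)
    then show "e = e'"
      using deterministicD[OF det, of "(e, True)" "(e', True)"] e by (auto simp: src_def letter_def)
  qed
  have through: "\<exists>y z. ?f (src \<Gamma> d) = coset y \<and> y @ letter \<Gamma> d # z \<in> K" if d: "fst d \<in> arcs\<^sub>L \<Gamma>" for d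
  proof -
    obtain \<pi> \<rho> where p: "lpath \<Gamma> (base \<Gamma>) (\<pi> @ d # \<rho>) (base \<Gamma>)" "reduced_word (\<pi> @ d # \<rho>)"
      using ex_reduced_loop_through[OF R fin d] by blast
    then have "path_label \<Gamma> \<pi> @ letter \<Gamma> d # path_label \<Gamma> \<rho> \<in> lang \<Gamma>"
      using reduced_path_label[OF det p(1)] unfolding lang_def
      by (intro CollectI exI[of _ "\<pi> @ d # \<rho>"]) simp
    moreover have "reduced_word (path_label \<Gamma> \<pi>)"
      using reduced_path_label[OF det p(1)] p(2) by (auto simp: reduced_word_append)
    moreover have "lpath \<Gamma> (base \<Gamma>) \<pi> (src \<Gamma> d)" using p(1) by (auto simp: app)
    ultimately show ?thesis using f lang by blast
  qed
  have onto: "\<exists>v\<in>verts\<^sub>L \<Gamma>. ?f v = coset y \<and>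
      (\<forall>a z'. z = (a, True) # z' \<longrightarrow> (\<exists>e\<in>arcs\<^sub>L \<Gamma>. org \<Gamma> e = v \<and> lab \<Gamma> e = a))"
    if yz: "y @ z \<in> K" for y z
  proof -
    obtain \<sigma> where \<sigma>: "lpath \<Gamma> (base \<Gamma>) \<sigma> (base \<Gamma>)" "path_label \<Gamma> \<sigma> = y @ z"
      using yz lang by (auto simp: lang_def)
    then obtain \<pi> \<rho> where \<pi>: "\<sigma> = \<pi> @ \<rho>" "path_label \<Gamma> \<pi> = y" "path_label \<Gamma> \<rho> = z"
      by (auto simp: path_label_letter map_eq_append_conv)
    then obtain v where v: "lpath \<Gamma> (base \<Gamma>) \<pi> v" "lpath \<Gamma> v \<rho> (base \<Gamma>)" using \<sigma>(1) by (auto simp: app)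
    have "reduced_word y" using K_carrier[OF yz] by (auto simp: carrier_free_group reduced_word_append)
    then have "?f v = coset y" using f[OF v(1)] \<pi> by simp
    moreover have "\<exists>e\<in>arcs\<^sub>L \<Gamma>. org \<Gamma> e = v \<and> lab \<Gamma> e = a" if "z = (a, True) # z'" for a z'
    proof -
      have "path_label \<Gamma> \<rho> = (a, True) # z'" using that \<pi> by simp
      then obtain d \<rho>' where "\<rho> = d # \<rho>'" "letter \<Gamma> d = (a, True)" by (cases \<rho>) auto
      then show ?thesis using v(2) by (intro bexI[of _ "fst d"]) (auto simp: letter_def src_def)
    qed
    ultimately show ?thesis using lpath_in_verts(2)[OF wf v(1)] by blast
  qed
  have "?f ` verts\<^sub>L \<Gamma> = met_vertices A K K"
  proof (intro equalityI subsetI)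
    fix c assume "c \<in> ?f ` verts\<^sub>L \<Gamma>"
    then obtain v where v: "v \<in> verts\<^sub>L \<Gamma>" "c = ?f v" by blast
    show "c \<in> met_vertices A K K"
    proof (cases "v = base \<Gamma>")
      case True
      then show ?thesis using v f_base K_in_met_vertices by simp
    next
      case False
      have "\<forall>v\<in>verts\<^sub>L \<Gamma> - {base \<Gamma>}. \<exists>e\<in>arcs\<^sub>L \<Gamma>. \<exists>f\<in>arcs\<^sub>L \<Gamma>. e \<noteq> f \<and>
          (org \<Gamma> e = v \<or> ter \<Gamma> e = v) \<and> (org \<Gamma> f = v \<or> ter \<Gamma> f = v)"
        using R unfolding reduced_graph_def by (elim conjE)
      from bspec[OF this, of v] obtain e where e: "e \<in> arcs\<^sub>L \<Gamma>" "org \<Gamma> e = v \<or> ter \<Gamma> e = v"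
        using v False by blast
      then have "src \<Gamma> (e, org \<Gamma> e = v) = v" by (auto simp: src_def)
      then show ?thesis using through[of "(e, org \<Gamma> e = v)"] e v coset_in_met_vertices by auto
    qed
  next
    fix c assume "c \<in> met_vertices A K K"
    then show "c \<in> ?f ` verts\<^sub>L \<Gamma>" using onto by (fastforce simp: met_vertices_def)
  qed
  then have bij_f: "bij_betw ?f (verts\<^sub>L \<Gamma>) (verts\<^sub>L (core_graph A K))"
    using inj_f by (simp add: bij_betw_def)
  have "?g ` arcs\<^sub>L \<Gamma> = met_edges A K K"
  proof (intro equalityI subsetI)
    fix c assume "c \<in> ?g ` arcs\<^sub>L \<Gamma>"
    then obtain e where e: "e \<in> arcs\<^sub>L \<Gamma>" "c = ?g e" by blast
    then show "c \<in> met_edges A K K"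
      using through[of "(e, True)"] by (auto simp: met_edges_def src_def letter_def)
  next
    fix c assume "c \<in> met_edges A K K"
    then obtain y a z where c: "c = (coset y, a)" "y @ (a, True) # z \<in> K" by (auto simp: met_edges_def)
    from onto[OF c(2)] obtain e where "e \<in> arcs\<^sub>L \<Gamma>" "?f (org \<Gamma> e) = coset y" "lab \<Gamma> e = a" by blast
    then show "c \<in> ?g ` arcs\<^sub>L \<Gamma>" using c by force
  qed
  then have bij_g: "bij_betw ?g (arcs\<^sub>L \<Gamma>) (arcs\<^sub>L (core_graph A K))"
    using inj_g by (simp add: bij_betw_def)
  have ter: "?f (org \<Gamma> e) #>\<^bsub>free_group A\<^esub> [(lab \<Gamma> e, True)] = ?f (ter \<Gamma> e)" if e: "e \<in> arcs\<^sub>L \<Gamma>" for e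
  proof -
    obtain \<pi> where \<pi>: "lpath \<Gamma> (base \<Gamma>) \<pi> (org \<Gamma> e)" "reduced_word (path_label \<Gamma> \<pi>)"
      using ex_path[of "org \<Gamma> e"] e wf by (auto simp: wf_digraph_def)
    have p: "lpath \<Gamma> (base \<Gamma>) (\<pi> @ [(e, True)]) (ter \<Gamma> e)"
      using \<pi> e wf by (auto simp: app src_def tgt_def wf_digraph_def)
    have "?f (ter \<Gamma> e) = coset (path_label \<Gamma> (reduce (\<pi> @ [(e, True)])))"
      using f ex_lpath_reduced_label[OF wf det p] by (metis reduced_reduce)
    also have "path_label \<Gamma> (reduce (\<pi> @ [(e, True)])) = reduce (path_label \<Gamma> \<pi> @ [(lab \<Gamma> e, True)])"
      using ex_lpath_reduced_label[OF wf det p] by (simp add: letter_def)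
    finally show ?thesis
      using f[OF \<pi>] carrier[OF \<pi>] lab e
      by (auto simp: coset_mult singleton_in_carrier)
  qed
  have "lgraph_morphism \<Gamma> (core_graph A K) ?f ?g"
    using bij_f bij_g ter f_base by (auto simp: lgraph_morphism_def bij_betw_def)
  then show ?thesis using bij_f bij_g by (simp add: lgraph_iso_def)
qed

lemma subgroup_graph:
  assumes "finite A" "finite (met_vertices A K K)"
  shows "reduced_graph A (subgroup_graph A K)" "fin_digraph (dgr (subgroup_graph A K))"
    "lang (subgroup_graph A K) = K"
proof -
  let ?C = "core_graph A K"
  have fin: "finite (verts\<^sub>L ?C)" "finite (arcs\<^sub>L ?C)"
    using assms finite_subset[OF met_edges_subset] by auto
  then have finC: "fin_digraph (dgr ?C)"
    using wf_core_graph by (simp add: fin_digraph_def fin_digraph_axioms_def)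
  obtain \<Delta> :: "(nat, nat, 'a) lgraph" and f g where iso: "lgraph_iso ?C \<Delta> f g"
    using ex_iso_nat_lgraph[OF wf_core_graph fin] by blast
  have R: "reduced_graph A \<Delta>" by (rule reduced_graph_iso[OF iso reduced_core_graph])
  moreover have "fin_digraph (dgr \<Delta>)"
    by (rule fin_digraph_iso[OF iso _ finC]) (use R in \<open>simp add: reduced_graph_def labeled_graph_def\<close>)
  moreover have "lang \<Delta> = K"
    using lang_iso[OF iso wf_core_graph] K_in_met_vertices lang_core_graph by simp
  ultimately have "\<exists>\<Delta> :: (nat, nat, 'a) lgraph. reduced_graph A \<Delta> \<and> fin_digraph (dgr \<Delta>) \<and> lang \<Delta> = K"
    by blast
  from someI_ex[OF this] show "reduced_graph A (subgroup_graph A K)"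
    "fin_digraph (dgr (subgroup_graph A K))" "lang (subgroup_graph A K) = K"
    by (auto simp: subgroup_graph_def)
qed

end

section \<open>Finitely generated subgroups and finite core graphs\<close>

context free_group_subgroup
begin

text \<open>By \<open>prefix_of_reduce\<close>, a product of generators meets only vertices that are met by a generator or the
  inverse of a generator.\<close>

lemma finite_met_vertices:
  assumes S: "finite S" "S \<subseteq> carrier (free_group A)" "K = generate (free_group A) S"
  shows "finite (met_vertices A K K)"
proof -
  define P where "P w = coset ` {y. \<exists>z. w = y @ z}" for w
  define V where "V = P [] \<union> (\<Union>s\<in>S. P s \<union> P (winv s))"
  have "finite {y. \<exists>z. w = y @ z}" for w :: "'a word"
  proof (rule finite_subset)
    show "{y. \<exists>z. w = y @ z} \<subseteq> (\<lambda>n. take n w) ` {..length w}"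
    proof
      fix y assume "y \<in> {y. \<exists>z. w = y @ z}"
      then show "y \<in> (\<lambda>n. take n w) ` {..length w}" by (intro image_eqI[of _ _ "length y"]) auto
    qed
  qed simp
  then have "finite V" using S(1) by (auto simp: V_def P_def)
  moreover have "P w \<subseteq> V" if "w \<in> K" for w
    using that unfolding S(3)
  proof induction
    case one
    then show ?case by (auto simp: V_def)
  next
    case (incl h)
    then show ?case by (auto simp: V_def)
  next
    case (inv h)
    then show ?case using S(2) inv_free_group[of h A] by (auto simp: V_def)
  next
    case (eng u v)
    have uv: "u \<in> K" "v \<in> K" using eng S(3) by auto
    show ?case
    proof
      fix c assume "c \<in> P (u \<otimes>\<^bsub>free_group A\<^esub> v)"
      then obtain y z where y: "c = coset y" "reduce (u @ v) = y @ z" by (auto simp: P_def)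
      obtain p q where p: "u @ v = p @ q" "reduce p = y" using prefix_of_reduce[OF y(2)] by blast
      then consider r where "u = p @ r" | r where "p = u @ r" "v = r @ q"
        by (auto simp: append_eq_append_conv2)
      then show "c \<in> V"
      proof cases
        case 1
        then have "y = p"
          using p K_carrier[OF uv(1)] by (auto simp: carrier_free_group reduced_word_append reduce_reduced)
        then show ?thesis using 1 y eng.IH by (auto simp: P_def)
      next
        case 2
        have r: "r \<in> carrier (free_group A)"
          using carrier_free_group_append(1) K_carrier[OF uv(2)] 2 by blast
        have "coset y = coset r"
        proof (subst coset_eq_iff)
          show "y \<in> carrier (free_group A)"
            using p 2 r K_carrier[OF uv(1)] reduce_append_in_carrier by blast
          show "reduce (y @ winv r) \<in> K"
            using p 2 uv K_carrier[OF uv(1)] reduce_cancel_middle(2)[of u r "[]"]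
            by (auto simp: carrier_free_group reduce_reduced)
        qed (rule r)
        then show ?thesis using 2 y eng.IH by (auto simp: P_def)
      qed
    qed
  qed
  then have "met_vertices A K K \<subseteq> V" by (auto simp: met_vertices_def P_def)
  ultimately show ?thesis by (rule finite_subset[rotated])
qed

text \<open>Conversely, let \<open>t c\<close> be a representative of each coset \<open>c\<close>, with \<open>t K\<close> the identity.  The elements
  \<open>t(c) a t(ca)\<^sup>-\<^sup>1\<close> for the edges \<open>(c, a)\<close> generate \<open>K\<close>, since the product of these elements along the
  path of a word telescopes.\<close>

lemma fin_gen_subgroup_if_finite:
  assumes fin: "finite (met_edges A K K)"
  shows "fin_gen_subgroup K (free_group A)"
proof -
  define t where "t c = (if c = K then [] else SOME x. x \<in> carrier (free_group A) \<and> c = coset x)" for c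
  have t: "t c \<in> carrier (free_group A) \<and> coset (t c) = c" if "c \<in> rcosets\<^bsub>free_group A\<^esub> K" for c
  proof (cases "c = K")
    case True
    then show ?thesis using F.one_closed by (simp add: t_def)
  next
    case False
    from that have "\<exists>x. x \<in> carrier (free_group A) \<and> c = coset x" by (auto simp: RCOSETS_def)
    from someI_ex[OF this] show ?thesis using False by (auto simp: t_def)
  qed
  define g where "g c l c' = reduce (t c @ l # winv (t c'))" for c l c'
  define S where "S = (\<lambda>(c, a). g c (a, True) (c #>\<^bsub>free_group A\<^esub> [(a, True)])) ` met_edges A K K"
  have coset_t: "t (coset x) \<in> carrier (free_group A)" "coset (t (coset x)) = coset x"
    if "x \<in> carrier (free_group A)" for x
    using t[OF coset_mem_rcosets[OF that]] by auto
  have g_inv: "reduce (g c l c' @ g c' (inv_letter l) c) = []" for c l c'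
  proof -
    have "reduce (g c l c' @ g c' (inv_letter l) c) =
        reduce ((t c @ [l]) @ winv (t c') @ t c' @ inv_letter l # winv (t c))"
      by (simp add: g_def)
    also have "\<dots> = reduce (t c @ [l] @ winv [l] @ winv (t c))"
      by (subst reduce_cancel_middle) (simp add: winv_Cons)
    also have "\<dots> = []" by (subst reduce_cancel_middle) simp
    finally show ?thesis .
  qed
  have g_carrier: "g (coset x) l (coset (reduce (x @ [l]))) \<in> carrier (free_group A)"
    if "x \<in> carrier (free_group A)" "fst l \<in> A" for x l
  proof -
    have "reduce (x @ [l]) \<in> carrier (free_group A)"
      using that by (simp add: reduce_append_in_carrier singleton_in_carrier)
    from winv_in_carrier[OF coset_t(1)[OF this]] coset_t(1)[OF that(1)] that(2)
    show ?thesis unfolding g_def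
      by (intro reduce_in_carrier) (auto simp: carrier_free_group)
  qed
  have g_in_K: "g (coset x) l (coset (reduce (x @ [l]))) \<in> K"
    if "x \<in> carrier (free_group A)" "fst l \<in> A" for x l
  proof -
    let ?c = "coset x" and ?c' = "coset (reduce (x @ [l]))"
    have xl: "reduce (x @ [l]) \<in> carrier (free_group A)" and l: "[l] \<in> carrier (free_group A)"
      using that by (simp_all add: reduce_append_in_carrier singleton_in_carrier)
    have "coset (reduce (t ?c @ [l])) = ?c'"
      using coset_t[OF that(1)] that l by (intro coset_mult_cong) auto
    then have "coset (reduce (t ?c @ [l])) = coset (t ?c')" using coset_t[OF xl] by simp
    then show ?thesis
      using coset_eq_iff[of "reduce (t ?c @ [l])" "t ?c'"] coset_t[OF xl] coset_t[OF that(1)] l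
      by (simp add: g_def reduce_append_in_carrier)
  qed
  have "S \<subseteq> K"
  proof
    fix s assume "s \<in> S"
    then obtain y a z where y: "s = g (coset y) (a, True) (coset y #>\<^bsub>free_group A\<^esub> [(a, True)])"
      "y @ (a, True) # z \<in> K"
      by (auto simp: S_def met_edges_def)
    then show "s \<in> K"
      using g_in_K[of y "(a, True)"] split_in_K[OF y(2)] by (simp add: coset_mult singleton_in_carrier)
  qed
  have step: "g (coset y) l (coset (y @ [l])) \<in> generate (free_group A) S" if in_K: "y @ l # z \<in> K" for y l z
  proof -
    note y = split_in_K[OF in_K]
    note e = crossed_in_met_edges[OF K subset_refl in_K]
    note cs = crossed_simps[OF y(1,2), of "met_vertices A K K" "met_edges A K K"]
    show ?thesis
    proof (cases "snd l")
      case True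
      then have "l = (fst l, True)" by (cases l) simp
      then have "g (coset y) l (coset (y @ [l])) \<in> S"
        using e True y cs unfolding S_def
        by (intro image_eqI[of _ _ "(coset y, fst l)"]) (auto simp: crossed_def tgt_def)
      then show ?thesis by (rule generate.incl)
    next
      case False
      then have l: "inv_letter l = (fst l, True)" by (simp add: inv_letter_def)
      have *: "g (coset (y @ [l])) (inv_letter l) (coset y) \<in> S" (is "?s \<in> S")
        using e False y cs l unfolding S_def
        by (intro image_eqI[of _ _ "(coset (y @ [l]), fst l)"]) (auto simp: crossed_def src_def)
      moreover have "inv\<^bsub>free_group A\<^esub> ?s = g (coset y) l (coset (y @ [l]))"
        using g_inv[of "coset y" l "coset (y @ [l])"] g_carrier[OF y(1,2)] y(4) K_carrier \<open>S \<subseteq> K\<close> *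
        by (intro F.inv_equality) auto
      ultimately show ?thesis using generate.inv by metis
    qed
  qed
  have *: "reduce (y @ winv (t (coset y))) \<in> generate (free_group A) S" if "y @ z \<in> K" for y z
    using that
  proof (induction y arbitrary: z rule: rev_induct)
    case Nil
    then show ?case using generate.one[of "free_group A"] by (simp add: t_def)
  next
    case (snoc l y)
    then have in_K: "y @ l # z \<in> K" by simp
    have "reduce (y @ winv (t (coset y))) \<otimes>\<^bsub>free_group A\<^esub> g (coset y) l (coset (y @ [l]))
        = reduce (y @ winv (t (coset y)) @ t (coset y) @ l # winv (t (coset (y @ [l]))))"
      by (simp add: g_def)
    also have "\<dots> = reduce (y @ l # winv (t (coset (y @ [l]))))"
      by (rule reduce_cancel_middle)
    finally show ?case
      using generate.eng[OF snoc.IH[OF in_K] step[OF in_K]] by simp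
  qed
  have "K \<subseteq> generate (free_group A) S"
  proof
    fix w assume w: "w \<in> K"
    then have "reduce (w @ winv (t K)) \<in> generate (free_group A) S"
      using *[of w "[]"] coset_eq_K_iff[OF K_carrier[OF w]] by simp
    then show "w \<in> generate (free_group A) S"
      using K_carrier[OF w] by (simp add: t_def carrier_free_group reduce_reduced)
  qed
  moreover have "generate (free_group A) S \<subseteq> K"
    by (rule F.generate_subgroup_incl[OF \<open>S \<subseteq> K\<close> K])
  moreover have "finite S" using fin by (simp add: S_def)
  ultimately show ?thesis
    using \<open>S \<subseteq> K\<close> K K_carrier unfolding fin_gen_subgroup_def by blast
qed

text \<open>If every vertex and edge of the core graph of \<open>K\<close> is met by a word of the finitely generated
  subgroup \<open>H\<close>, then the projection \<open>Hx \<mapsto> Kx\<close> of core graphs is onto, so \<open>K\<close> is an overgroup.\<close>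

lemma overgroupI:
  assumes H: "subgroup H (free_group A)" "H \<subseteq> K" and A: "finite A"
    and fin: "finite (met_vertices A H H)"
    and V: "met_vertices A K K \<subseteq> met_vertices A H K" and E: "met_edges A K K \<subseteq> met_edges A H K"
  shows "K \<in> overgroups A H"
proof -
  interpret H: free_group_subgroup A H by (rule free_group_subgroup.intro) (rule H(1))
  have proj: "K <#>\<^bsub>free_group A\<^esub> H.coset y = coset y" if "y \<in> carrier (free_group A)" for y
  proof -
    have "K <#>\<^bsub>free_group A\<^esub> H = K"
    proof
      show "K <#>\<^bsub>free_group A\<^esub> H \<subseteq> K"
        using H(2) subgroup.m_closed[OF K] by (auto simp: set_mult_def)
      have "k \<in> K <#>\<^bsub>free_group A\<^esub> H" if "k \<in> K" for k
      proof -
        have "k \<otimes>\<^bsub>free_group A\<^esub> [] \<in> K <#>\<^bsub>free_group A\<^esub> H"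
          unfolding set_mult_def using that H.Nil_in_K by blast
        then show ?thesis using F.r_one[OF K_carrier[OF that]] unfolding one_free_group by metis
      qed
      then show "K \<subseteq> K <#>\<^bsub>free_group A\<^esub> H" by blast
    qed
    then show ?thesis
      using F.setmult_rcos_assoc[OF subgroup.subset[OF K] subgroup.subset[OF H(1)] that] by simp
  qed
  let ?f = "\<lambda>c. K <#>\<^bsub>free_group A\<^esub> c" and ?g = "\<lambda>(c, a). (K <#>\<^bsub>free_group A\<^esub> c, a)"
  have carr: "y \<in> carrier (free_group A)" if "y @ z \<in> H" for y z
    using H.K_carrier[OF that] carrier_free_group_append by blast
  have fV: "?f ` met_vertices A H H = met_vertices A K K"
  proof -
    have "?f ` met_vertices A H H = met_vertices A H K"
    proof (intro equalityI subsetI)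
      fix c assume "c \<in> ?f ` met_vertices A H H"
      then obtain y z where "c = K <#>\<^bsub>free_group A\<^esub> H.coset y" "y @ z \<in> H"
        by (auto simp: met_vertices_def)
      then show "c \<in> met_vertices A H K" unfolding met_vertices_def using proj carr by blast
    next
      fix c assume "c \<in> met_vertices A H K"
      then obtain y z where y: "c = coset y" "y @ z \<in> H" by (auto simp: met_vertices_def)
      then have "c = ?f (H.coset y)" using proj carr by simp
      moreover have "H.coset y \<in> met_vertices A H H" using y unfolding met_vertices_def by blast
      ultimately show "c \<in> ?f ` met_vertices A H H" by (rule image_eqI)
    qed
    also have "\<dots> = met_vertices A K K" using V H(2) unfolding met_vertices_def by blast
    finally show ?thesis .
  qed
  have gE: "?g ` met_edges A H H = met_edges A K K"
  proof -
    have "?g ` met_edges A H H = met_edges A H K"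
    proof (intro equalityI subsetI)
      fix e assume "e \<in> ?g ` met_edges A H H"
      then obtain y a z where "e = (K <#>\<^bsub>free_group A\<^esub> H.coset y, a)" "y @ (a, True) # z \<in> H"
        by (auto simp: met_edges_def)
      then show "e \<in> met_edges A H K" unfolding met_edges_def using proj carr by blast
    next
      fix e assume "e \<in> met_edges A H K"
      then obtain y a z where y: "e = (coset y, a)" "y @ (a, True) # z \<in> H"
        by (auto simp: met_edges_def)
      then have "e = ?g (H.coset y, a)" using proj carr by simp
      moreover have "(H.coset y, a) \<in> met_edges A H H" using y unfolding met_edges_def by blast
      ultimately show "e \<in> ?g ` met_edges A H H" by (rule image_eqI)
    qed
    also have "\<dots> = met_edges A K K" using E H(2) unfolding met_edges_def by blast
    finally show ?thesis .
  qed
  have mor: "lgraph_morphism (core_graph A H) (core_graph A K) ?f ?g"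
  proof -
    have "?f H = K" using proj[of "[]"] F.one_closed by simp
    moreover have "?f (c #>\<^bsub>free_group A\<^esub> [(a, True)]) = ?f c #>\<^bsub>free_group A\<^esub> [(a, True)]"
      if ca: "(c, a) \<in> met_edges A H H" for c a
    proof -
      obtain y z where y: "c = H.coset y" "y @ (a, True) # z \<in> H" using ca by (auto simp: met_edges_def)
      then show ?thesis
        using H.split_in_K[OF y(2)] proj singleton_in_carrier[of "(a, True)"]
        by (simp add: H.coset_mult coset_mult)
    qed
    ultimately show ?thesis using fV gE by (auto simp: lgraph_morphism_def)
  qed
  have finK: "finite (met_vertices A K K)" using fV fin by (metis finite_imageI)
  then have "finite (met_edges A K K)"
    using finite_subset[OF met_edges_subset] A by blast
  then have fg: "fin_gen_subgroup K (free_group A)" by (rule fin_gen_subgroup_if_finite)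
  let ?\<Gamma> = "subgroup_graph A H" and ?\<Delta> = "subgroup_graph A K"
  obtain f1 g1 where iso1: "lgraph_iso ?\<Gamma> (core_graph A H) f1 g1"
    using H.lgraph_iso_core_graph[OF H.subgroup_graph[OF A fin]] by blast
  obtain f2 g2 where iso2: "lgraph_iso ?\<Delta> (core_graph A K) f2 g2"
    using lgraph_iso_core_graph[OF subgroup_graph[OF A finK]] by blast
  obtain f3 g3 where iso3: "lgraph_iso (core_graph A K) ?\<Delta> f3 g3"
    using lgraph_iso_sym[OF iso2] subgroup_graph(1)[OF A finK]
    by (auto simp: reduced_graph_def labeled_graph_def)
  have "lgraph_morphism ?\<Gamma> ?\<Delta> (f3 \<circ> (?f \<circ> f1)) (g3 \<circ> (?g \<circ> g1))"
    using iso1 iso3 mor unfolding lgraph_iso_def by (blast intro: lgraph_morphism_comp)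
  moreover have "(f3 \<circ> (?f \<circ> f1)) ` verts\<^sub>L ?\<Gamma> = verts\<^sub>L ?\<Delta>"
    "(g3 \<circ> (?g \<circ> g1)) ` arcs\<^sub>L ?\<Gamma> = arcs\<^sub>L ?\<Delta>"
    using iso1 iso3 fV gE unfolding lgraph_iso_def bij_betw_def by (simp_all only: image_comp[symmetric]) simp_all
  ultimately show ?thesis using fg unfolding overgroups_def by blast
qed

end

section \<open>Extensions by groups of prime exponent\<close>

lemma (in group) order_prime_power:
  assumes p: "prime p" and fin: "finite (carrier G)"
    and pow: "\<And>x. x \<in> carrier G \<Longrightarrow> \<exists>k. x [^] (p ^ k) = \<one>"
  shows "\<exists>n. order G = p ^ n"
proof -
  have q: "q = p" if q: "prime q" "q dvd order G" for q
  proof (rule ccontr)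
    assume "q \<noteq> p"
    have pos: "order G \<noteq> 0" using fin by (simp add: order_gt_0_iff_finite)
    define a where "a = multiplicity q (order G)"
    obtain m where am: "order G = q ^ a * m" "\<not> q dvd m"
      unfolding a_def
      by (rule multiplicity_decompose'[OF pos prime_elem_not_unit[OF prime_imp_prime_elem[OF q(1)]]])
    have "a > 0" using am q(2) by (cases a) auto
    obtain P where P: "subgroup P G" "card P = q ^ a"
      using sylow_thm[OF q(1) is_group am(1) fin] by blast
    have "card P > 1" using P(2) one_less_power[OF prime_gt_1_nat[OF q(1)] \<open>a > 0\<close>] by simp
    then have "\<not> P \<subseteq> {\<one>}" using card_mono[of "{\<one>}" P] by auto
    then obtain x where x: "x \<in> P" "x \<noteq> \<one>" by blast
    have xG: "x \<in> carrier G" by (rule subgroup.mem_carrier[OF P(1) x(1)])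
    have "x [^]\<^bsub>G\<lparr>carrier := P\<rparr>\<^esub> order (G\<lparr>carrier := P\<rparr>) = \<one>\<^bsub>G\<lparr>carrier := P\<rparr>\<^esub>"
      by (rule group.pow_order_eq_1[OF subgroup_imp_group[OF P(1)]]) (use x(1) in simp)
    then have "x [^] (q ^ a) = \<one>"
      unfolding nat_pow_consistent[of x "q ^ a" P] order_def using P(2) by simp
    then have "ord x dvd q ^ a" using xG by (simp add: pow_eq_id)
    moreover obtain k where "x [^] (p ^ k) = \<one>" using pow xG by blast
    then have "ord x dvd p ^ k" using xG by (simp add: pow_eq_id)
    moreover have "coprime (q ^ a) (p ^ k)" using primes_coprime[OF q(1) p \<open>q \<noteq> p\<close>] by simp
    ultimately have "ord x = 1" using coprime_common_divisor[of "q ^ a" "p ^ k" "ord x"] by simp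
    then show False using x pow_ord_eq_1[OF xG] xG by simp
  qed
  have "order G \<noteq> 0" using fin by (simp add: order_gt_0_iff_finite)
  then obtain m where nm: "order G = p ^ multiplicity p (order G) * m" "\<not> p dvd m"
    by (rule multiplicity_decompose'[OF _ prime_elem_not_unit[OF prime_imp_prime_elem[OF p]]])
  have "m = 1"
  proof (rule ccontr)
    assume "m \<noteq> 1"
    then obtain r where "prime r" "r dvd m" using prime_factor_nat by blast
    then show False using q[of r] nm by (metis dvd_mult)
  qed
  then show ?thesis using nm by (metis mult.right_neutral)
qed

text \<open>If \<open>Q\<close> is an extension of a \<open>p\<close>-group by an abelian group of exponent dividing \<open>p - 1\<close>, and \<open>G\<close> maps to
  \<open>Q\<close> with a kernel of exponent \<open>p\<close>, then the preimage of the \<open>p\<close>-group is a \<open>p\<close>-group.\<close>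

lemma var_H_extension:
  fixes G :: "'g monoid" and Q :: "'h monoid"
  assumes p: "prime p" and G: "group G" "finite (carrier G)" and f: "f \<in> hom G Q" and Q: "var_H p Q"
    and ker: "\<And>x. x \<in> carrier G \<Longrightarrow> f x = \<one>\<^bsub>Q\<^esub> \<Longrightarrow> x [^]\<^bsub>G\<^esub> p = \<one>\<^bsub>G\<^esub>"
  shows "var_H p G"
proof -
  interpret G: group G by fact
  obtain M where M: "M \<lhd> Q" "var_Gp p (Q\<lparr>carrier := M\<rparr>)" "var_Ab (p - 1) (Q Mod M)"
    using Q by (auto simp: var_H_def var_prod_def)
  interpret M: normal M Q by fact
  interpret f: group_hom G Q f using f by unfold_locales
  define N where "N = {x \<in> carrier G. f x \<in> M}"
  have N: "N \<lhd> G"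
    unfolding G.normal_inv_iff
  proof safe
    show "subgroup N G" by (rule G.subgroupI) (auto simp: N_def intro: exI[of _ "\<one>\<^bsub>G\<^esub>"])
    show "x \<otimes>\<^bsub>G\<^esub> h \<otimes>\<^bsub>G\<^esub> inv\<^bsub>G\<^esub> x \<in> N" if "x \<in> carrier G" "h \<in> N" for x h
      using that M.inv_op_closed2 by (auto simp: N_def)
  qed
  interpret GN: group "G\<lparr>carrier := N\<rparr>"
    by (rule G.subgroup_imp_group) (rule normal_imp_subgroup[OF N])
  interpret QM: group "Q\<lparr>carrier := M\<rparr>"
    using M(2) by (simp add: var_Gp_def)
  obtain n where n: "order (Q\<lparr>carrier := M\<rparr>) = p ^ n" using M(2) by (auto simp: var_Gp_def)
  have "\<exists>k. x [^]\<^bsub>G\<lparr>carrier := N\<rparr>\<^esub> (p ^ k) = \<one>\<^bsub>G\<lparr>carrier := N\<rparr>\<^esub>" if "x \<in> carrier (G\<lparr>carrier := N\<rparr>)" for x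
  proof -
    have x: "x \<in> carrier G" "f x \<in> M" using that by (auto simp: N_def)
    have "f x [^]\<^bsub>Q\<lparr>carrier := M\<rparr>\<^esub> order (Q\<lparr>carrier := M\<rparr>) = \<one>\<^bsub>Q\<lparr>carrier := M\<rparr>\<^esub>"
      by (rule QM.pow_order_eq_1) (use x in simp)
    then have "f x [^]\<^bsub>Q\<^esub> (p ^ n) = \<one>\<^bsub>Q\<^esub>"
      unfolding n M.nat_pow_consistent[of "f x" "p ^ n" M] by simp
    then have "f (x [^]\<^bsub>G\<^esub> (p ^ n)) = \<one>\<^bsub>Q\<^esub>" using x f.hom_nat_pow by simp
    then have "(x [^]\<^bsub>G\<^esub> (p ^ n)) [^]\<^bsub>G\<^esub> p = \<one>\<^bsub>G\<^esub>" using ker x by simp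
    then have "x [^]\<^bsub>G\<^esub> (p ^ Suc n) = \<one>\<^bsub>G\<^esub>" using x by (simp add: G.nat_pow_pow mult.commute)
    then show ?thesis
      unfolding G.nat_pow_consistent[of x "p ^ Suc n" N] by (intro exI[of _ "Suc n"]) simp
  qed
  moreover have "finite (carrier (G\<lparr>carrier := N\<rparr>))" using G(2) by (simp add: N_def)
  ultimately have "var_Gp p (G\<lparr>carrier := N\<rparr>)"
    using GN.order_prime_power[OF p] GN.is_group by (auto simp: var_Gp_def)
  moreover have "var_Ab (p - 1) (G Mod N)"
    unfolding FactGroup_var_Ab_iff[OF N]
    using M(3) G(2) unfolding FactGroup_var_Ab_iff[OF M(1)]
    by (auto simp: FactGroup_def RCOSETS_def N_def f.hom_nat_pow)
  ultimately show ?thesis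
    using G N unfolding var_H_def var_prod_def by blast
qed

text \<open>Let \<open>c\<close> be a crossed homomorphism from \<open>F\<close> into the integer-valued functions of \<open>g \<in> F\<close>, with values
  that are invariant under translation of \<open>g\<close> by \<open>N\<close>.  Restricted to \<open>N\<close> it is a homomorphism; reducing it modulo \<open>p\<close>, its kernel is
  again normal in \<open>F\<close>, and \<open>N\<close> modulo this kernel is an elementary abelian \<open>p\<close>-group.\<close>

lemma var_H_crossed_hom_kernel:
  fixes F :: "'g monoid" and c :: "'g \<Rightarrow> 'g \<Rightarrow> int"
  assumes p: "prime p" and N: "N \<lhd> F" "var_H p (F Mod N)"
    and c: "\<And>g x y. \<lbrakk>g \<in> carrier F; x \<in> carrier F; y \<in> carrier F\<rbrakk> \<Longrightarrow>
      c g (x \<otimes>\<^bsub>F\<^esub> y) = c g x + c (g \<otimes>\<^bsub>F\<^esub> x) y"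
    and inv: "\<And>n g x. \<lbrakk>n \<in> N; g \<in> carrier F; x \<in> carrier F\<rbrakk> \<Longrightarrow> c (n \<otimes>\<^bsub>F\<^esub> g) x = c g x"
    and N'_def: "N' = {n \<in> N. \<forall>g\<in>carrier F. int p dvd c g n}"
  shows "N' \<lhd> F \<and> var_H p (F Mod N')"
proof -
  interpret N: normal N F by fact
  note NF = N.mem_carrier
  have c1: "c g \<one>\<^bsub>F\<^esub> = 0" if "g \<in> carrier F" for g
    using c[OF that N.one_closed N.one_closed] that by simp
  have c_inv: "c (g \<otimes>\<^bsub>F\<^esub> x) (inv\<^bsub>F\<^esub> x) = - c g x" if "g \<in> carrier F" "x \<in> carrier F" for g x
    using c[of g x "inv\<^bsub>F\<^esub> x"] c1 that by simp
  have right: "c (g \<otimes>\<^bsub>F\<^esub> n) x = c g x" if "n \<in> N" "g \<in> carrier F" "x \<in> carrier F" for n g x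
  proof -
    have "g \<otimes>\<^bsub>F\<^esub> n \<otimes>\<^bsub>F\<^esub> inv\<^bsub>F\<^esub> g \<in> N" using that N.inv_op_closed2 by blast
    from inv[OF this that(2,3)] show ?thesis using that NF by (simp add: N.m_assoc)
  qed
  have N': "N' \<lhd> F"
    unfolding N.normal_inv_iff
  proof safe
    show "subgroup N' F"
    proof (rule N.subgroupI)
      show "N' \<subseteq> carrier F" using NF by (auto simp: N'_def)
      have "\<one>\<^bsub>F\<^esub> \<in> N'"
        using subgroup.one_closed[OF N.is_subgroup] by (simp add: N'_def c1)
      then show "N' \<noteq> {}" by blast
    next
      fix n assume n: "n \<in> N'"
      then have nN: "n \<in> N" by (simp add: N'_def)
      have "c g (inv\<^bsub>F\<^esub> n) = - c g n" if "g \<in> carrier F" for g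
        using c_inv[OF that NF[OF nN]] right[OF nN that, of "inv\<^bsub>F\<^esub> n"] nN NF by simp
      then show "inv\<^bsub>F\<^esub> n \<in> N'" using n by (auto simp: N'_def)
    next
      fix m n assume mn: "m \<in> N'" "n \<in> N'"
      then have mnN: "m \<in> N" "n \<in> N" by (auto simp: N'_def)
      have "c g (m \<otimes>\<^bsub>F\<^esub> n) = c g m + c g n" if "g \<in> carrier F" for g
        using c[of g m n] right[of m g n] mnN NF that by simp
      then show "m \<otimes>\<^bsub>F\<^esub> n \<in> N'" using mn by (auto simp: N'_def)
    qed
  next
    fix x n assume x: "x \<in> carrier F" and n: "n \<in> N'"
    then have nN: "n \<in> N" and nF: "n \<in> carrier F" using NF by (auto simp: N'_def)
    have ix: "inv\<^bsub>F\<^esub> x \<in> carrier F" and xn: "x \<otimes>\<^bsub>F\<^esub> n \<in> carrier F" using x nF by auto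
    have conj: "c g (x \<otimes>\<^bsub>F\<^esub> n \<otimes>\<^bsub>F\<^esub> inv\<^bsub>F\<^esub> x) = c (g \<otimes>\<^bsub>F\<^esub> x) n" if g: "g \<in> carrier F" for g
    proof -
      have gx: "g \<otimes>\<^bsub>F\<^esub> x \<in> carrier F" using g x by simp
      have "c (g \<otimes>\<^bsub>F\<^esub> (x \<otimes>\<^bsub>F\<^esub> n)) (inv\<^bsub>F\<^esub> x) = - c g x"
        unfolding N.m_assoc[OF g x nF, symmetric] right[OF nN gx ix] by (rule c_inv[OF g x])
      then show ?thesis unfolding c[OF g xn ix] c[OF g x nF] by linarith
    qed
    have "int p dvd c g (x \<otimes>\<^bsub>F\<^esub> n \<otimes>\<^bsub>F\<^esub> inv\<^bsub>F\<^esub> x)" if "g \<in> carrier F" for g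
      unfolding conj[OF that] using n that x by (simp add: N'_def)
    then show "x \<otimes>\<^bsub>F\<^esub> n \<otimes>\<^bsub>F\<^esub> inv\<^bsub>F\<^esub> x \<in> N'"
      using N.inv_op_closed2[OF x nN] by (simp add: N'_def)
  qed
  interpret N': normal N' F by fact
  interpret Q: group "F Mod N'" by (rule N'.factorgroup_is_group)
  have coset_eq: "L #>\<^bsub>F\<^esub> x = L #>\<^bsub>F\<^esub> y \<longleftrightarrow> x \<otimes>\<^bsub>F\<^esub> inv\<^bsub>F\<^esub> y \<in> L"
    if "subgroup L F" "x \<in> carrier F" "y \<in> carrier F" for x y L
    using that by (metis subgroup.rcos_module N.rcos_self N.repr_independence N.is_group)
  have well: "N #>\<^bsub>F\<^esub> x = N #>\<^bsub>F\<^esub> y"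
    if "x \<in> carrier F" "y \<in> carrier F" "N' #>\<^bsub>F\<^esub> x = N' #>\<^bsub>F\<^esub> y" for x y
  proof -
    have "x \<otimes>\<^bsub>F\<^esub> inv\<^bsub>F\<^esub> y \<in> N'"
      using coset_eq[OF N'.is_subgroup that(1,2)] that(3) by blast
    moreover have "N' \<subseteq> N" unfolding N'_def by blast
    ultimately show ?thesis using coset_eq[OF N.is_subgroup that(1,2)] by blast
  qed
  obtain f where f: "f \<in> hom (F Mod N') (F Mod N)"
    "\<And>x. x \<in> carrier F \<Longrightarrow> f (N' #>\<^bsub>F\<^esub> x) = N #>\<^bsub>F\<^esub> x"
  proof (rule FactGroup_universal[OF N.r_coset_hom_Mod N' well])
    fix h assume "h \<in> hom (F Mod N') (F Mod N)"
      "\<And>x. x \<in> carrier F \<Longrightarrow> h (N' #>\<^bsub>F\<^esub> x) = N #>\<^bsub>F\<^esub> x"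
    then show thesis by (rule that)
  qed
  have car: "carrier (F Mod L) = (\<lambda>x. L #>\<^bsub>F\<^esub> x) ` carrier F" for L
    by (auto simp: FactGroup_def RCOSETS_def)
  have fin: "finite (carrier (F Mod N'))"
  proof -
    \<comment> \<open>A coset of \<open>N'\<close> is determined by the coset of \<open>N\<close> that contains it and the residues of \<open>c\<close>.\<close>
    define \<Phi> where "\<Phi> x = (N #>\<^bsub>F\<^esub> x,
        restrict (\<lambda>C. c (SOME g. g \<in> carrier F \<and> C = N #>\<^bsub>F\<^esub> g) x mod int p) (carrier (F Mod N)))" for x
    have finN: "finite (carrier (F Mod N))"
      using N(2) by (auto simp: var_H_def var_prod_def)
    have \<Phi>: "N' #>\<^bsub>F\<^esub> x = N' #>\<^bsub>F\<^esub> y" if x: "x \<in> carrier F" "y \<in> carrier F" "\<Phi> x = \<Phi> y" for x y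
    proof -
      let ?n = "x \<otimes>\<^bsub>F\<^esub> inv\<^bsub>F\<^esub> y"
      have n: "?n \<in> N"
        using x coset_eq[OF N.is_subgroup] by (auto simp: \<Phi>_def)
      have "int p dvd c g ?n" if g: "g \<in> carrier F" for g
      proof -
        let ?C = "N #>\<^bsub>F\<^esub> g"
        define h where "h = (SOME h. h \<in> carrier F \<and> ?C = N #>\<^bsub>F\<^esub> h)"
        have h: "h \<in> carrier F" "?C = N #>\<^bsub>F\<^esub> h"
          using someI_ex[of "\<lambda>h. h \<in> carrier F \<and> ?C = N #>\<^bsub>F\<^esub> h"] g unfolding h_def by blast+
        have "snd (\<Phi> x) ?C = snd (\<Phi> y) ?C" using x(3) by simp
        then have "c h x mod int p = c h y mod int p"
          using g unfolding \<Phi>_def h_def by (simp add: car)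
        moreover have "c g z = c h z" if "z \<in> carrier F" for z
        proof -
          have "g \<otimes>\<^bsub>F\<^esub> inv\<^bsub>F\<^esub> h \<in> N" using h g coset_eq[OF N.is_subgroup] by blast
          from inv[OF this h(1) that] show ?thesis using g h by (simp add: N.m_assoc)
        qed
        ultimately have *: "c g x mod int p = c g y mod int p" using x by simp
        have "c g x = c g (?n \<otimes>\<^bsub>F\<^esub> y)" using x by (simp add: N.m_assoc)
        also have "\<dots> = c g ?n + c g y"
          unfolding c[OF g NF[OF n] x(2)] right[OF n g x(2)] ..
        finally have "c g ?n = c g x - c g y" by linarith
        then show ?thesis using * by (metis mod_eq_dvd_iff)
      qed
      then have "?n \<in> N'" unfolding N'_def using n by blast
      then show ?thesis using x coset_eq[OF N'.is_subgroup] by blast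
    qed
    have "\<Phi> ` carrier F \<subseteq> carrier (F Mod N) \<times> (carrier (F Mod N) \<rightarrow>\<^sub>E {0..<int p})"
      using p by (auto simp: \<Phi>_def car prime_gt_0_nat)
    moreover have "finite (carrier (F Mod N) \<times> (carrier (F Mod N) \<rightarrow>\<^sub>E {0..<int p}))"
      using finN by (intro finite_cartesian_product finite_PiE) auto
    ultimately have "finite (\<Phi> ` carrier F)" by (rule finite_subset)
    moreover have "carrier (F Mod N') \<subseteq> (\<lambda>y. N' #>\<^bsub>F\<^esub> inv_into (carrier F) \<Phi> y) ` \<Phi> ` carrier F"
    proof
      fix X assume "X \<in> carrier (F Mod N')"
      then obtain x where x: "x \<in> carrier F" "X = N' #>\<^bsub>F\<^esub> x" by (auto simp: car)
      then have "X = N' #>\<^bsub>F\<^esub> inv_into (carrier F) \<Phi> (\<Phi> x)"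
        using \<Phi>[of x "inv_into (carrier F) \<Phi> (\<Phi> x)"] inv_into_into[of "\<Phi> x" \<Phi> "carrier F"]
          f_inv_into_f[of "\<Phi> x" \<Phi> "carrier F"] by auto
      then show "X \<in> (\<lambda>y. N' #>\<^bsub>F\<^esub> inv_into (carrier F) \<Phi> y) ` \<Phi> ` carrier F" using x by blast
    qed
    ultimately show ?thesis by (meson finite_imageI finite_subset)
  qed
  have "X [^]\<^bsub>F Mod N'\<^esub> p = \<one>\<^bsub>F Mod N'\<^esub>"
    if X: "X \<in> carrier (F Mod N')" "f X = \<one>\<^bsub>F Mod N\<^esub>" for X
  proof -
    obtain n where n: "n \<in> carrier F" "X = N' #>\<^bsub>F\<^esub> n" using X by (auto simp: car)
    then have "N #>\<^bsub>F\<^esub> n = N" using X f by (simp add: FactGroup_def)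
    then have nN: "n \<in> N" using N.rcos_self[OF n(1) N.is_subgroup] by simp
    have pow: "c g (n [^]\<^bsub>F\<^esub> k) = int k * c g n" if g: "g \<in> carrier F" for g and k :: nat
    proof (induction k)
      case (Suc k)
      have "c g (n [^]\<^bsub>F\<^esub> k \<otimes>\<^bsub>F\<^esub> n) = c g (n [^]\<^bsub>F\<^esub> k) + c g n"
        using c[of g "n [^]\<^bsub>F\<^esub> k" n] right[OF _ g, of "n [^]\<^bsub>F\<^esub> k" n] n nN g
          N.subgroup_int_pow_closed[OF N.is_subgroup nN, of "int k"] by (simp add: int_pow_int)
      then show ?case using Suc by (simp add: algebra_simps)
    qed (use c1 g in simp)
    have "n [^]\<^bsub>F\<^esub> p \<in> N"
      using N.subgroup_int_pow_closed[OF N.is_subgroup nN, of "int p"] by (simp add: int_pow_int)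
    moreover have "int p dvd c g (n [^]\<^bsub>F\<^esub> p)" if "g \<in> carrier F" for g
      unfolding pow[OF that] by simp
    ultimately have "n [^]\<^bsub>F\<^esub> p \<in> N'" unfolding N'_def by blast
    then have "N' #>\<^bsub>F\<^esub> (n [^]\<^bsub>F\<^esub> p) = N'" by (intro N'.rcos_const N.is_group)
    then show ?thesis
      using n N'.FactGroup_pow[OF n(1), of p] by (simp add: FactGroup_def)
  qed
  then have "var_H p (F Mod N')"
    by (intro var_H_extension[OF p Q.is_group fin f(1) N(2)])
  then show ?thesis using N' by blast
qed

section \<open>Loops that cross an edge exactly once\<close>

text \<open>The number of forward crossings minus the number of backward crossings of the edge \<open>e\<close>.\<close>

definition exp_sum :: "'e \<Rightarrow> ('e \<times> bool) list \<Rightarrow> int" where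
  "exp_sum e \<pi> = (\<Sum>d\<leftarrow>\<pi>. if fst d = e then if snd d then 1 else - 1 else 0)"

lemma exp_sum_simps [simp]:
  "exp_sum e [] = 0"
  "exp_sum e (d # \<pi>) = (if fst d = e then if snd d then 1 else - 1 else 0) + exp_sum e \<pi>"
  "exp_sum e (\<pi> @ \<rho>) = exp_sum e \<pi> + exp_sum e \<rho>"
  by (simp_all add: exp_sum_def)

lemma exp_sum_winv [simp]: "exp_sum e (winv \<pi>) = - exp_sum e \<pi>"
  by (induction \<pi>) (auto simp: winv_Cons inv_letter_def)

lemma exp_sum_eq_0: "e \<notin> fst ` set \<pi> \<Longrightarrow> exp_sum e \<pi> = 0"
  by (induction \<pi>) auto

lemma abs_exp_sum_eq_1:
  assumes "distinct (filter (\<lambda>e. e \<in> B) (map fst \<pi>))" "e \<in> B" "e \<in> fst ` set \<pi>"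
  shows "\<bar>exp_sum e \<pi>\<bar> = 1"
proof -
  from assms(3) obtain d where d: "d \<in> set \<pi>" "e = fst d" by auto
  then obtain \<pi>1 \<pi>2 where "\<pi> = \<pi>1 @ d # \<pi>2" by (meson split_list)
  then have "e \<notin> fst ` set \<pi>1" "e \<notin> fst ` set \<pi>2" using assms d by auto
  then show ?thesis using \<open>\<pi> = \<pi>1 @ d # \<pi>2\<close> d by (simp add: exp_sum_eq_0)
qed

text \<open>Let \<open>B\<close> be a set of edges such that each end of each edge outside \<open>B\<close> can be joined to \<open>b\<close> outside \<open>B\<close>.
  If no edge of \<open>B\<close> is crossed twice, the given loop will do.  Otherwise consider the first moment at which an
  edge \<open>e\<close> of \<open>B\<close> is crossed again.  If it is crossed in the same direction, the segment in between,
  together with one crossing of \<open>e\<close>, is a loop.  If it is crossed in the opposite direction, the segment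
  in between is a nonempty loop; either it crosses some edge of \<open>B\<close>, and then exactly once, or it
  shows that the end of \<open>e\<close> can be joined to \<open>b\<close> outside \<open>B\<close>.\<close>

lemma ex_loop_exp_sum_1:
  assumes wf: "wf_digraph (dgr \<Gamma>)" and loop: "lpath \<Gamma> b \<pi> b" "reduced_word \<pi>"
    and bad: "\<exists>d\<in>set \<pi>. fst d \<in> B"
    and good: "\<And>d. fst d \<in> arcs\<^sub>L \<Gamma> - B \<Longrightarrow> \<exists>\<rho>. lpath \<Gamma> b \<rho> (src \<Gamma> d) \<and> fst ` set \<rho> \<inter> B = {}"
  shows "\<exists>\<sigma> e. lpath \<Gamma> b \<sigma> b \<and> e \<in> B \<and> \<bar>exp_sum e \<sigma>\<bar> = 1"
proof -
  let ?D = "\<lambda>w. distinct (filter (\<lambda>e. e \<in> B) (map fst w))"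
  note app = lpath_append[OF wf]
  show ?thesis
  proof (cases "?D \<pi>")
    case True
    then show ?thesis using loop bad abs_exp_sum_eq_1[OF True] by blast
  next
    case False
    define n where "n = (LEAST n. \<not> ?D (take n \<pi>))"
    have n: "\<not> ?D (take n \<pi>)"
      unfolding n_def by (rule LeastI[of "\<lambda>n. \<not> ?D (take n \<pi>)" "length \<pi>"]) (use False in simp)
    then obtain m where m: "n = Suc m" by (cases n) auto
    have dm: "?D (take m \<pi>)"
      using not_less_Least[of m "\<lambda>n. \<not> ?D (take n \<pi>)"] m n_def by auto
    have "m < length \<pi>" using n dm m by (cases "m < length \<pi>") auto
    then have tk: "take n \<pi> = take m \<pi> @ [\<pi> ! m]" using m by (simp add: take_Suc_conv_app_nth)
    define d' where "d' = \<pi> ! m"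
    have d': "fst d' \<in> B" "fst d' \<in> fst ` set (take m \<pi>)"
      using n dm unfolding tk d'_def[symmetric] by (auto split: if_splits)
    then obtain d where d: "d \<in> set (take m \<pi>)" "fst d = fst d'" by auto
    then obtain \<pi>1 y where y: "take m \<pi> = \<pi>1 @ d # y" by (meson split_list)
    obtain \<pi>2 where pi: "\<pi> = \<pi>1 @ d # y @ d' # \<pi>2"
    proof -
      have "\<pi> = take n \<pi> @ drop n \<pi>" by simp
      also have "\<dots> = \<pi>1 @ d # y @ d' # drop n \<pi>" unfolding tk y d'_def by simp
      finally show thesis by (rule that)
    qed
    let ?e = "fst d"
    have dB: "?e \<in> B" using d d' by simp
    have e1: "?e \<notin> fst ` set \<pi>1" "?e \<notin> fst ` set y" and Dy: "?D y"
      using dm d' d unfolding y by auto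
    have "lpath \<Gamma> b (\<pi>1 @ d # y @ d' # \<pi>2) b" using loop(1) unfolding pi .
    then have p1: "lpath \<Gamma> b \<pi>1 (src \<Gamma> d)" and darc: "fst d \<in> arcs\<^sub>L \<Gamma>"
      and py: "lpath \<Gamma> (tgt \<Gamma> d) y (src \<Gamma> d')"
      by (auto simp: app)
    have p1d: "lpath \<Gamma> b (\<pi>1 @ [d]) (tgt \<Gamma> d)"
      using p1 darc tgt_in_verts[OF wf darc] by (auto simp: app)
    have "d' = d \<or> d' = inv_letter d"
      using d(2) by (auto simp: inv_letter_def prod_eq_iff)
    then show ?thesis
    proof
      assume "d' = d"
      then have "lpath \<Gamma> (src \<Gamma> d) (d # y) (src \<Gamma> d)" using py darc by simp
      then have "lpath \<Gamma> b (\<pi>1 @ (d # y) @ winv \<pi>1) b"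
        using p1 lpath_winv[OF wf p1] app by blast
      moreover have "\<bar>exp_sum ?e (\<pi>1 @ (d # y) @ winv \<pi>1)\<bar> = 1"
        using e1 by (simp add: exp_sum_eq_0)
      ultimately show ?thesis using dB by blast
    next
      assume inv: "d' = inv_letter d"
      have py': "lpath \<Gamma> (tgt \<Gamma> d) y (tgt \<Gamma> d)" using py inv by simp
      show ?thesis
      proof (cases "\<exists>d2\<in>set y. fst d2 \<in> B")
        case True
        then obtain d2 where d2: "d2 \<in> set y" "fst d2 \<in> B" by blast
        have "lpath \<Gamma> b ((\<pi>1 @ [d]) @ y @ winv (\<pi>1 @ [d])) b"
          using p1d py' lpath_winv[OF wf p1d] app by blast
        moreover have "\<bar>exp_sum (fst d2) ((\<pi>1 @ [d]) @ y @ winv (\<pi>1 @ [d]))\<bar> = 1"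
          using abs_exp_sum_eq_1[OF Dy d2(2)] d2(1) by simp
        ultimately show ?thesis using d2(2) by blast
      next
        case False
        have "y \<noteq> []"
          using loop(2) inv unfolding pi by (auto simp: reduced_word_append reduced_word_Cons)
        then obtain x y' where x: "y = x # y'" by (cases y) auto
        then have "fst x \<in> arcs\<^sub>L \<Gamma> - B" "src \<Gamma> x = tgt \<Gamma> d" using py' False by auto
        then obtain \<rho> where \<rho>: "lpath \<Gamma> b \<rho> (tgt \<Gamma> d)" "fst ` set \<rho> \<inter> B = {}"
          using good[of x] by auto
        have "lpath \<Gamma> b ((\<pi>1 @ [d]) @ winv \<rho>) b"
          using p1d lpath_winv[OF wf \<rho>(1)] app by blast
        moreover have "\<bar>exp_sum ?e ((\<pi>1 @ [d]) @ winv \<rho>)\<bar> = 1"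
        proof -
          have "?e \<notin> fst ` set \<rho>" using \<rho>(2) dB by blast
          then show ?thesis using e1(1) by (simp add: exp_sum_eq_0)
        qed
        ultimately show ?thesis using dB by blast
      qed
    qed
  qed
qed

section \<open>The closure of a subgroup\<close>

text \<open>The normal subgroups that are open in the topology considered here.\<close>

abbreviation (input) open_normal :: "nat \<Rightarrow> 'g monoid \<Rightarrow> 'g set \<Rightarrow> bool" where
  "open_normal p F N \<equiv> N \<lhd> F \<and> var_H p (F Mod N)"

lemma open_normal_carrier:
  assumes "group F"
  shows "open_normal p F (carrier F)"
proof -
  interpret F: group F by fact
  have sub: "subgroup (carrier F) F" by (rule F.subgroup_self)
  have N: "carrier F \<lhd> F" unfolding F.normal_inv_iff using sub by auto
  interpret N: normal "carrier F" F by (rule N)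
  interpret Q: group "F Mod carrier F" by (rule N.factorgroup_is_group)
  have carrier_Q: "carrier (F Mod carrier F) = {\<one>\<^bsub>F Mod carrier F\<^esub>}"
    using F.coset_join2[OF _ sub] F.one_closed by (auto simp: FactGroup_def RCOSETS_def)
  let ?E = "carrier (F Mod carrier F)"
  have E: "?E \<lhd> F Mod carrier F" unfolding carrier_Q by (rule Q.one_is_normal)
  have "var_Gp p ((F Mod carrier F)\<lparr>carrier := ?E\<rparr>)"
    unfolding var_Gp_def
  proof (intro conjI)
    show "group ((F Mod carrier F)\<lparr>carrier := ?E\<rparr>)"
      by (rule Q.subgroup_imp_group[OF Q.subgroup_self])
  qed (auto simp: order_def carrier_Q intro!: exI[of _ 0])
  moreover have "var_Ab (p - 1) ((F Mod carrier F) Mod ?E)"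
    unfolding FactGroup_var_Ab_iff[OF E]
  proof (intro conjI ballI)
    show "finite (carrier ((F Mod carrier F) Mod ?E))"
      using carrier_Q by (simp add: FactGroup_def RCOSETS_def)
  qed (intro Q.m_closed Q.inv_closed Q.nat_pow_closed; assumption)+
  ultimately have "var_H p (F Mod carrier F)"
    unfolding var_H_def var_prod_def using Q.is_group carrier_Q E by auto
  then show ?thesis using N by blast
qed

lemma mem_pro_closure_iff:
  assumes p: "prime p" and F: "group F" and x: "x \<in> carrier F"
  shows "x \<in> pro_closure (var_H p) F S \<longleftrightarrow> (\<forall>N. open_normal p F N \<longrightarrow> (\<exists>n\<in>N. n \<otimes>\<^bsub>F\<^esub> x \<in> S))"
proof -
  interpret F: group F by fact
  let ?X = "pro_topology (var_H p) F"
  have op: "openin ?X (N #>\<^bsub>F\<^esub> y)" if "open_normal p F N" "y \<in> carrier F" for N y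
    unfolding pro_topology_def
    by (rule topology_generated_by_Basis) (use that in \<open>auto simp: pro_cosets_def\<close>)
  have self: "y \<in> N #>\<^bsub>F\<^esub> y" if "open_normal p F N" "y \<in> carrier F" for N y
    using that F.rcos_self normal_imp_subgroup by blast
  have small: "\<exists>N. open_normal p F N \<and> N #>\<^bsub>F\<^esub> x \<subseteq> T" if T: "openin ?X T" "x \<in> T" for T
  proof -
    have "(arbitrary union_of (\<lambda>U. U \<in> pro_cosets (var_H p) F)) T"
      using T(1) unfolding openin_pro_topology_var_H[OF p F] .
    then obtain U where "U \<in> pro_cosets (var_H p) F" "x \<in> U" "U \<subseteq> T"
      using T(2) unfolding union_of_def by auto
    then obtain N y where N: "open_normal p F N" "y \<in> carrier F" "x \<in> N #>\<^bsub>F\<^esub> y" "N #>\<^bsub>F\<^esub> y \<subseteq> T"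
      unfolding pro_cosets_def by blast
    then have "N #>\<^bsub>F\<^esub> y = N #>\<^bsub>F\<^esub> x"
      by (intro F.repr_independence) (auto intro: normal_imp_subgroup)
    then show ?thesis using N by blast
  qed
  have coset_S: "(\<exists>y\<in>S. y \<in> N #>\<^bsub>F\<^esub> x) \<longleftrightarrow> (\<exists>n\<in>N. n \<otimes>\<^bsub>F\<^esub> x \<in> S)" for N
    by (auto simp: r_coset_def)
  have "x \<in> topspace ?X"
    using openin_subset[OF op[OF open_normal_carrier[OF F] x]] self[OF open_normal_carrier[OF F] x] by blast
  then have "x \<in> pro_closure (var_H p) F S \<longleftrightarrow> (\<forall>T. x \<in> T \<and> openin ?X T \<longrightarrow> (\<exists>y\<in>S. y \<in> T))"
    by (simp add: pro_closure_def in_closure_of Bex_def)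
  also have "\<dots> \<longleftrightarrow> (\<forall>N. open_normal p F N \<longrightarrow> (\<exists>y\<in>S. y \<in> N #>\<^bsub>F\<^esub> x))"
    using small op[OF _ x] self[OF _ x] by (meson subsetD)
  finally show ?thesis by (simp only: coset_S)
qed

lemma pro_closure_subset_carrier:
  assumes "prime p" "group F"
  shows "pro_closure (var_H p) F S \<subseteq> carrier F"
proof -
  interpret F: group F by fact
  have sub: "U \<subseteq> carrier F" if U: "U \<in> pro_cosets (var_H p) F" for U
  proof -
    obtain N y where "U = N #>\<^bsub>F\<^esub> y" "N \<lhd> F" "y \<in> carrier F" using U by (auto simp: pro_cosets_def)
    then show ?thesis
      using F.r_coset_subset_G[OF subgroup.subset[OF normal_imp_subgroup]] by blast
  qed
  have "topspace (pro_topology (var_H p) F) \<subseteq> carrier F"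
    unfolding pro_topology_def topology_generated_by_topspace using sub by blast
  then show ?thesis
    unfolding pro_closure_def by (rule order_trans[OF closure_of_subset_topspace])
qed

lemma subset_pro_closure:
  assumes "prime p" "group F" "S \<subseteq> carrier F"
  shows "S \<subseteq> pro_closure (var_H p) F S"
proof
  fix x assume x: "x \<in> S"
  interpret F: group F by fact
  have "\<one>\<^bsub>F\<^esub> \<in> N \<and> \<one>\<^bsub>F\<^esub> \<otimes>\<^bsub>F\<^esub> x \<in> S" if "open_normal p F N" for N
    using that x assms(3) subgroup.one_closed[OF normal_imp_subgroup] by auto
  then show "x \<in> pro_closure (var_H p) F S"
    using mem_pro_closure_iff[OF assms(1,2)] x assms(3) by blast
qed

lemma subgroup_pro_closure:
  assumes p: "prime p" and F: "group F" and H: "subgroup H F"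
  shows "subgroup (pro_closure (var_H p) F H) F"
proof -
  interpret F: group F by fact
  let ?K = "pro_closure (var_H p) F H"
  note HF = subgroup.mem_carrier[OF H]
  note KF = subsetD[OF pro_closure_subset_carrier[OF p F, of H]]
  note iff = mem_pro_closure_iff[OF p F, of _ H]
  show ?thesis
  proof (rule F.subgroupI)
    show "?K \<noteq> {}"
      using subset_pro_closure[OF p F subgroup.subset[OF H]] subgroup.one_closed[OF H] by blast
  next
    fix x assume x: "x \<in> ?K"
    then have xF: "x \<in> carrier F" by (rule KF)
    have "\<exists>m\<in>N. m \<otimes>\<^bsub>F\<^esub> inv\<^bsub>F\<^esub> x \<in> H" if N: "open_normal p F N" for N
    proof -
      interpret N: normal N F using N by blast
      obtain n where n: "n \<in> N" "n \<otimes>\<^bsub>F\<^esub> x \<in> H" using x N iff[OF xF] by blast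
      have nF: "n \<in> carrier F" using n(1) by (rule N.mem_carrier)
      have "inv\<^bsub>F\<^esub> x \<otimes>\<^bsub>F\<^esub> inv\<^bsub>F\<^esub> n \<otimes>\<^bsub>F\<^esub> x \<in> N"
        using N.inv_op_closed1[OF xF N.m_inv_closed[OF n(1)]] .
      moreover have "inv\<^bsub>F\<^esub> x \<otimes>\<^bsub>F\<^esub> inv\<^bsub>F\<^esub> n \<otimes>\<^bsub>F\<^esub> x \<otimes>\<^bsub>F\<^esub> inv\<^bsub>F\<^esub> x = inv\<^bsub>F\<^esub> (n \<otimes>\<^bsub>F\<^esub> x)"
        using xF nF by (simp add: F.m_assoc F.inv_mult_group)
      ultimately show ?thesis using subgroup.m_inv_closed[OF H n(2)] by metis
    qed
    then show "inv\<^bsub>F\<^esub> x \<in> ?K" using iff[of "inv\<^bsub>F\<^esub> x"] xF by blast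
  next
    fix x y assume xy: "x \<in> ?K" "y \<in> ?K"
    then have xF: "x \<in> carrier F" and yF: "y \<in> carrier F" by (auto dest: KF)
    have "\<exists>k\<in>N. k \<otimes>\<^bsub>F\<^esub> (x \<otimes>\<^bsub>F\<^esub> y) \<in> H" if N: "open_normal p F N" for N
    proof -
      interpret N: normal N F using N by blast
      obtain n where n: "n \<in> N" "n \<otimes>\<^bsub>F\<^esub> x \<in> H" using xy N iff[OF xF] by blast
      obtain m where m: "m \<in> N" "m \<otimes>\<^bsub>F\<^esub> y \<in> H" using xy N iff[OF yF] by blast
      have nF: "n \<in> carrier F" and mF: "m \<in> carrier F" using n m N.mem_carrier by auto
      have "n \<otimes>\<^bsub>F\<^esub> (x \<otimes>\<^bsub>F\<^esub> m \<otimes>\<^bsub>F\<^esub> inv\<^bsub>F\<^esub> x) \<in> N"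
        using n m N.inv_op_closed2[OF xF m(1)] by (simp add: N.m_closed)
      moreover have "n \<otimes>\<^bsub>F\<^esub> (x \<otimes>\<^bsub>F\<^esub> m \<otimes>\<^bsub>F\<^esub> inv\<^bsub>F\<^esub> x) \<otimes>\<^bsub>F\<^esub> (x \<otimes>\<^bsub>F\<^esub> y) = n \<otimes>\<^bsub>F\<^esub> x \<otimes>\<^bsub>F\<^esub> (m \<otimes>\<^bsub>F\<^esub> y)"
      proof -
        have "inv\<^bsub>F\<^esub> x \<otimes>\<^bsub>F\<^esub> (x \<otimes>\<^bsub>F\<^esub> y) = y"
          using xF yF by (simp add: F.m_assoc[symmetric])
        then show ?thesis using xF yF nF mF by (simp add: F.m_assoc)
      qed
      ultimately show ?thesis using subgroup.m_closed[OF H n(2) m(2)] by metis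
    qed
    then show "x \<otimes>\<^bsub>F\<^esub> y \<in> ?K" using iff[of "x \<otimes>\<^bsub>F\<^esub> y"] xF yF by blast
  qed (rule pro_closure_subset_carrier[OF p F])
qed

text \<open>Finitely many elements outside the closure are separated from the set by one open normal
  subgroup.\<close>

lemma separate_finite:
  assumes p: "prime p" and F: "group F" and "finite Z" "Z \<subseteq> carrier F" "Z \<inter> pro_closure (var_H p) F S = {}"
  shows "\<exists>N. open_normal p F N \<and> (\<forall>z\<in>Z. \<forall>n\<in>N. n \<otimes>\<^bsub>F\<^esub> z \<notin> S)"
  using assms(3-)
proof (induction Z)
  case empty
  then show ?case using open_normal_carrier[OF F] by blast
next
  case (insert z Z)
  then obtain N where N: "open_normal p F N" "\<forall>z\<in>Z. \<forall>n\<in>N. n \<otimes>\<^bsub>F\<^esub> z \<notin> S" by auto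
  have "z \<in> carrier F" "z \<notin> pro_closure (var_H p) F S" using insert.prems by auto
  then obtain M where M: "open_normal p F M" "\<forall>n\<in>M. n \<otimes>\<^bsub>F\<^esub> z \<notin> S"
    using mem_pro_closure_iff[OF p F] by blast
  have "open_normal p F (N \<inter> M)" using var_H_quotient_Int[OF p] N(1) M(1) by blast
  then show ?case using N(2) M(2) by (intro exI[of _ "N \<inter> M"]) blast
qed

section \<open>Exponent sums along words\<close>

text \<open>The signed number of times that the edge leaving \<open>S\<close> with label \<open>a\<close> is crossed when a word is read
  from \<open>g\<close>.  The set \<open>S\<close> of group elements stands for a vertex of a coset graph; the subgroup itself need
  not be known, which makes it possible to compare the counts for two subgroups.  The count depends
  only on the element of the free group that the word represents.\<close>

fun exp_along :: "'a word set \<Rightarrow> 'a \<Rightarrow> 'a word \<Rightarrow> 'a word \<Rightarrow> int" where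
  "exp_along S a g [] = 0"
| "exp_along S a g (l # w) =
     (if fst l = a \<and> (if snd l then g else reduce (g @ [l])) \<in> S then if snd l then 1 else - 1 else 0) +
     exp_along S a (reduce (g @ [l])) w"

lemma exp_along_append:
  "reduced_word g \<Longrightarrow> exp_along S a g (u @ v) = exp_along S a g u + exp_along S a (reduce (g @ u)) v"
  by (induction u arbitrary: g) (auto simp: reduce_reduced)

lemma exp_along_cancel:
  assumes "reduced_word g"
  shows "exp_along S a g (l # inv_letter l # w) = exp_along S a g w"
proof -
  have "reduce (g @ [l, inv_letter l]) = g"
    using reduce_cancel_middle(2)[of g "[l]" "[]"] assms by (simp add: winv_Cons reduce_reduced)
  then show ?thesis by (cases l; cases "snd l"; cases "fst l = a") auto
qed

lemma exp_along_reduce: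
  "reduced_word g \<Longrightarrow> exp_along S a g (reduce w) = exp_along S a g w"
proof (induction w arbitrary: g)
  case (Cons l w)
  have IH: "exp_along S a g (l # reduce w) = exp_along S a g (l # w)"
    using Cons.IH[of "reduce (g @ [l])"] by simp
  show ?case
  proof (cases "\<exists>w'. reduce w = inv_letter l # w'")
    case True
    then obtain w' where "reduce w = inv_letter l # w'" by blast
    then show ?thesis using IH exp_along_cancel[OF Cons.prems, of S a l w'] by (simp add: reduce_Cons)
  next
    case False
    then have "reduce (l # w) = l # reduce w" by (cases "reduce w") (auto simp: reduce_Cons)
    then show ?thesis using IH by simp
  qed
qed simp

lemma exp_along_cong:
  assumes "reduced_word g" "\<And>u v. w = u @ v \<Longrightarrow> reduce (g @ u) \<in> S \<longleftrightarrow> reduce (g @ u) \<in> S'"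
  shows "exp_along S a g w = exp_along S' a g w"
  using assms
proof (induction w arbitrary: g)
  case (Cons l w)
  have "g \<in> S \<longleftrightarrow> g \<in> S'" "reduce (g @ [l]) \<in> S \<longleftrightarrow> reduce (g @ [l]) \<in> S'"
    using Cons.prems(2)[of "[]" "l # w"] Cons.prems(2)[of "[l]" w] Cons.prems(1)
    by (simp_all add: reduce_reduced)
  moreover have "exp_along S a (reduce (g @ [l])) w = exp_along S' a (reduce (g @ [l])) w"
  proof (rule Cons.IH)
    show "reduce (reduce (g @ [l]) @ u) \<in> S \<longleftrightarrow> reduce (reduce (g @ [l]) @ u) \<in> S'" if "w = u @ v" for u v
      using Cons.prems(2)[of "l # u" v] that by simp
  qed simp
  ultimately show ?case by simp
qed simp

lemma exp_along_eq_0: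
  assumes "reduced_word g"
    "\<And>u l v. w = u @ l # v \<Longrightarrow> fst l = a \<Longrightarrow> reduce (g @ (if snd l then u else u @ [l])) \<notin> S"
  shows "exp_along S a g w = 0"
  using assms
proof (induction w arbitrary: g)
  case (Cons l w)
  have "\<not> (fst l = a \<and> (if snd l then g else reduce (g @ [l])) \<in> S)"
    using Cons.prems(2)[of "[]" l w] Cons.prems(1) by (auto simp: reduce_reduced split: if_splits)
  moreover have "exp_along S a (reduce (g @ [l])) w = 0"
  proof (rule Cons.IH)
    show "reduce (reduce (g @ [l]) @ (if snd m then u else u @ [m])) \<notin> S"
      if "w = u @ m # v" "fst m = a" for u m v
      using Cons.prems(2)[of "l # u" m v] that by (cases "snd m") simp_all
  qed simp
  ultimately show ?case by (simp only: exp_along.simps) simp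
qed simp

context free_group_subgroup
begin

lemma exp_along_left_invariant:
  assumes "\<And>h. h \<in> carrier (free_group A) \<Longrightarrow> reduce (n @ h) \<in> S \<longleftrightarrow> h \<in> S"
    "g \<in> carrier (free_group A)" "fst ` set w \<subseteq> A"
  shows "exp_along S a (reduce (n @ g)) w = exp_along S a g w"
  using assms(2,3)
proof (induction w arbitrary: g)
  case (Cons l w)
  then have gl: "reduce (g @ [l]) \<in> carrier (free_group A)"
    by (simp add: reduce_append_in_carrier singleton_in_carrier)
  have "reduce (reduce (n @ g) @ [l]) = reduce (n @ reduce (g @ [l]))" by simp
  then show ?case
    using Cons.IH[OF gl] Cons.prems assms(1)[OF gl] assms(1)[OF Cons.prems(1)] by simp
qed simp

lemma exp_sum_eq_exp_along:
  assumes E: "E \<subseteq> (rcosets\<^bsub>free_group A\<^esub> K) \<times> A" and x: "x \<in> carrier (free_group A)"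
    and g: "g \<in> carrier (free_group A)" and \<pi>: "lpath (coset_graph A K V E) (coset g) \<pi> v"
  shows "exp_sum (coset x, a) \<pi> = exp_along (coset x) a g (path_label (coset_graph A K V E) \<pi>)"
  using g \<pi>
proof (induction \<pi> arbitrary: g)
  case (Cons d \<pi>)
  let ?C = "coset_graph A K V E"
  let ?l = "letter ?C d"
  have l: "fst ?l \<in> A" using Cons.prems E by (auto simp: letter_def)
  have d: "d = crossed g ?l" using Cons.prems E by (intro eq_crossed) auto
  have gl: "reduce (g @ [?l]) \<in> carrier (free_group A)"
    using Cons.prems l by (simp add: reduce_append_in_carrier singleton_in_carrier)
  have eq: "coset y = coset x \<longleftrightarrow> y \<in> coset x" if "y \<in> carrier (free_group A)" for y
    using mem_coset_iff[OF x that] coset_eq_iff[OF that x] by simp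
  have "tgt ?C d = coset (reduce (g @ [?l]))"
    using crossed_simps(2)[OF Cons.prems(1) l] d by metis
  then have IH: "exp_sum (coset x, a) \<pi> = exp_along (coset x) a (reduce (g @ [?l])) (path_label ?C \<pi>)"
    using Cons.IH[OF gl] Cons.prems by simp
  have "snd d = snd ?l" by (simp add: letter_def)
  moreover have "fst d = (coset x, a) \<longleftrightarrow> fst ?l = a \<and> (if snd ?l then g else reduce (g @ [?l])) \<in> coset x"
    by (subst d) (use eq[OF Cons.prems(1)] eq[OF gl] in \<open>auto simp: crossed_def\<close>)
  ultimately show ?case using IH by simp
qed simp

end

section \<open>The closure is an overgroup\<close>

text \<open>A finitely generated subgroup \<open>H\<close> of the free group and its closure \<open>K\<close>.\<close>

locale closed_hull =
  fixes A :: "'a set" and H K :: "'a word set" and p :: nat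
  assumes p: "prime p" and A: "finite A" and H: "fin_gen_subgroup H (free_group A)"
    and K_def: "K = pro_closure (var_H p) (free_group A) H"
begin

lemma subgroup_H: "subgroup H (free_group A)"
  using H by (simp add: fin_gen_subgroup_def)

sublocale H: free_group_subgroup A H
  by (rule free_group_subgroup.intro) (rule subgroup_H)

sublocale K: free_group_subgroup A K
  unfolding K_def
  by (rule free_group_subgroup.intro) (rule subgroup_pro_closure[OF p group_free_group subgroup_H])

lemma H_subset_K: "H \<subseteq> K"
  unfolding K_def by (rule subset_pro_closure[OF p group_free_group subgroup.subset[OF subgroup_H]])

lemma finite_met: "finite (met_vertices A H H)"
proof -
  obtain S where "finite S" "S \<subseteq> carrier (free_group A)" "H = generate (free_group A) S"
    using H by (auto simp: fin_gen_subgroup_def)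
  then show ?thesis by (rule H.finite_met_vertices)
qed

lemma K_coset_eq:
  assumes "H.coset y = H.coset z" "y \<in> carrier (free_group A)" "z \<in> carrier (free_group A)"
  shows "K.coset y = K.coset z"
  using assms H_subset_K H.coset_eq_iff[OF assms(2,3)] K.coset_eq_iff[OF assms(2,3)] by blast

text \<open>The elements of \<open>K\<close> cross every edge of the coset graph of \<open>K\<close> that is not met by \<open>H\<close> with an
  exponent sum divisible by \<open>p\<close>.  Indeed, choose an open normal subgroup \<open>N\<close> such that, in the coset
  graph of \<open>NH\<close>, the edge still differs from the finitely many edges that matter.  There, the elements
  of \<open>H\<close> do not cross the edge at all, and the elements of some smaller open normal subgroup
  cross it with exponent sum divisible by \<open>p\<close>.\<close>

lemma dvd_exp_along:
  assumes v: "v \<in> K" and x: "x \<in> carrier (free_group A)" and not_met: "(K.coset x, a) \<notin> met_edges A H K"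
  shows "int p dvd exp_along (K.coset x) a [] v"
proof -
  let ?F = "free_group A"
  have vF: "v \<in> carrier ?F" by (rule K.K_carrier[OF v])
  have wx: "winv x \<in> carrier ?F" by (rule K.winv_in_carrier[OF x])
  have red: "reduced_word g" if "g \<in> carrier ?F" for g using that by (simp add: carrier_free_group)
  have "met_vertices A H H \<subseteq> H.coset ` carrier ?F"
    using H.met_vertices_subset by (auto simp: RCOSETS_def)
  then obtain Y1 where Y1: "finite Y1" "Y1 \<subseteq> carrier ?F" "met_vertices A H H = H.coset ` Y1"
    using finite_subset_image[OF finite_met] by metis
  define Y2 where "Y2 = (\<lambda>n. take n v) ` {..length v}"
  have Y2: "u \<in> Y2" if "v = u @ z" for u z
    using that unfolding Y2_def by (intro image_eqI[of _ _ "length u"]) auto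
  have Y2F: "Y2 \<subseteq> carrier ?F"
    using vF carrier_free_group_append(1)[of "take n v" "drop n v" A for n] by (auto simp: Y2_def)
  define Z where "Z = (\<lambda>y. reduce (y @ winv x)) ` (Y1 \<union> Y2) - K"
  have "finite Z" using Y1 by (simp add: Z_def Y2_def)
  moreover have "Z \<subseteq> carrier ?F"
    using Y1(2) Y2F wx K.reduce_append_in_carrier by (auto simp: Z_def)
  moreover have "Z \<inter> pro_closure (var_H p) ?F H = {}" by (auto simp: Z_def K_def)
  ultimately obtain N where N: "N \<lhd> ?F" "var_H p (?F Mod N)"
    and sep: "\<And>z n. z \<in> Z \<Longrightarrow> n \<in> N \<Longrightarrow> n \<otimes>\<^bsub>?F\<^esub> z \<notin> H"
    using separate_finite[OF p group_free_group] by metis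
  interpret N: normal N ?F by (rule N(1))
  have NF: "n \<in> carrier ?F" if "n \<in> N" for n using that by (rule N.mem_carrier)
  \<comment> \<open>The coset of \<open>x\<close> modulo \<open>NH\<close>.\<close>
  define S where "S = {g \<in> carrier ?F. \<exists>n\<in>N. reduce (n @ g @ winv x) \<in> H}"
  have S_iff: "y \<in> S \<longleftrightarrow> y \<in> K.coset x" if "y \<in> Y1 \<union> Y2" for y
  proof -
    have y: "y \<in> carrier ?F" using that Y1(2) Y2F by blast
    then have yx: "reduce (y @ winv x) \<in> carrier ?F" using wx K.reduce_append_in_carrier by blast
    have "y \<in> S \<longleftrightarrow> (\<exists>n\<in>N. n \<otimes>\<^bsub>?F\<^esub> reduce (y @ winv x) \<in> H)" using y by (simp add: S_def)
    also have "\<dots> \<longleftrightarrow> reduce (y @ winv x) \<in> K"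
    proof
      assume "\<exists>n\<in>N. n \<otimes>\<^bsub>?F\<^esub> reduce (y @ winv x) \<in> H"
      then have "reduce (y @ winv x) \<notin> Z" using sep by blast
      then show "reduce (y @ winv x) \<in> K" using that by (auto simp: Z_def)
    next
      assume "reduce (y @ winv x) \<in> K"
      then show "\<exists>n\<in>N. n \<otimes>\<^bsub>?F\<^esub> reduce (y @ winv x) \<in> H"
        using mem_pro_closure_iff[OF p group_free_group yx] N unfolding K_def by blast
    qed
    also have "\<dots> \<longleftrightarrow> y \<in> K.coset x" using K.mem_coset_iff[OF x y] by simp
    finally show ?thesis .
  qed
  have S_N: "reduce (n @ g) \<in> S" if "g \<in> S" "n \<in> N" for g n
  proof -
    from that obtain m where m: "m \<in> N" "reduce (m @ g @ winv x) \<in> H" and g: "g \<in> carrier ?F"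
      by (auto simp: S_def)
    have "m \<otimes>\<^bsub>?F\<^esub> inv\<^bsub>?F\<^esub> n \<in> N" using m(1) that(2) by (simp only: N.m_closed N.m_inv_closed)
    then have "reduce (m @ winv n) \<in> N" using NF[OF that(2)] by (simp add: inv_free_group)
    moreover have "reduce (reduce (m @ winv n) @ reduce (n @ g) @ winv x) \<in> H"
    proof -
      have "reduce (reduce (m @ winv n) @ reduce (n @ g) @ winv x) = reduce (m @ winv n @ n @ g @ winv x)"
        using reduce_append_middle[of "m @ winv n" "n @ g" "winv x"] by simp
      then show ?thesis using m(2) by (simp add: reduce_cancel_middle)
    qed
    ultimately show ?thesis
      using g NF[OF that(2)] K.reduce_append_in_carrier unfolding S_def by blast
  qed
  have S_N_iff: "reduce (n @ g) \<in> S \<longleftrightarrow> g \<in> S" if "n \<in> N" "g \<in> carrier ?F" for g n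
  proof
    assume "reduce (n @ g) \<in> S"
    moreover have "winv n \<in> N" using N.m_inv_closed[OF that(1)] NF[OF that(1)] by (simp add: inv_free_group)
    ultimately have "reduce (winv n @ reduce (n @ g)) \<in> S" by (rule S_N)
    then show "g \<in> S"
      using reduce_cancel_middle(1)[of "[]" n g] red[OF that(2)] by (simp add: reduce_reduced)
  qed (rule S_N[OF _ that(1)])
  have S_H: "reduce (h @ g) \<in> S" if "g \<in> S" "h \<in> H" for g h
  proof -
    from that obtain m where m: "m \<in> N" "reduce (m @ g @ winv x) \<in> H" and g: "g \<in> carrier ?F"
      by (auto simp: S_def)
    have hF: "h \<in> carrier ?F" using that(2) H.K_carrier by blast
    have "h \<otimes>\<^bsub>?F\<^esub> m \<otimes>\<^bsub>?F\<^esub> inv\<^bsub>?F\<^esub> h \<in> N" by (rule N.inv_op_closed2[OF hF m(1)])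
    then have "reduce (h @ m @ winv h) \<in> N" using hF by (simp add: inv_free_group)
    moreover have "reduce (reduce (h @ m @ winv h) @ reduce (h @ g) @ winv x) \<in> H"
    proof -
      have "reduce (reduce (h @ m @ winv h) @ reduce (h @ g) @ winv x) =
          reduce ((h @ m) @ winv h @ h @ g @ winv x)"
        using reduce_append_middle[of "h @ m @ winv h" "h @ g" "winv x"] by simp
      also have "\<dots> = reduce (h @ reduce (m @ g @ winv x))"
        by (subst reduce_cancel_middle) simp
      finally show ?thesis using H.reduce_append_in_K[OF that(2) m(2)] by simp
    qed
    ultimately show ?thesis
      using g hF K.reduce_append_in_carrier unfolding S_def by blast
  qed
  have zero: "exp_along S a [] h = 0" if h: "h \<in> H" for h
  proof (rule exp_along_eq_0)
    fix u l z assume split: "h = u @ l # z" "fst l = a"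
    let ?q = "if snd l then u else u @ [l]"
    have in_H: "u @ l # z \<in> H" using split h by simp
    have qF: "?q \<in> carrier ?F" and q_red: "reduce ?q = ?q"
      using H.split_in_K[OF in_H] by (auto simp: carrier_free_group reduce_reduced)
    have "fst (H.crossed u l) \<in> met_edges A H H"
      by (rule H.crossed_in_met_edges[OF subgroup_H subset_refl in_H])
    then have "(H.coset ?q, a) \<in> met_edges A H H"
      using split H.split_in_K[OF in_H] by (auto simp: H.crossed_def split: if_splits)
    then obtain y z' where y: "H.coset ?q = H.coset y" "y @ (a, True) # z' \<in> H"
      by (auto simp: met_edges_def)
    have yF: "y \<in> carrier ?F" using H.split_in_K[OF y(2)] by simp
    have "H.coset y \<in> met_vertices A H H" by (rule H.coset_in_met_vertices[OF y(2)])
    then obtain y1 where y1: "y1 \<in> Y1" "H.coset y = H.coset y1" using Y1(3) by auto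
    have y1F: "y1 \<in> carrier ?F" using y1 Y1(2) by blast
    show "reduce ([] @ ?q) \<notin> S"
    proof
      assume "reduce ([] @ ?q) \<in> S"
      then have "?q \<in> S" using q_red by simp
      moreover have "reduce (y1 @ winv ?q) \<in> H"
        using H.coset_eq_iff[OF y1F qF] y y1 by simp
      ultimately have "reduce (reduce (y1 @ winv ?q) @ ?q) \<in> S" by (rule S_H)
      then have "y1 \<in> S"
        using reduce_cancel_middle(1)[of y1 ?q "[]"] red[OF y1F] by (simp add: reduce_reduced)
      then have "y1 \<in> K.coset x" using S_iff y1 by blast
      then have "K.coset y1 = K.coset x"
        using K.mem_coset_iff[OF x y1F] K.coset_eq_iff[OF y1F x] by simp
      then have "K.coset x = K.coset y" using K_coset_eq[OF y1(2) yF y1F] by simp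
      then show False using not_met y(2) by (auto simp: met_edges_def)
    qed
  qed simp
  define N' where "N' = {n \<in> N. \<forall>g\<in>carrier ?F. int p dvd exp_along S a g n}"
  have "N' \<lhd> ?F \<and> var_H p (?F Mod N')"
  proof (rule var_H_crossed_hom_kernel[OF p N _ _ N'_def])
    fix g u w assume "g \<in> carrier ?F" "u \<in> carrier ?F" "w \<in> carrier ?F"
    then show "exp_along S a g (u \<otimes>\<^bsub>?F\<^esub> w) = exp_along S a g u + exp_along S a (g \<otimes>\<^bsub>?F\<^esub> u) w"
      using red[of g] by (simp add: exp_along_reduce exp_along_append)
  next
    fix n g u assume n: "n \<in> N" and g: "g \<in> carrier ?F" and u: "u \<in> carrier ?F"
    have "fst ` set u \<subseteq> A" using u by (simp add: carrier_free_group)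
    from K.exp_along_left_invariant[OF S_N_iff[OF n] g this]
    show "exp_along S a (n \<otimes>\<^bsub>?F\<^esub> g) u = exp_along S a g u" by simp
  qed
  then obtain n where n: "n \<in> N'" "n \<otimes>\<^bsub>?F\<^esub> v \<in> H"
    using v mem_pro_closure_iff[OF p group_free_group vF] unfolding K_def by blast
  then have nN: "n \<in> N" and dvd: "int p dvd exp_along S a [] n"
    using H.F.one_closed unfolding N'_def by auto
  have "0 = exp_along S a [] (n @ v)"
    using zero[OF n(2)] by (simp add: exp_along_reduce)
  also have "\<dots> = exp_along S a [] n + exp_along S a (reduce (n @ [])) v"
    by (simp add: exp_along_append)
  also have "exp_along S a (reduce (n @ [])) v = exp_along S a [] v"
    using S_N_iff[OF nN] H.F.one_closed vF
    by (intro K.exp_along_left_invariant) (auto simp: carrier_free_group)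
  also have "exp_along S a [] v = exp_along (K.coset x) a [] v"
  proof (rule exp_along_cong)
    fix u z assume "v = u @ z"
    then have "u \<in> Y2" "reduce u = u"
      using Y2 vF by (auto simp: carrier_free_group reduced_word_append reduce_reduced)
    then show "reduce ([] @ u) \<in> S \<longleftrightarrow> reduce ([] @ u) \<in> K.coset x" using S_iff by simp
  qed simp
  finally show ?thesis using dvd by (metis dvd_add_right_iff dvd_0_right)
qed

text \<open>The edges that are not met by \<open>H\<close> are the bad ones; the others are joined to the base vertex by paths
  labeled with prefixes of elements of \<open>H\<close>, which avoid bad edges.\<close>

lemma met_edges_subset: "met_edges A K K \<subseteq> met_edges A H K"
proof (rule ccontr)
  let ?C = "core_graph A K" and ?B = "met_edges A K K - met_edges A H K"
  assume "\<not> met_edges A K K \<subseteq> met_edges A H K"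
  then obtain e where e: "e \<in> ?B" by blast
  then obtain y a z where y: "e = (K.coset y, a)" "y @ (a, True) # z \<in> K" by (auto simp: met_edges_def)
  let ?d = "K.crossed y (a, True)"
  have d: "fst ?d = e" using y by (simp add: K.crossed_def)
  note ya = K.split_in_K[OF y(2)]
  have in1: "[] @ y @ ((a, True) # z) \<in> K" and in2: "(y @ [(a, True)]) @ z @ [] \<in> K" using y by auto
  obtain \<pi>1 where \<pi>1: "lpath ?C K \<pi>1 (K.coset y)" "path_label ?C \<pi>1 = y"
    using K.ex_lpath_core_graph[OF K.K subset_refl in1] by auto
  obtain \<pi>2 where \<pi>2: "lpath ?C (K.coset (y @ [(a, True)])) \<pi>2 K" "path_label ?C \<pi>2 = z"
    using K.ex_lpath_core_graph[OF K.K subset_refl in2] K.coset_eq_K_iff[OF K.K_carrier[OF y(2)]] y(2) by auto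
  let ?\<pi> = "\<pi>1 @ ?d # \<pi>2"
  have loop: "lpath ?C K ?\<pi> K"
    using \<pi>1 \<pi>2 e d K.crossed_simps[OF ya(1,2)] ya(4)
    by (auto simp: lpath_append[OF K.wf_core_graph])
  have "path_label ?C ?\<pi> = y @ (a, True) # z"
    using \<pi>1 \<pi>2 K.crossed_simps[OF ya(1,2)] by simp
  then have "reduced_word ?\<pi>"
    using reduced_path_label[OF K.deterministic_core_graph loop] K.K_carrier[OF y(2)]
    by (simp add: carrier_free_group)
  moreover have "\<exists>d\<in>set ?\<pi>. fst d \<in> ?B" using e d by auto
  moreover have "\<exists>\<rho>. lpath ?C K \<rho> (src ?C d) \<and> fst ` set \<rho> \<inter> ?B = {}" if dB: "fst d \<in> arcs\<^sub>L ?C - ?B" for d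
  proof -
    have "fst d \<in> met_edges A H K" using dB by auto
    then obtain u b w where u: "fst d = (K.coset u, b)" "u @ (b, True) # w \<in> H" by (auto simp: met_edges_def)
    have in_K: "u @ (b, True) # w \<in> K" using u H_subset_K by blast
    note ub = K.split_in_K[OF in_K]
    define q where "q = (if snd d then u else u @ [(b, True)])"
    have "src ?C d = K.coset q"
      using u ub by (auto simp: src_def q_def K.coset_mult K.singleton_in_carrier)
    moreover have "\<exists>r. [] @ q @ r \<in> H" using u(2) by (auto simp: q_def)
    then obtain \<rho> where "lpath ?C K \<rho> (K.coset q)" "fst ` set \<rho> \<subseteq> met_edges A H K"
      using K.ex_lpath_core_graph[OF subgroup_H H_subset_K, of "[]" q] by auto
    ultimately show ?thesis by auto
  qed
  ultimately obtain \<sigma> e' where \<sigma>: "lpath ?C K \<sigma> K" and e': "e' \<in> ?B" "\<bar>exp_sum e' \<sigma>\<bar> = 1"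
    using ex_loop_exp_sum_1[OF K.wf_core_graph loop, of ?B] by blast
  obtain x b where x: "e' = (K.coset x, b)" "x \<in> carrier (free_group A)"
    using e' K.split_in_K by (auto simp: met_edges_def)
  let ?w = "path_label ?C \<sigma>"
  have \<sigma>': "lpath ?C (K.coset []) \<sigma> K" using \<sigma> by simp
  have "fst ` set ?w \<subseteq> A \<and> K = K.coset (reduce ([] @ ?w))"
    by (rule K.lpath_coset_graph_target[OF K.met_edges_subset_rcosets H.F.one_closed[unfolded one_free_group] \<sigma>'])
  then have "reduce ?w \<in> K"
    using K.self_in_coset[OF reduce_in_carrier] by auto
  then have "int p dvd exp_along (K.coset x) b [] (reduce ?w)"
    by (rule dvd_exp_along) (use x e' in auto)
  also have "exp_along (K.coset x) b [] (reduce ?w) = exp_along (K.coset x) b [] ?w"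
    by (simp add: exp_along_reduce)
  also have "\<dots> = exp_sum e' \<sigma>"
    using K.exp_sum_eq_exp_along[OF K.met_edges_subset_rcosets x(2) H.F.one_closed[unfolded one_free_group] \<sigma>'] x(1)
    by simp
  finally have "int p dvd \<bar>exp_sum e' \<sigma>\<bar>" by simp
  then show False using e'(2) p by simp
qed

text \<open>A vertex of the core graph of \<open>K\<close> other than the base vertex is the end of an edge, which is met by \<open>H\<close>.\<close>

lemma met_vertices_subset: "met_vertices A K K \<subseteq> met_vertices A H K"
proof
  fix c assume "c \<in> met_vertices A K K"
  then obtain y z where y: "c = K.coset y" "y @ z \<in> K" by (auto simp: met_vertices_def)
  show "c \<in> met_vertices A H K"
  proof (cases y rule: rev_cases)
    case Nil
    then show ?thesis
      using y H.Nil_in_K unfolding met_vertices_def by (intro CollectI exI[of _ "[]"]) simp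
  next
    case (snoc y' l)
    have in_K: "y' @ l # z \<in> K" using y snoc by simp
    note yl = K.split_in_K[OF in_K]
    have "fst (K.crossed y' l) \<in> met_edges A H K"
      using K.crossed_in_met_edges[OF K.K subset_refl in_K] met_edges_subset by blast
    then obtain u b w where u: "fst (K.crossed y' l) = (K.coset u, b)" "u @ (b, True) # w \<in> H"
      by (auto simp: met_edges_def)
    have u_in_K: "u @ (b, True) # w \<in> K" using u H_subset_K by blast
    note ub = K.split_in_K[OF u_in_K]
    show ?thesis
    proof (cases "snd l")
      case True
      then have l: "l = (b, True)" "K.coset y' = K.coset u" using u by (cases l; simp add: K.crossed_def)+
      have "c = K.coset (reduce (y' @ [l]))" using y snoc yl by simp
      also have "\<dots> = K.coset (reduce (u @ [l]))"
        using l yl ub by (intro K.coset_mult_cong) (auto simp: K.singleton_in_carrier)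
      finally have "c = K.coset (u @ [(b, True)])" using l ub by simp
      moreover have "(u @ [(b, True)]) @ w \<in> H" using u by simp
      ultimately show ?thesis unfolding met_vertices_def by blast
    next
      case False
      then have "c = K.coset u" using u y snoc yl by (simp add: K.crossed_def)
      then show ?thesis using u(2) unfolding met_vertices_def by blast
    qed
  qed
qed

lemma overgroup: "K \<in> overgroups A H"
  by (rule K.overgroupI[OF subgroup_H H_subset_K A finite_met met_vertices_subset met_edges_subset])

end

theorem corollary3p2:
  fixes p :: nat and A :: "'a set" and H :: "'a word set"
  assumes "prime p"
    and "finite A"
    and "fin_gen_subgroup H (free_group A)"
  shows "pro_closure (var_H p) (free_group A) H \<in> overgroups A H"
proof -
  interpret closed_hull A H "pro_closure (var_H p) (free_group A) H" p
    by (rule closed_hull.intro) (use assms in simp_all)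
  show ?thesis by (rule overgroup)
qed

end
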